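(* Consider the sparse $\beta$-model (S$\beta$M) on $n$ nodes with true parameter $(\mu_0,\boldsymbol\beta_0)$, whose support $S=S(\boldsymbol\beta_0)$ is known, and let $s_0=|S|$; here $\mu_0$, $\boldsymbol\beta_0$, $S$ and $s_0$ may depend on $n$, and $s_0$ may tend to infinity as $n\to\infty$. Consider the reparameterization $$\mu=-\gamma\log n+\mu^\dagger,\qquad \beta_i=\alpha\log n+\beta_i^\dagger\ \text{ for all } i\in S,$$ for some (fixed) $\gamma\in[0,2)$ and $\alpha\in[0,1)$ such that $0\le\gamma-\alpha<1$. Let $[-M_1^\dagger,M_1^\dagger]\times[0,M_2^\dagger]^{s_0}$ be the parameter space for $(\mu^\dagger,\boldsymbol\beta_S^\dagger)$, where $M_1^\dagger>0$ and $M_2^\dagger>0$ may depend on $n$ but satisfy $\max\{M_1^\dagger,M_2^\dagger\}=o(\log n)$. Denote by $(\mu_0^\dagger,\boldsymbol\beta_{0S}^\dagger)$ the true parameter value for $(\mu^\dagger,\boldsymbol\beta_S^\dagger)$, which may depend on $n$ but belongs to the parameter space. Let $(\hat\mu^\dagger,\hat{\boldsymbol\beta}_S^\dagger)$ be an MLE of $(\mu^\dagger,\boldsymbol\beta_S^\dagger)$ over this parameter space (the MLE need not be unique). Then the following hold as $n\to\infty$. (i) If in addition $s_0=\overline{o}(n^{1-\alpha})$, then $$\hat\mu^\dagger=\mu_0^\dagger+\overline{o}_P(1)\quad\text{and}\quad \max_{i\in S}|\hat\beta_i^\dagger-\beta_{0i}^\dagger|=\overline{o}_P(1).$$ (ii)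 If in addition $|\mu_0^\dagger|\le M_1^\dagger-\eta$ and $\eta\le\min_{i\in S}\beta_{0i}^\dagger\le\max_{i\in S}\beta_{0i}^\dagger\le M_2^\dagger-\eta$ for some small constant $0<\eta<\min\{M_1^\dagger,M_2^\dagger\}$ independent of $n$, and $s_0=\overline{o}(n^{(1-\alpha)/2})$, then for any fixed subset $F\subset S$, $$\Sigma_F^{-1/2}\begin{pmatrix} n^{1-\gamma/2}(\hat\mu^\dagger-\mu_0^\dagger)\\ n^{1/2-(\gamma-\alpha)/2}(\hat\beta_i^\dagger-\beta_{0i}^\dagger)_{i\in F}\end{pmatrix}\stackrel{d}{\to}N(\boldsymbol 0,I_{1+|F|}),$$ where $\Sigma_F$ is the diagonal matrix whose first diagonal entry (for $\mu^\dagger$) and remaining diagonal entries (indexed by $i\in F$) are $$\begin{cases}2e^{-\mu_0^\dagger}\ \text{and}\ e^{-\mu_0^\dagger-\beta_{0i}^\dagger}\ \text{for } i\in F & \text{if }\alpha<\gamma,\\ 2e^{-\mu_0^\dagger}\ \text{and}\ 2+e^{-\mu_0^\dagger-\beta_{0i}^\dagger}+e^{\mu_0^\dagger+\beta_{0i}^\dagger}\ \text{for } i\in F& \text{if }\gamma=\alpha\in(0,1),\\ 4+2e^{-\mu_0^\dagger}+2e^{\mu_0^\dagger}\ \text{and}\ 2+e^{-\mu_0^\dagger-\beta_{0i}^\dagger}+e^{\mu_0^\dagger+\beta_{0i}^\dagger}\ \text{for } i\in F& \text{if }\gamma=\alpha=0.\end{cases}$$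
   Context: Sparse $\beta$-model (S$\beta$M): an undirected random graph on nodes $\{1,\dots,n\}$ without self-loops, with symmetric adjacency matrix $A=(A_{ij})$, $A_{ii}=0$, where $(A_{ij})_{1\le i<j\le n}$ are independent Bernoulli random variables with $$P(A_{ij}=1)=p_{ij}=\frac{e^{\mu+\beta_i+\beta_j}}{1+e^{\mu+\beta_i+\beta_j}},$$ $\mu\in\mathbb R$, $\boldsymbol\beta=(\beta_1,\dots,\beta_n)^T\in[0,\infty)^n$, and $\min_{1\le i\le n}\beta_i=0$ (identifiability). The support is $S(\boldsymbol\beta)=\{i:\beta_i\neq0\}$, and $\boldsymbol\beta_S$ is the subvector of $\boldsymbol\beta$ with indices in $S$. Degrees: $d_i=\sum_{j\ne i}A_{ij}$; number of edges: $d_+=\sum_{1\le i<j\le n}A_{ij}$. The negative log-likelihood is $\ell_n(\mu,\boldsymbol\beta)=-d_+\mu-\sum_{i=1}^n d_i\beta_i+\sum_{1\le i<j\le n}\log(1+e^{\mu+\beta_i+\beta_j})$. With known support $S$, an MLE of $(\mu^\dagger,\boldsymbol\beta^\dagger_S)$ over a parameter space is a minimizer over that space of $\ell_n(\mu,\boldsymbol\beta)$ with $\mu=-\gamma\log n+\mu^\dagger$, $\beta_i=\alpha\log n+\beta_i^\dagger$ for $i\in S$, and $\beta_i=0$ for $i\notin S$. The data are generated from the S$\beta$M with parameter $(\mu_0,\boldsymbol\beta_0)$. Notation: for positive sequences, $a_n=\overline{o}(b_n)$ means $a_n=O(n^{-c}b_n)$ for some (sufficiently small) fixed constant $c>0$;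 analogously, for stochastic sequences, $a_n=\overline{o}_P(b_n)$ means $a_n=O_P(n^{-c}b_n)$ for some fixed constant $c>0$. $I_k$ is the $k\times k$ identity matrix. "Fixed subset $F\subset S$" means that $F$ does not depend on $n$. *)

theory Defs
  imports "HOL-Probability.Probability" "HOL-Library.Landau_Symbols"
begin

section \<open>The sparse beta-model\<close>

definition node_pairs :: "nat \<Rightarrow> (nat \<times> nat) set" where
  "node_pairs n = {(i, j). 1 \<le> i \<and> i < j \<and> j \<le> n}"

definition edge_prob :: "real \<Rightarrow> (nat \<Rightarrow> real) \<Rightarrow> nat \<Rightarrow> nat \<Rightarrow> real" where
  "edge_prob \<mu> \<beta> i j = exp (\<mu> + \<beta> i + \<beta> j) / (1 + exp (\<mu> + \<beta> i + \<beta> j))"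

definition beta_support :: "nat \<Rightarrow> (nat \<Rightarrow> real) \<Rightarrow> nat set" where
  "beta_support n \<beta> = {i \<in> {1..n}. \<beta> i \<noteq> 0}"

text \<open>The nodes are \<open>{1..n}\<close>; values of \<open>A\<close> and \<open>\<beta>\<close> outside this range are irrelevant.\<close>

locale sparse_beta_model = prob_space M
  for M :: "'w measure" and n :: nat and \<mu> :: real and \<beta> :: "nat \<Rightarrow> real"
    and A :: "'w \<Rightarrow> nat \<Rightarrow> nat \<Rightarrow> bool" +
  assumes beta_nonneg: "\<And>i. i \<in> {1..n} \<Longrightarrow> 0 \<le> \<beta> i"
    and beta_min: "Min (\<beta> ` {1..n}) = 0"
    and no_loops: "\<And>\<omega> i. \<omega> \<in> space M \<Longrightarrow> i \<in> {1..n} \<Longrightarrow> \<not> A \<omega> i i"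
    and symmetric: "\<And>\<omega> i j. \<omega> \<in> space M \<Longrightarrow> i \<in> {1..n} \<Longrightarrow> j \<in> {1..n} \<Longrightarrow> A \<omega> i j = A \<omega> j i"
    and edges_indep: "indep_vars (\<lambda>_. count_space UNIV) (\<lambda>(i, j) \<omega>. A \<omega> i j) (node_pairs n)"
    and edges_bernoulli: "\<And>i j. (i, j) \<in> node_pairs n \<Longrightarrow>
      distr M (count_space UNIV) (\<lambda>\<omega>. A \<omega> i j) = measure_pmf (bernoulli_pmf (edge_prob \<mu> \<beta> i j))"

definition node_degree :: "nat \<Rightarrow> (nat \<Rightarrow> nat \<Rightarrow> bool) \<Rightarrow> nat \<Rightarrow> real" where
  "node_degree n a i = (\<Sum>j\<in>{1..n} - {i}. of_bool (a i j))"

definition num_edges :: "nat \<Rightarrow> (nat \<Rightarrow> nat \<Rightarrow> bool) \<Rightarrow> real" where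
  "num_edges n a = (\<Sum>(i, j)\<in>node_pairs n. of_bool (a i j))"

definition neg_loglik :: "nat \<Rightarrow> (nat \<Rightarrow> nat \<Rightarrow> bool) \<Rightarrow> real \<Rightarrow> (nat \<Rightarrow> real) \<Rightarrow> real" where
  "neg_loglik n a \<mu> \<beta> =
     - num_edges n a * \<mu> - (\<Sum>i\<in>{1..n}. node_degree n a i * \<beta> i)
     + (\<Sum>(i, j)\<in>node_pairs n. ln (1 + exp (\<mu> + \<beta> i + \<beta> j)))"

section \<open>Reparameterization and maximum likelihood with known support\<close>

definition mu_of :: "real \<Rightarrow> nat \<Rightarrow> real \<Rightarrow> real" where
  "mu_of \<gamma> n m = - \<gamma> * ln (real n) + m"

definition beta_of :: "real \<Rightarrow> nat \<Rightarrow> nat set \<Rightarrow> (nat \<Rightarrow> real) \<Rightarrow> nat \<Rightarrow> real" where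
  "beta_of \<alpha> n S b i = (if i \<in> S then \<alpha> * ln (real n) + b i else 0)"

text \<open>A vector indexed by \<open>S\<close> is represented by a function of which only the values on \<open>S\<close> matter.\<close>

definition param_space :: "nat set \<Rightarrow> real \<Rightarrow> real \<Rightarrow> (real \<times> (nat \<Rightarrow> real)) set" where
  "param_space S M1 M2 = {(m, b). m \<in> {- M1..M1} \<and> (\<forall>i\<in>S. b i \<in> {0..M2})}"

definition is_mle ::
  "real \<Rightarrow> real \<Rightarrow> nat \<Rightarrow> nat set \<Rightarrow> real \<Rightarrow> real \<Rightarrow> (nat \<Rightarrow> nat \<Rightarrow> bool) \<Rightarrow> real \<Rightarrow> (nat \<Rightarrow> real) \<Rightarrow> bool" where
  "is_mle \<gamma> \<alpha> n S M1 M2 a mhat bhat \<longleftrightarrow>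
     is_arg_min (\<lambda>(m, b). neg_loglik n a (mu_of \<gamma> n m) (beta_of \<alpha> n S b))
       (\<lambda>x. x \<in> param_space S M1 M2) (mhat, bhat)"

section \<open>Asymptotic notation\<close>

definition bar_o :: "(nat \<Rightarrow> real) \<Rightarrow> (nat \<Rightarrow> real) \<Rightarrow> bool" where
  "bar_o a b \<longleftrightarrow> (\<exists>c>0. a \<in> O(\<lambda>n. real n powr (- c) * b n))"

definition big_O_P :: "(nat \<Rightarrow> 'w measure) \<Rightarrow> (nat \<Rightarrow> 'w \<Rightarrow> real) \<Rightarrow> (nat \<Rightarrow> real) \<Rightarrow> bool" where
  "big_O_P M X r \<longleftrightarrow>
     (\<forall>\<epsilon>>0. \<exists>K>0. \<forall>\<^sub>F n in sequentially.
        measure (M n) {\<omega> \<in> space (M n). \<bar>X n \<omega>\<bar> > K * r n} \<le> \<epsilon>)"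

definition bar_o_P :: "(nat \<Rightarrow> 'w measure) \<Rightarrow> (nat \<Rightarrow> 'w \<Rightarrow> real) \<Rightarrow> (nat \<Rightarrow> real) \<Rightarrow> bool" where
  "bar_o_P M X b \<longleftrightarrow> (\<exists>c>0. big_O_P M X (\<lambda>n. real n powr (- c) * b n))"

text \<open>The inserted \<open>0\<close> only makes the maximum over the empty set equal to \<open>0\<close>.\<close>

definition max_abs :: "nat set \<Rightarrow> (nat \<Rightarrow> real) \<Rightarrow> real" where
  "max_abs S v = Max (insert 0 ((\<lambda>i. \<bar>v i\<bar>) ` S))"

section \<open>Convergence in distribution of random vectors\<close>

text \<open>
  Random vectors with a finite index set \<open>I\<close> take values in the product space
  \<open>PiM I (\<lambda>_. borel)\<close>. The library's \<open>weak_conv_m\<close> covers only the one-dimensional case.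
\<close>

definition weak_conv_vec ::
  "'i set \<Rightarrow> (nat \<Rightarrow> ('i \<Rightarrow> real) measure) \<Rightarrow> ('i \<Rightarrow> real) measure \<Rightarrow> bool" where
  "weak_conv_vec I P Q \<longleftrightarrow>
     (\<forall>f. continuous_map (product_topology (\<lambda>_. euclideanreal) I) euclideanreal f \<longrightarrow>
          bounded (f ` (I \<rightarrow>\<^sub>E UNIV)) \<longrightarrow>
          (\<lambda>n. integral\<^sup>L (P n) f) \<longlonglongrightarrow> integral\<^sup>L Q f)"

definition std_normal_vec :: "'i set \<Rightarrow> ('i \<Rightarrow> real) measure" where
  "std_normal_vec I = PiM I (\<lambda>_. std_normal_distribution)"

text \<open>
  The coordinates of the limit vector are indexed by \<open>None\<close> (for \<open>\<mu>\<close>) and \<open>Some i\<close> with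
  \<open>i \<in> F\<close> (for \<open>\<beta> i\<close>).
\<close>

definition coords :: "nat set \<Rightarrow> nat option set" where
  "coords F = insert None (Some ` F)"

text \<open>Diagonal entries of \<open>\<Sigma>\<^sub>F\<close>; the last branch is meant for \<open>\<gamma> = \<alpha> = 0\<close>.\<close>

definition Sigma_diag :: "real \<Rightarrow> real \<Rightarrow> real \<Rightarrow> (nat \<Rightarrow> real) \<Rightarrow> nat option \<Rightarrow> real" where
  "Sigma_diag \<gamma> \<alpha> m b k =
     (if \<alpha> < \<gamma> then
        (case k of None \<Rightarrow> 2 * exp (- m)
                 | Some i \<Rightarrow> exp (- m - b i))
      else if 0 < \<alpha> then
        (case k of None \<Rightarrow> 2 * exp (- m)
                 | Some i \<Rightarrow> 2 + exp (- m - b i) + exp (m + b i))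
      else
        (case k of None \<Rightarrow> 4 + 2 * exp (- m) + 2 * exp m
                 | Some i \<Rightarrow> 2 + exp (- m - b i) + exp (m + b i)))"

definition scaled_error ::
  "real \<Rightarrow> real \<Rightarrow> nat \<Rightarrow> real \<Rightarrow> (nat \<Rightarrow> real) \<Rightarrow> real \<Rightarrow> (nat \<Rightarrow> real) \<Rightarrow> nat option \<Rightarrow> real" where
  "scaled_error \<gamma> \<alpha> n m b mhat bhat k =
     (case k of None \<Rightarrow> real n powr (1 - \<gamma> / 2) * (mhat - m)
              | Some i \<Rightarrow> real n powr (1 / 2 - (\<gamma> - \<alpha>) / 2) * (bhat i - b i))"

text \<open>The matrix being diagonal, \<open>\<Sigma>\<^sub>F\<close> to the power \<open>-1/2\<close> acts coordinatewise.\<close>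

definition standardized_error ::
  "real \<Rightarrow> real \<Rightarrow> nat \<Rightarrow> nat set \<Rightarrow> real \<Rightarrow> (nat \<Rightarrow> real) \<Rightarrow> real \<Rightarrow> (nat \<Rightarrow> real) \<Rightarrow> nat option \<Rightarrow> real" where
  "standardized_error \<gamma> \<alpha> n F m b mhat bhat =
     (\<lambda>k\<in>coords F. Sigma_diag \<gamma> \<alpha> m b k powr (- 1 / 2) * scaled_error \<gamma> \<alpha> n m b mhat bhat k)"

end

theory Submission
  imports Defs "HOL-Real_Asymp.Real_Asymp"
begin

text \<open>
  Nodes outside \<open>S\<close> have \<open>\<beta> = 0\<close>, so with \<open>\<rho> = \<gamma> - \<alpha>\<close> the pairs of nodes fall into three
  classes. About \<open>n\<^sup>2/2\<close> outer pairs (no end in \<open>S\<close>) share one edge probability of order \<open>n powr - \<gamma>\<close>,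
  which depends on \<open>\<mu>\<close> alone. Each \<open>i \<in> S\<close> has about \<open>n\<close> pairs with outside nodes, and these share one
  edge probability of order \<open>n powr - \<rho>\<close>, which depends on \<open>\<mu> + \<beta> i\<close> alone. The at most \<open>s\<^sup>2\<close> inner pairs
  (both ends in \<open>S\<close>) have probabilities of order at most \<open>n powr (min 0 (2 * \<alpha> - \<gamma>))\<close>. All orders hold up to
  factors \<open>exp (O (M1 + M2))\<close>, which are below \<open>n powr \<epsilon>\<close> for every fixed \<open>\<epsilon> > 0\<close>. Up to terms that the sparsity
  of \<open>S\<close> makes negligible, the problem is therefore a family of one-parameter problems: the outer pairs
  determine \<open>\<mu>\<close>, and then the pairs from \<open>i\<close> to the outside determine \<open>\<beta> i\<close>.

  Consistency. The objective is minimal in each coordinate separately, so a coordinate of the estimator that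
  lies above its true value is not at the lower end of its interval and has a nonpositive partial derivative;
  the situation below the true value is symmetric. This yields one-sided score inequalities for boundary
  estimators as well (\<open>mle_score_mu\<close>, \<open>mle_score_beta\<close>), and they bound first \<open>\<mu>hat - \<mu>\<close> and then each
  \<open>\<beta>hat i - \<beta> i\<close> by noise, by the contribution of the other classes, and, for \<open>\<beta>\<close>, by the error in \<open>\<mu>\<close>
  (\<open>mu_error_bound\<close>, \<open>beta_error_bound\<close>). A Chernoff bound (\<open>noise_tail\<close>) controls the noise of all
  degrees simultaneously, because its exponential tail absorbs a union over \<open>n\<close> events. The result is
  \<open>consistency\<close>: every error is at most \<open>n powr - c'\<close> outside an event of vanishing probability.

  Normality. By consistency the estimator is interior and solves the score equations. Subtracting the
  equations of all \<open>i \<in> S\<close> from the one for \<open>\<mu>\<close> cancels the mixed pairs exactly and leaves outer minus inner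
  pairs (\<open>sum_pairs_minus_stars\<close>). The inner terms are negligible even by crude bounds: since
  \<open>min 0 (2 * \<alpha> - \<gamma>) \<le> \<alpha> - \<gamma> / 2\<close>, the condition \<open>s \<le> n powr ((1 - \<alpha>) / 2 - c)\<close> places them below the
  standard deviations \<open>n powr (1 - \<gamma> / 2)\<close> and \<open>n powr ((1 - \<rho>) / 2)\<close> of the leading terms by a power of \<open>n\<close>.
  Linearizing the logistic function (\<open>logistic_score_inversion\<close>) expresses each error, rescaled, as a
  standardized edge count over outer pairs, or over the pairs from \<open>i\<close> to the outside, plus a negligible
  remainder (\<open>linearization\<close>). These edge counts run over disjoint sets of pairs, hence are exactly independent,
  and each is binomial. So the vector limit theorem reduces to a one-dimensional central limit theorem for
  binomial variables with growing variance (\<open>noise_char\<close>, \<open>weak_conv_m_from_char_bound\<close>), to weak convergence of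
  product measures, obtained by coupling each coordinate as in Skorohod's theorem (\<open>weak_conv_PiM\<close>), and to a
  Slutsky argument (\<open>weak_conv_vec_perturb\<close>). Finally the actual variances are compared with \<open>Sigma_diag\<close>
  (\<open>dlogistic_limit\<close>).
\<close>

section \<open>The logistic function\<close>

definition logistic :: "real \<Rightarrow> real" where
  "logistic x = exp x / (1 + exp x)"

text \<open>
  The derivative of \<open>logistic\<close>; at an edge's log-odds it is also the variance of the edge indicator.
\<close>

definition dlogistic :: "real \<Rightarrow> real" where
  "dlogistic x = exp x / (1 + exp x)\<^sup>2"

lemma edge_prob_logistic: "edge_prob \<mu> \<beta> i j = logistic (\<mu> + \<beta> i + \<beta> j)"
  by (simp add: edge_prob_def logistic_def)

lemma one_plus_exp_pos [simp]: "1 + exp (x::real) > 0" "1 + exp (x::real) \<noteq> 0"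
  using exp_gt_zero[of x] by linarith+

lemma logistic_pos: "0 < logistic x"
  by (simp add: logistic_def)

lemma logistic_less_1: "logistic x < 1"
  by (simp add: logistic_def)

lemma logistic_le_exp: "logistic x \<le> exp x"
  by (simp add: logistic_def field_simps)

lemma has_field_derivative_logistic [derivative_intros]:
  "(f has_field_derivative f') (at x within T) \<Longrightarrow>
   ((\<lambda>x. logistic (f x)) has_field_derivative (dlogistic (f x) * f')) (at x within T)"
  unfolding logistic_def dlogistic_def
  by (auto intro!: derivative_eq_intros simp: field_simps power2_eq_square)

lemma dlogistic_pos: "0 < dlogistic x"
  by (simp add: dlogistic_def)

lemma dlogistic_eq: "dlogistic x = logistic x * (1 - logistic x)"
  by (simp add: dlogistic_def logistic_def field_simps power2_eq_square)

lemma dlogistic_le_logistic: "dlogistic x \<le> logistic x"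
  using logistic_pos[of x] by (simp add: dlogistic_eq)

lemma inverse_dlogistic: "inverse (dlogistic x) = 2 + exp x + exp (- x)"
  by (simp add: dlogistic_def exp_minus field_simps power2_eq_square)

lemma dlogistic_inverse: "dlogistic x = inverse (2 + exp x + exp (- x))"
  by (metis inverse_dlogistic inverse_inverse_eq)

text \<open>
  This turns bounds on log-odds of the form \<open>\<bar>x\<bar> \<le> k * ln n + o(ln n)\<close> into the lower bound
  \<open>n powr (- k - \<epsilon>)\<close> for the curvature of the likelihood.
\<close>

lemma dlogistic_ge: "exp (- \<bar>x\<bar>) / 4 \<le> dlogistic x"
proof -
  have "2 + exp x + exp (- x) \<le> 4 * exp \<bar>x\<bar>"
    using exp_ge_zero one_le_exp_iff[of "\<bar>x\<bar>"] exp_le_cancel_iff[of x "\<bar>x\<bar>"] exp_le_cancel_iff[of "-x" "\<bar>x\<bar>"]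
    by linarith
  moreover have "0 < 2 + exp x + exp (- x)" by (smt (verit) exp_gt_zero)
  ultimately have "inverse (4 * exp \<bar>x\<bar>) \<le> inverse (2 + exp x + exp (- x))"
    by (intro le_imp_inverse_le) auto
  then show ?thesis by (simp add: dlogistic_inverse exp_minus field_simps)
qed

text \<open>
  The logarithm of \<open>dlogistic\<close> is 1-Lipschitz. Relative (not absolute) control of the derivative is essential,
  because the derivative itself tends to \<open>0\<close> in the sparse regimes.
\<close>

lemma dlogistic_shift_ge: "exp (- \<bar>h\<bar>) * dlogistic x \<le> dlogistic (x + h)"
proof -
  have "2 + exp (x + h) + exp (- (x + h)) \<le> exp \<bar>h\<bar> * (2 + exp x + exp (- x))"
  proof -
    have "exp (x + h) \<le> exp \<bar>h\<bar> * exp x" "exp (- (x + h)) \<le> exp \<bar>h\<bar> * exp (- x)"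
      unfolding exp_add[symmetric] by auto
    moreover have "1 \<le> exp \<bar>h\<bar>" by simp
    ultimately show ?thesis unfolding distrib_left by linarith
  qed
  moreover have "0 < 2 + exp (x + h) + exp (- (x + h))" by (smt (verit) exp_gt_zero)
  ultimately have "inverse (exp \<bar>h\<bar> * (2 + exp x + exp (- x))) \<le> inverse (2 + exp (x + h) + exp (- (x + h)))"
    by (intro le_imp_inverse_le) auto
  then show ?thesis by (simp only: dlogistic_inverse exp_minus inverse_mult_distrib)
qed

lemma dlogistic_shift_le: "dlogistic (x + h) \<le> exp \<bar>h\<bar> * dlogistic x"
  using dlogistic_shift_ge[of "-h" "x + h"] by (simp add: exp_minus field_simps)

lemma logistic_mvt: "\<exists>z. min x y \<le> z \<and> z \<le> max x y \<and> logistic y - logistic x = dlogistic z * (y - x)"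
proof (cases x y rule: linorder_cases)
  case less
  then obtain z where "x < z" "z < y" "logistic y - logistic x = (y - x) * dlogistic z"
    using MVT2[of x y logistic dlogistic] has_field_derivative_logistic[OF DERIV_ident] by auto
  then show ?thesis by (intro exI[of _ z]) (auto simp: algebra_simps)
next
  case greater
  then obtain z where "y < z" "z < x" "logistic x - logistic y = (x - y) * dlogistic z"
    using MVT2[of y x logistic dlogistic] has_field_derivative_logistic[OF DERIV_ident] by auto
  then show ?thesis by (intro exI[of _ z]) (auto simp: algebra_simps)
qed auto

lemma logistic_diff_ge:
  assumes "\<And>z. min x y \<le> z \<Longrightarrow> z \<le> max x y \<Longrightarrow> B \<le> dlogistic z"
  shows "B * \<bar>y - x\<bar> \<le> \<bar>logistic y - logistic x\<bar>"
proof -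
  obtain z where z: "min x y \<le> z" "z \<le> max x y" "logistic y - logistic x = dlogistic z * (y - x)"
    using logistic_mvt by blast
  then show ?thesis using assms[of z] dlogistic_pos[of z]
    by (simp add: abs_mult mult_right_mono)
qed

lemma logistic_diff_le:
  assumes "\<And>z. min x y \<le> z \<Longrightarrow> z \<le> max x y \<Longrightarrow> dlogistic z \<le> B"
  shows "\<bar>logistic y - logistic x\<bar> \<le> B * \<bar>y - x\<bar>"
proof -
  obtain z where z: "min x y \<le> z" "z \<le> max x y" "logistic y - logistic x = dlogistic z * (y - x)"
    using logistic_mvt by blast
  then show ?thesis using assms[of z] dlogistic_pos[of z]
    by (simp add: abs_mult mult_right_mono)
qed

lemma logistic_mono: "x \<le> y \<Longrightarrow> logistic x \<le> logistic y"
  using logistic_mvt[of x y] dlogistic_pos by (smt (verit) mult_nonneg_nonneg)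

text \<open>
  One-parameter linearization. If \<open>N\<close> edges with log-odds \<open>x\<close> satisfy the score equation with noise \<open>Z\<close> and
  remainder \<open>r\<close>, the mean value theorem gives \<open>W * q * w = Z + r\<close> where \<open>q\<close> is the ratio of the derivative at an
  intermediate point to the derivative at \<open>x\<close>; this ratio is \<open>1 + O(w)\<close>. Errors are measured relative to the
  standard deviation \<open>sqrt W\<close> of \<open>Z\<close>.
\<close>

lemma logistic_score_inversion:
  fixes N x w Z r :: real
  assumes N: "0 < N" and w: "\<bar>w\<bar> \<le> 1/4" and eq: "N * (logistic (x + w) - logistic x) = Z + r"
  defines "W \<equiv> N * dlogistic x"
  shows "\<bar>w * sqrt W - Z / sqrt W\<bar> \<le> 4 * \<bar>w\<bar> * \<bar>Z / sqrt W\<bar> + 2 * \<bar>r\<bar> / sqrt W"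
proof -
  have W: "W > 0" using N dlogistic_pos[of x] by (simp add: W_def)
  obtain z where z: "min x (x+w) \<le> z" "z \<le> max x (x+w)" "logistic (x+w) - logistic x = dlogistic z * w"
    using logistic_mvt[of x "x+w"] by auto
  define q where "q = dlogistic z / dlogistic x"
  have qeq: "dlogistic z = q * dlogistic x" using dlogistic_pos[of x] by (simp add: q_def)
  have h: "\<bar>z - x\<bar> \<le> \<bar>w\<bar>" using z(1,2) by (auto simp: abs_if split: if_splits)
  have "exp (- \<bar>z-x\<bar>) \<le> q" "q \<le> exp \<bar>z-x\<bar>"
    using dlogistic_shift_ge[of "z-x" x] dlogistic_shift_le[of x "z-x"] dlogistic_pos[of x]
    by (auto simp: q_def field_simps)
  moreover have "1 - \<bar>w\<bar> \<le> exp (- \<bar>z-x\<bar>)" using exp_ge_add_one_self[of "- \<bar>z-x\<bar>"] h by linarith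
  moreover have "exp \<bar>z-x\<bar> \<le> 1 + 2 * \<bar>w\<bar>"
  proof -
    have "exp \<bar>z-x\<bar> \<le> exp \<bar>w\<bar>" using h by simp
    also have "\<dots> \<le> 1 + \<bar>w\<bar> + \<bar>w\<bar>\<^sup>2" using w by (intro exp_bound) auto
    also have "\<bar>w\<bar>\<^sup>2 \<le> \<bar>w\<bar> * 1" unfolding power2_eq_square using w by (intro mult_left_mono) auto
    finally show ?thesis by simp
  qed
  ultimately have q: "1 - \<bar>w\<bar> \<le> q" "q \<le> 1 + 2 * \<bar>w\<bar>" by linarith+
  have qpos: "q \<ge> 1/2" using q w by linarith
  have "W * q * w = Z + r" using eq z(3) qeq by (simp add: W_def algebra_simps)
  then have "w * sqrt W * (q * sqrt W) = Z + r"
    using W by (simp add: algebra_simps)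
  then have "w * sqrt W = (Z + r) / (q * sqrt W)" using W qpos by (simp add: field_simps)
  then have "w * sqrt W - Z / sqrt W = (1 / q - 1) * (Z / sqrt W) + (1/q) * (r / sqrt W)"
    using W qpos by (simp add: field_simps)
  also have "\<bar>\<dots>\<bar> \<le> \<bar>1 / q - 1\<bar> * \<bar>Z / sqrt W\<bar> + \<bar>1/q\<bar> * \<bar>r / sqrt W\<bar>"
    using abs_triangle_ineq abs_mult by metis
  also have "\<dots> \<le> (4 * \<bar>w\<bar>) * \<bar>Z / sqrt W\<bar> + 2 * \<bar>r / sqrt W\<bar>"
  proof (intro add_mono mult_right_mono)
    have "\<bar>1 / q - 1\<bar> = \<bar>1 - q\<bar> / q" using qpos by (simp add: field_simps abs_if)
    also have "\<dots> \<le> (2 * \<bar>w\<bar>) / (1/2)" using q qpos by (intro frac_le) auto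
    finally show "\<bar>1 / q - 1\<bar> \<le> 4 * \<bar>w\<bar>" by simp
    show "\<bar>1/q\<bar> \<le> 2" using qpos by (simp add: field_simps)
  qed auto
  finally show ?thesis using W by simp
qed

section \<open>Sums over pairs of nodes\<close>

definition pairs_in :: "nat \<Rightarrow> nat set \<Rightarrow> (nat \<times> nat) set" where
  "pairs_in n T = {(i, j) \<in> node_pairs n. i \<in> T \<and> j \<in> T}"

text \<open>
  The pairs joining \<open>k\<close> to \<open>T\<close>, stored like all pairs with the smaller node first.
\<close>

definition star :: "nat \<Rightarrow> nat \<Rightarrow> nat set \<Rightarrow> (nat \<times> nat) set" where
  "star n k T = {(i, j) \<in> node_pairs n. i = k \<and> j \<in> T \<or> j = k \<and> i \<in> T}"

lemma finite_node_pairs [simp]: "finite (node_pairs n)"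
  by (rule finite_subset[of _ "{1..n} \<times> {1..n}"]) (auto simp: node_pairs_def)

lemma pairs_in_subset: "pairs_in n T \<subseteq> node_pairs n"
  and star_subset: "star n k T \<subseteq> node_pairs n"
  by (auto simp: pairs_in_def star_def)

lemma finite_pairs_in [simp]: "finite (pairs_in n T)"
  and finite_star [simp]: "finite (star n k T)"
  using finite_subset[OF pairs_in_subset] finite_subset[OF star_subset] by auto

lemma sum_star:
  fixes f :: "nat \<Rightarrow> nat \<Rightarrow> 'a::comm_monoid_add"
  assumes k: "k \<in> {1..n}" and sym: "\<And>i j. i \<in> {1..n} \<Longrightarrow> j \<in> {1..n} \<Longrightarrow> f i j = f j i"
  shows "(\<Sum>(i, j)\<in>star n k T. f i j) = (\<Sum>j\<in>{1..n} \<inter> T - {k}. f k j)"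
\<comment> \<open>The pair of \<open>k\<close> and \<open>j\<close> is stored in increasing order.\<close>
proof (rule sum.reindex_bij_witness[where i = "\<lambda>j. (min k j, max k j)" and j = "\<lambda>(a, b). if a = k then b else a"], goal_cases)
  case (5 e)
  then obtain a b where e: "e = (a, b)" "(a, b) \<in> star n k T" by (cases e) auto
  then show ?case using k sym[of k a] by (auto simp: star_def node_pairs_def)
qed (use k in \<open>auto simp: star_def node_pairs_def min_def max_def split: if_splits\<close>)

lemma card_star:
  assumes "k \<in> {1..n}"
  shows "card (star n k T) = card ({1..n} \<inter> T - {k})"
  using sum_star[of k n "\<lambda>_ _. 1::nat" T] assms by (simp add: case_prod_beta)

text \<open>
  A pair is counted once for each of its ends that lies in \<open>S\<close>.
\<close>

lemma sum_over_stars: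
  fixes g :: "nat \<times> nat \<Rightarrow> real"
  assumes S: "S \<subseteq> {1..n}"
  shows "(\<Sum>k\<in>S. \<Sum>e\<in>star n k UNIV. g e) =
         (\<Sum>e\<in>node_pairs n. g e * (of_bool (fst e \<in> S) + of_bool (snd e \<in> S)))"
proof -
  have fS: "finite S" using S finite_subset by blast
  have "(\<Sum>k\<in>S. \<Sum>e\<in>star n k UNIV. g e) =
        (\<Sum>k\<in>S. \<Sum>e\<in>node_pairs n. g e * (of_bool (fst e = k) + of_bool (snd e = k)))"
  proof (rule sum.cong[OF refl])
    fix k assume "k \<in> S"
    have "(\<Sum>e\<in>node_pairs n. g e * (of_bool (fst e = k) + of_bool (snd e = k)))
        = (\<Sum>e\<in>node_pairs n. if e \<in> star n k UNIV then g e else 0)"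
      by (rule sum.cong) (auto simp: star_def node_pairs_def)
    also have "\<dots> = (\<Sum>e\<in>star n k UNIV. g e)"
      using star_subset[of n k UNIV] by (simp add: sum.If_cases Int_absorb1)
    finally show "(\<Sum>e\<in>star n k UNIV. g e) =
        (\<Sum>e\<in>node_pairs n. g e * (of_bool (fst e = k) + of_bool (snd e = k)))" ..
  qed
  also have "\<dots> = (\<Sum>e\<in>node_pairs n. \<Sum>k\<in>S. g e * (of_bool (fst e = k) + of_bool (snd e = k)))"
    by (rule sum.swap)
  also have "\<dots> = (\<Sum>e\<in>node_pairs n. g e * (of_bool (fst e \<in> S) + of_bool (snd e \<in> S)))"
    using fS by (intro sum.cong refl)
      (simp add: sum_distrib_left[symmetric] sum.distrib of_bool_def sum.delta)
  finally show ?thesis .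
qed

text \<open>
  A mixed pair is counted once among all pairs and once in the stars and cancels, an inner pair is counted once
  and twice, an outer pair once and not at all. Applied to fitted minus true probabilities and to the noise,
  this removes the dependence of the score for \<open>\<mu>\<close> on the mixed pairs.
\<close>

lemma sum_pairs_minus_stars:
  fixes g :: "nat \<times> nat \<Rightarrow> real"
  assumes S: "S \<subseteq> {1..n}"
  shows "(\<Sum>e\<in>node_pairs n. g e) - (\<Sum>k\<in>S. \<Sum>e\<in>star n k UNIV. g e)
       = (\<Sum>e\<in>pairs_in n (- S). g e) - (\<Sum>e\<in>pairs_in n S. g e)"
proof -
  have "(\<Sum>e\<in>node_pairs n. g e) - (\<Sum>k\<in>S. \<Sum>e\<in>star n k UNIV. g e) =
     (\<Sum>e\<in>node_pairs n. g e - g e * (of_bool (fst e \<in> S) + of_bool (snd e \<in> S)))"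
    unfolding sum_over_stars[OF S] by (simp add: sum_subtractf)
  also have "\<dots> = (\<Sum>e\<in>node_pairs n. (if e \<in> pairs_in n (- S) then g e else 0) - (if e \<in> pairs_in n S then g e else 0))"
    by (rule sum.cong) (auto simp: pairs_in_def)
  also have "\<dots> = (\<Sum>e\<in>pairs_in n (- S). g e) - (\<Sum>e\<in>pairs_in n S. g e)"
    using pairs_in_subset[of n S] pairs_in_subset[of n "- S"]
    by (simp add: sum_subtractf sum.If_cases Int_absorb1)
  finally show ?thesis .
qed

lemma sum_star_split:
  fixes g :: "nat \<times> nat \<Rightarrow> real"
  shows "(\<Sum>e\<in>star n k UNIV. g e) = (\<Sum>e\<in>star n k (- S). g e) + (\<Sum>e\<in>star n k S. g e)"
proof -
  have "star n k UNIV = star n k (- S) \<union> star n k S" "star n k (- S) \<inter> star n k S = {}"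
    by (auto simp: star_def node_pairs_def)
  then show ?thesis by (simp add: sum.union_disjoint)
qed

lemma sum_pairs_diff_le:
  fixes g :: "nat \<times> nat \<Rightarrow> real"
  assumes S: "S \<subseteq> {1..n}"
  shows "\<bar>(\<Sum>e\<in>node_pairs n. g e) - (\<Sum>e\<in>pairs_in n (- S). g e)\<bar>
           \<le> (\<Sum>k\<in>S. \<Sum>e\<in>star n k UNIV. \<bar>g e\<bar>)"
proof -
  have "(\<Sum>e\<in>node_pairs n. g e) - (\<Sum>e\<in>pairs_in n (- S). g e) = (\<Sum>e\<in>node_pairs n - pairs_in n (- S). g e)"
    using pairs_in_subset by (simp add: sum_diff)
  also have "\<bar>\<dots>\<bar> \<le> (\<Sum>e\<in>node_pairs n - pairs_in n (- S). \<bar>g e\<bar>)" by (rule sum_abs)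
  also have "\<dots> = (\<Sum>e\<in>node_pairs n - pairs_in n (- S). \<bar>g e\<bar> * 1)" by simp
  also have "\<dots> \<le> (\<Sum>e\<in>node_pairs n - pairs_in n (- S). \<bar>g e\<bar> * (of_bool (fst e \<in> S) + of_bool (snd e \<in> S)))"
    by (intro sum_mono mult_left_mono) (auto simp: pairs_in_def)
  also have "\<dots> \<le> (\<Sum>e\<in>node_pairs n. \<bar>g e\<bar> * (of_bool (fst e \<in> S) + of_bool (snd e \<in> S)))"
    by (rule sum_mono2) auto
  also have "\<dots> = (\<Sum>k\<in>S. \<Sum>e\<in>star n k UNIV. \<bar>g e\<bar>)"
    by (rule sum_over_stars[OF S, symmetric])
  finally show ?thesis .
qed

text \<open>
  Adding a new largest element \<open>b\<close> to \<open>B\<close> creates exactly the pairs \<open>(i, b)\<close> with \<open>i \<in> B\<close>.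
\<close>

lemma card_increasing_pairs:
  fixes B :: "'a::linorder set"
  assumes "finite B"
  shows "2 * card {(i, j). i \<in> B \<and> j \<in> B \<and> i < j} = card B * (card B - 1)"
  using assms
proof (induction B rule: finite_linorder_max_induct)
  case (insert b B)
  have eq: "{(i, j). i \<in> insert b B \<and> j \<in> insert b B \<and> i < j} =
     {(i, j). i \<in> B \<and> j \<in> B \<and> i < j} \<union> (\<lambda>i. (i, b)) ` B"
    using insert(2) by force
  have fin: "finite {(i, j). i \<in> B \<and> j \<in> B \<and> i < j}"
    by (rule finite_subset[of _ "B \<times> B"]) (use insert(1) in auto)
  have "card {(i, j). i \<in> insert b B \<and> j \<in> insert b B \<and> i < j} =
     card {(i, j). i \<in> B \<and> j \<in> B \<and> i < j} + card B"
    unfolding eq using insert(1,2) fin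
    by (subst card_Un_disjoint) (auto simp: card_image inj_on_def)
  moreover have "card (insert b B) = Suc (card B)" using insert(1,2) by auto
  ultimately show ?case using insert(3) by (cases "card B") (auto simp: algebra_simps)
qed auto

lemma card_pairs_in:
  "2 * real (card (pairs_in n T)) = real (card ({1..n} \<inter> T)) * (real (card ({1..n} \<inter> T)) - 1)"
proof -
  have "pairs_in n T = {(i, j). i \<in> {1..n} \<inter> T \<and> j \<in> {1..n} \<inter> T \<and> i < j}"
    by (auto simp: pairs_in_def node_pairs_def)
  then have "2 * card (pairs_in n T) = card ({1..n} \<inter> T) * (card ({1..n} \<inter> T) - 1)"
    using card_increasing_pairs[of "{1..n} \<inter> T"] by simp
  then have "real (2 * card (pairs_in n T)) = real (card ({1..n} \<inter> T) * (card ({1..n} \<inter> T) - 1))"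
    by presburger
  then show ?thesis by (cases "card ({1..n} \<inter> T)") auto
qed

lemma card_pairs_in_le: "real (card (pairs_in n T)) \<le> (real (card ({1..n} \<inter> T)))\<^sup>2"
  using card_pairs_in[of n T] by (simp add: power2_eq_square algebra_simps)

section \<open>Score inequalities for the constrained estimator\<close>

text \<open>
  The first-order conditions at a minimum over an interval, each valid as soon as there is room to move in the
  direction concerned.
\<close>

lemma minimum_derivative_sign:
  fixes f :: "real \<Rightarrow> real"
  assumes D: "DERIV f x :> D" and x: "x \<in> {lo..hi}" and le: "\<And>y. y \<in> {lo..hi} \<Longrightarrow> f x \<le> f y"
  shows "lo < x \<Longrightarrow> D \<le> 0" and "x < hi \<Longrightarrow> 0 \<le> D"
proof -
  show "D \<le> 0" if "lo < x"
  proof (rule ccontr)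
    assume "\<not> D \<le> 0"
    then obtain d where d: "d > 0" "\<And>h. 0 < h \<Longrightarrow> h < d \<Longrightarrow> f (x - h) < f x"
      using DERIV_pos_inc_left[OF D] by auto
    define h where "h = min (d / 2) (x - lo)"
    have "f (x - h) < f x" using d that by (intro d(2)) (auto simp: h_def)
    moreover have "f x \<le> f (x - h)" using d x that by (intro le) (auto simp: h_def)
    ultimately show False by simp
  qed
  show "0 \<le> D" if "x < hi"
  proof (rule ccontr)
    assume "\<not> 0 \<le> D"
    then obtain d where d: "d > 0" "\<And>h. 0 < h \<Longrightarrow> h < d \<Longrightarrow> f (x + h) < f x"
      using DERIV_neg_dec_right[OF D] by auto
    define h where "h = min (d / 2) (hi - x)"
    have "f (x + h) < f x" using d that by (intro d(2)) (auto simp: h_def)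
    moreover have "f x \<le> f (x + h)" using d x that by (intro le) (auto simp: h_def)
    ultimately show False by simp
  qed
qed

lemma has_field_derivative_softplus:
  "(f has_field_derivative f') (at x within T) \<Longrightarrow>
   ((\<lambda>x. ln (1 + exp (f x))) has_field_derivative (logistic (f x) * f')) (at x within T)" for f :: "real \<Rightarrow> real"
  unfolding logistic_def by (auto intro!: derivative_eq_intros simp: field_simps)

definition fit :: "real \<Rightarrow> real \<Rightarrow> nat \<Rightarrow> nat set \<Rightarrow> real \<Rightarrow> (nat \<Rightarrow> real) \<Rightarrow> nat \<times> nat \<Rightarrow> real" where
  "fit \<gamma> \<alpha> n S m b = (\<lambda>(i, j). edge_prob (mu_of \<gamma> n m) (beta_of \<alpha> n S b) i j)"

lemma DERIV_neg_loglik_mu: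
  "DERIV (\<lambda>m. neg_loglik n a (mu_of \<gamma> n m) (beta_of \<alpha> n S b)) m :>
     (\<Sum>e\<in>node_pairs n. fit \<gamma> \<alpha> n S m b e) - num_edges n a"
  unfolding neg_loglik_def mu_of_def fit_def edge_prob_logistic case_prod_beta
  by (rule DERIV_cong, (rule DERIV_add DERIV_diff DERIV_sum DERIV_cmult has_field_derivative_softplus DERIV_const DERIV_ident)+) simp

lemma node_degree_eq:
  assumes "k \<in> {1..n}" "\<And>i j. i \<in> {1..n} \<Longrightarrow> j \<in> {1..n} \<Longrightarrow> a i j = a j i"
  shows "node_degree n a k = (\<Sum>(i, j)\<in>star n k UNIV. of_bool (a i j))"
  using sum_star[of k n "\<lambda>i j. of_bool (a i j) :: real" UNIV] assms by (simp add: node_degree_def)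

lemma DERIV_neg_loglik_beta:
  assumes k: "k \<in> S" and S: "S \<subseteq> {1..n}"
  shows "DERIV (\<lambda>x. neg_loglik n a (mu_of \<gamma> n m) (beta_of \<alpha> n S (b(k := x)))) (b k) :>
     (\<Sum>e\<in>star n k UNIV. fit \<gamma> \<alpha> n S m b e) - node_degree n a k"
proof -
  have B: "beta_of \<alpha> n S (b(k := x)) i = (if i = k then \<alpha> * ln (real n) + x else beta_of \<alpha> n S b i)" for x i
    using k by (auto simp: beta_of_def)
  have D: "DERIV (\<lambda>x. beta_of \<alpha> n S (b(k := x)) i) y :> of_bool (i = k)" for i y
    unfolding B by (cases "i = k") (auto intro!: derivative_eq_intros)
  have B0: "beta_of \<alpha> n S (b(k := b k)) = beta_of \<alpha> n S b" by simp
  have "DERIV (\<lambda>x. neg_loglik n a (mu_of \<gamma> n m) (beta_of \<alpha> n S (b(k := x)))) (b k) :>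
     - (\<Sum>i\<in>{1..n}. node_degree n a i * of_bool (i = k)) +
     (\<Sum>e\<in>node_pairs n. fit \<gamma> \<alpha> n S m b e * (of_bool (fst e = k) + of_bool (snd e = k)))"
    unfolding neg_loglik_def fit_def edge_prob_logistic case_prod_beta
    by (rule DERIV_cong, (rule DERIV_add DERIV_diff DERIV_sum DERIV_cmult has_field_derivative_softplus DERIV_const D)+) (simp only: B0, simp)
  also have "(\<Sum>i\<in>{1..n}. node_degree n a i * of_bool (i = k)) = node_degree n a k"
    using k S by (simp add: of_bool_def if_distrib[of "\<lambda>x. _ * x"] sum.delta' subset_eq cong: if_cong)
  also have "(\<Sum>e\<in>node_pairs n. fit \<gamma> \<alpha> n S m b e * (of_bool (fst e = k) + of_bool (snd e = k)))
    = (\<Sum>e\<in>node_pairs n. if e \<in> star n k UNIV then fit \<gamma> \<alpha> n S m b e else 0)"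
    by (rule sum.cong) (auto simp: star_def node_pairs_def)
  also have "\<dots> = (\<Sum>e\<in>star n k UNIV. fit \<gamma> \<alpha> n S m b e)"
    using star_subset[of n k UNIV] by (simp add: sum.If_cases Int_absorb1)
  finally show ?thesis by (simp del: fun_upd_apply)
qed

lemma mle_in_space:
  assumes "is_mle \<gamma> \<alpha> n S M1 M2 a mh bh"
  shows "mh \<in> {-M1..M1}" "\<And>i. i \<in> S \<Longrightarrow> bh i \<in> {0..M2}"
  using assms by (auto simp: is_mle_def is_arg_min_def param_space_def)

lemma mle_minimal:
  assumes "is_mle \<gamma> \<alpha> n S M1 M2 a mh bh" "m \<in> {-M1..M1}" "\<And>i. i \<in> S \<Longrightarrow> b i \<in> {0..M2}"
  shows "neg_loglik n a (mu_of \<gamma> n mh) (beta_of \<alpha> n S bh) \<le> neg_loglik n a (mu_of \<gamma> n m) (beta_of \<alpha> n S b)"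
proof -
  have "(m, b) \<in> param_space S M1 M2" using assms(2,3) by (auto simp: param_space_def)
  then show ?thesis using assms(1) unfolding is_mle_def is_arg_min_linorder by fastforce
qed

text \<open>
  Only moves in the \<open>\<mu>\<close> direction within the parameter box are compared; the fitted expected number of edges can
  exceed the observed one only at the lower end of the box, and fall short of it only at the upper end.
\<close>

lemma mle_score_mu:
  assumes "is_mle \<gamma> \<alpha> n S M1 M2 a mh bh"
  shows "- M1 < mh \<Longrightarrow> (\<Sum>e\<in>node_pairs n. fit \<gamma> \<alpha> n S mh bh e) \<le> num_edges n a"
    and "mh < M1 \<Longrightarrow> num_edges n a \<le> (\<Sum>e\<in>node_pairs n. fit \<gamma> \<alpha> n S mh bh e)"
  using minimum_derivative_sign[OF DERIV_neg_loglik_mu[of n a \<gamma> \<alpha> S bh mh] mle_in_space(1)[OF assms]]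
    mle_minimal[OF assms _ mle_in_space(2)[OF assms]] by fastforce+

lemma mle_score_beta:
  assumes "is_mle \<gamma> \<alpha> n S M1 M2 a mh bh" and k: "k \<in> S" and S: "S \<subseteq> {1..n}"
  shows "0 < bh k \<Longrightarrow> (\<Sum>e\<in>star n k UNIV. fit \<gamma> \<alpha> n S mh bh e) \<le> node_degree n a k"
    and "bh k < M2 \<Longrightarrow> node_degree n a k \<le> (\<Sum>e\<in>star n k UNIV. fit \<gamma> \<alpha> n S mh bh e)"
proof -
  have *: "neg_loglik n a (mu_of \<gamma> n mh) (beta_of \<alpha> n S (bh(k := bh k))) \<le>
     neg_loglik n a (mu_of \<gamma> n mh) (beta_of \<alpha> n S (bh(k := y)))" if "y \<in> {0..M2}" for y
    using mle_minimal[OF assms(1) mle_in_space(1)[OF assms(1)], of "bh(k := y)"] mle_in_space(2)[OF assms(1)] that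
    by auto
  note min = minimum_derivative_sign[OF DERIV_neg_loglik_beta[OF k S, of a \<gamma> mh \<alpha> bh] mle_in_space(2)[OF assms(1) k] *]
  show "0 < bh k \<Longrightarrow> (\<Sum>e\<in>star n k UNIV. fit \<gamma> \<alpha> n S mh bh e) \<le> node_degree n a k" 
    "bh k < M2 \<Longrightarrow> node_degree n a k \<le> (\<Sum>e\<in>star n k UNIV. fit \<gamma> \<alpha> n S mh bh e)"
    using min by fastforce+
qed

section \<open>Fluctuations of edge counts\<close>

definition noise :: "real \<Rightarrow> (nat \<Rightarrow> real) \<Rightarrow> (nat \<times> nat) set \<Rightarrow> (nat \<Rightarrow> nat \<Rightarrow> bool) \<Rightarrow> real" where
  "noise \<mu> \<beta> P a = (\<Sum>(i, j)\<in>P. of_bool (a i j) - edge_prob \<mu> \<beta> i j)"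

text \<open>
  For negative \<open>x\<close> this follows from the lower Taylor bound for \<open>exp (- x)\<close> by taking reciprocals.
\<close>

lemma exp_le_quadratic:
  fixes x :: real
  assumes "\<bar>x\<bar> \<le> 1"
  shows "exp x \<le> 1 + x + x\<^sup>2"
proof (cases "x \<ge> 0")
  case True
  then show ?thesis using exp_bound[of x] assms by simp
next
  case False
  define y where "y = - x"
  have y: "0 \<le> y" using False by (simp add: y_def)
  have "1 + y + y\<^sup>2 / 2 \<le> exp y" using exp_lower_Taylor_quadratic y by simp
  moreover have "1 \<le> (1 - y + y\<^sup>2) * (1 + y + y\<^sup>2 / 2)"
  proof -
    have "(1 - y + y\<^sup>2) * (1 + y + y\<^sup>2 / 2) = 1 + (y\<^sup>2 + y^3 + y^4) / 2"
      by (simp add: field_simps power2_eq_square power3_eq_cube power4_eq_xxxx)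
    then show ?thesis using y by simp
  qed
  moreover have "0 < 1 - y + y\<^sup>2"
    using zero_le_power2[of "y - 1/2"] by (simp add: power2_eq_square algebra_simps)
  ultimately have "1 \<le> (1 - y + y\<^sup>2) * exp y"
    by (smt (verit) mult_left_mono)
  then have "exp (- y) \<le> 1 - y + y\<^sup>2"
    by (simp add: exp_minus field_simps)
  then show ?thesis by (simp add: y_def)
qed

lemma edge_prob_bounds: "0 < edge_prob \<mu> \<beta> i j" "edge_prob \<mu> \<beta> i j < 1"
  using logistic_pos logistic_less_1 by (auto simp: edge_prob_logistic)

context sparse_beta_model
begin

abbreviation (input) edge :: "nat \<times> nat \<Rightarrow> 'w \<Rightarrow> bool" where
  "edge e \<omega> \<equiv> A \<omega> (fst e) (snd e)"

abbreviation (input) p :: "nat \<times> nat \<Rightarrow> real" where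
  "p e \<equiv> edge_prob \<mu> \<beta> (fst e) (snd e)"

lemma edge_measurable [measurable]:
  "e \<in> node_pairs n \<Longrightarrow> edge e \<in> measurable M (count_space UNIV)"
  using edges_indep unfolding indep_vars_def2 by (auto simp: case_prod_beta)

lemma indep_edges_map:
  assumes "P \<subseteq> node_pairs n"
  shows "indep_vars (\<lambda>_. borel) (\<lambda>e \<omega>. h e (edge e \<omega>) :: 'b::topological_space) P"
  using indep_vars_compose2[OF indep_vars_subset[OF edges_indep assms], of h "\<lambda>_. borel"]
  by (simp add: case_prod_beta)

lemma expectation_edge:
  fixes h :: "bool \<Rightarrow> real"
  assumes e: "e \<in> node_pairs n"
  shows "integrable M (\<lambda>\<omega>. h (edge e \<omega>))"
    and "expectation (\<lambda>\<omega>. h (edge e \<omega>)) = h True * p e + h False * (1 - p e)"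
proof -
  have m: "edge e \<in> measurable M (count_space UNIV)" using e by simp
  show "integrable M (\<lambda>\<omega>. h (edge e \<omega>))"
  proof (rule integrable_const_bound[of _ "max \<bar>h True\<bar> \<bar>h False\<bar>"])
    show "AE \<omega> in M. norm (h (edge e \<omega>)) \<le> max \<bar>h True\<bar> \<bar>h False\<bar>"
      by (intro AE_I2) (metis (full_types) max.cobounded1 max.cobounded2 real_norm_def)
    show "(\<lambda>\<omega>. h (edge e \<omega>)) \<in> borel_measurable M"
      using m by measurable
  qed
  have "expectation (\<lambda>\<omega>. h (edge e \<omega>)) = (\<integral>b. h b \<partial>distr M (count_space UNIV) (edge e))"
    using m by (subst integral_distr) auto
  also have "\<dots> = (\<integral>b. h b \<partial>measure_pmf (bernoulli_pmf (p e)))"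
    using edges_bernoulli[of "fst e" "snd e"] e by simp
  also have "\<dots> = h True * p e + h False * (1 - p e)"
    using edge_prob_bounds[of \<mu> \<beta> "fst e" "snd e"] by (subst integral_bernoulli_pmf) auto
  finally show "expectation (\<lambda>\<omega>. h (edge e \<omega>)) = h True * p e + h False * (1 - p e)" .
qed

lemma noise_alt: "noise \<mu> \<beta> P (A \<omega>) = (\<Sum>e\<in>P. of_bool (edge e \<omega>) - p e)"
  by (simp add: noise_def case_prod_beta)

lemma noise_measurable [measurable]:
  assumes "P \<subseteq> node_pairs n"
  shows "(\<lambda>\<omega>. noise \<mu> \<beta> P (A \<omega>)) \<in> borel_measurable M"
proof -
  have "(\<lambda>\<omega>. of_bool (edge e \<omega>) - p e) \<in> borel_measurable M" if "e \<in> P" for e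
    by (rule borel_measurable_integrable, rule expectation_edge(1)[of e "\<lambda>b. of_bool b - p e"]) (use that assms in blast)
  then show ?thesis unfolding noise_alt by (rule borel_measurable_sum)
qed

text \<open>
  By independence the moment generating function factors, and a centred Bernoulli variable with mean \<open>p\<close> has
  \<open>E exp (l * X) \<le> exp (p * (exp l - 1 - l)) \<le> exp (p * l\<^sup>2)\<close>.
\<close>

lemma noise_mgf:
  assumes P: "P \<subseteq> node_pairs n" and l: "\<bar>l\<bar> \<le> 1"
  shows "integrable M (\<lambda>\<omega>. exp (l * noise \<mu> \<beta> P (A \<omega>)))"
    and "expectation (\<lambda>\<omega>. exp (l * noise \<mu> \<beta> P (A \<omega>))) \<le> exp (l\<^sup>2 * (\<Sum>e\<in>P. p e))"
proof -
  have fP: "finite P" using finite_subset[OF P] by simp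
  define h where "h e b = exp (l * (of_bool b - p e))" for e and b :: bool
  have eq: "exp (l * noise \<mu> \<beta> P (A \<omega>)) = (\<Prod>e\<in>P. h e (edge e \<omega>))" for \<omega>
    using fP by (simp add: h_def noise_alt sum_distrib_left exp_sum)
  have I: "integrable M (\<lambda>\<omega>. h e (edge e \<omega>))" if "e \<in> P" for e
    by (rule expectation_edge(1)[of e "h e", OF subsetD[OF P that]])
  have ind: "indep_vars (\<lambda>_. borel) (\<lambda>e \<omega>. h e (edge e \<omega>)) P" by (rule indep_edges_map[OF P])
  show "integrable M (\<lambda>\<omega>. exp (l * noise \<mu> \<beta> P (A \<omega>)))"
    unfolding eq by (rule indep_vars_integrable[OF fP ind I])
  have "expectation (\<lambda>\<omega>. exp (l * noise \<mu> \<beta> P (A \<omega>))) = (\<Prod>e\<in>P. expectation (\<lambda>\<omega>. h e (edge e \<omega>)))"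
    unfolding eq by (rule indep_vars_lebesgue_integral[OF fP ind I])
  also have "\<dots> \<le> (\<Prod>e\<in>P. exp (l\<^sup>2 * p e))"
  proof (rule prod_mono, safe)
    fix i j assume e: "(i, j) \<in> P"
    let ?e = "(i, j)"
    show "0 \<le> expectation (\<lambda>\<omega>. h ?e (edge ?e \<omega>))" by (rule integral_nonneg_AE) (simp add: h_def)
    have "expectation (\<lambda>\<omega>. h ?e (edge ?e \<omega>)) = exp (- l * p ?e) * (1 + p ?e * (exp l - 1))"
    proof -
      have "expectation (\<lambda>\<omega>. h ?e (edge ?e \<omega>)) = exp (l + - l * p ?e) * p ?e + exp (- l * p ?e) * (1 - p ?e)"
        using e P by (subst expectation_edge(2)) (auto simp: h_def right_diff_distrib)
      then show ?thesis unfolding exp_add by (simp add: algebra_simps)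
    qed
    also have "\<dots> \<le> exp (- l * p ?e) * exp (p ?e * (exp l - 1))"
      by (intro mult_left_mono) (auto intro: exp_ge_add_one_self)
    also have "\<dots> = exp (p ?e * (exp l - 1 - l))"
      by (simp add: exp_add[symmetric] algebra_simps)
    also have "\<dots> \<le> exp (p ?e * l\<^sup>2)"
      using exp_le_quadratic[OF l] edge_prob_bounds[of \<mu> \<beta> i j] by simp
    finally show "expectation (\<lambda>\<omega>. h ?e (edge ?e \<omega>)) \<le> exp (l\<^sup>2 * p ?e)" by (simp add: mult.commute)
  qed
  also have "\<dots> = exp (l\<^sup>2 * (\<Sum>e\<in>P. p e))" using fP by (simp add: exp_sum sum_distrib_left)
  finally show "expectation (\<lambda>\<omega>. exp (l * noise \<mu> \<beta> P (A \<omega>))) \<le> exp (l\<^sup>2 * (\<Sum>e\<in>P. p e))" .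
qed

text \<open>
  A Chernoff bound at the fixed exponent \<open>\<plusminus> 1 / sqrt V\<close>, at which the moment generating function is at
  most \<open>exp 1\<close>. The exponential tail in units of \<open>sqrt V\<close> is weaker than Gaussian, but with \<open>t\<close> a small power
  of \<open>n\<close> it beats any polynomial number of events.
\<close>

lemma noise_tail:
  assumes P: "P \<subseteq> node_pairs n" and V: "1 \<le> V" "(\<Sum>e\<in>P. p e) \<le> V"
  shows "prob {\<omega> \<in> space M. t * sqrt V < \<bar>noise \<mu> \<beta> P (A \<omega>)\<bar>} \<le> 2 * exp (1 - t)"
proof -
  have one: "prob {\<omega> \<in> space M. t * sqrt V \<le> s * noise \<mu> \<beta> P (A \<omega>)} \<le> exp (1 - t)"
    if s: "s = 1 \<or> s = -1" for s :: real
  proof -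
    \<comment> \<open>The sign \<open>s\<close> selects the tail; \<open>V \<ge> 1\<close> ensures \<open>\<bar>l\<bar> \<le> 1\<close>.\<close>
    define l where "l = s / sqrt V"
    have s2: "s\<^sup>2 = 1" "\<bar>s\<bar> = 1" using s by auto
    have l: "\<bar>l\<bar> \<le> 1" "l\<^sup>2 = 1 / V" using V s2 by (auto simp: l_def power_divide)
    have [measurable]: "(\<lambda>\<omega>. noise \<mu> \<beta> P (A \<omega>)) \<in> borel_measurable M" using P by simp
    have "{\<omega> \<in> space M. t * sqrt V \<le> s * noise \<mu> \<beta> P (A \<omega>)} = {\<omega> \<in> space M. exp t \<le> exp (l * noise \<mu> \<beta> P (A \<omega>))}"
      using V by (auto simp: l_def field_simps)
    also have "prob \<dots> \<le> expectation (\<lambda>\<omega>. exp (l * noise \<mu> \<beta> P (A \<omega>))) / exp t"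
      using noise_mgf(1)[OF P l(1)] by (intro integral_Markov_inequality_measure[of _ _ "{}"]) auto
    also have "\<dots> \<le> exp (l\<^sup>2 * (\<Sum>e\<in>P. p e)) / exp t"
      by (intro divide_right_mono noise_mgf(2)[OF P l(1)]) auto
    also have "l\<^sup>2 * (\<Sum>e\<in>P. p e) \<le> 1" unfolding l(2) using V by simp
    then have "exp (l\<^sup>2 * (\<Sum>e\<in>P. p e)) / exp t \<le> exp 1 / exp t"
      by (intro divide_right_mono) auto
    finally show ?thesis by (simp add: exp_diff)
  qed
  have [measurable]: "(\<lambda>\<omega>. noise \<mu> \<beta> P (A \<omega>)) \<in> borel_measurable M" using P by simp
  have "prob {\<omega> \<in> space M. t * sqrt V < \<bar>noise \<mu> \<beta> P (A \<omega>)\<bar>} \<le>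
     prob ({\<omega> \<in> space M. t * sqrt V \<le> 1 * noise \<mu> \<beta> P (A \<omega>)} \<union> {\<omega> \<in> space M. t * sqrt V \<le> (-1) * noise \<mu> \<beta> P (A \<omega>)})"
    by (intro finite_measure_mono) auto
  also have "\<dots> \<le> prob {\<omega> \<in> space M. t * sqrt V \<le> 1 * noise \<mu> \<beta> P (A \<omega>)} + prob {\<omega> \<in> space M. t * sqrt V \<le> (-1) * noise \<mu> \<beta> P (A \<omega>)}"
    by (intro measure_subadditive) (auto simp: emeasure_eq_measure)
  also have "\<dots> \<le> exp (1 - t) + exp (1 - t)" by (intro add_mono one) auto
  finally show ?thesis by simp
qed

lemma noise_tail_union:
  fixes P :: "'i \<Rightarrow> (nat \<times> nat) set"
  assumes I: "finite I" and P: "\<And>i. i \<in> I \<Longrightarrow> P i \<subseteq> node_pairs n"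
    and V: "\<And>i. i \<in> I \<Longrightarrow> 1 \<le> V i" "\<And>i. i \<in> I \<Longrightarrow> (\<Sum>e\<in>P i. p e) \<le> V i"
  shows "{\<omega> \<in> space M. \<exists>i\<in>I. t * sqrt (V i) < \<bar>noise \<mu> \<beta> (P i) (A \<omega>)\<bar>} \<in> sets M"
    and "prob {\<omega> \<in> space M. \<exists>i\<in>I. t * sqrt (V i) < \<bar>noise \<mu> \<beta> (P i) (A \<omega>)\<bar>} \<le> real (card I) * (2 * exp (1 - t))"
proof -
  have [measurable]: "(\<lambda>\<omega>. noise \<mu> \<beta> (P i) (A \<omega>)) \<in> borel_measurable M" if "i \<in> I" for i using P that by simp
  have s: "{\<omega> \<in> space M. t * sqrt (V i) < \<bar>noise \<mu> \<beta> (P i) (A \<omega>)\<bar>} \<in> sets M" if "i \<in> I" for i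
    using that by measurable
  have eq: "{\<omega> \<in> space M. \<exists>i\<in>I. t * sqrt (V i) < \<bar>noise \<mu> \<beta> (P i) (A \<omega>)\<bar>} =
     (\<Union>i\<in>I. {\<omega> \<in> space M. t * sqrt (V i) < \<bar>noise \<mu> \<beta> (P i) (A \<omega>)\<bar>})" by auto
  show "{\<omega> \<in> space M. \<exists>i\<in>I. t * sqrt (V i) < \<bar>noise \<mu> \<beta> (P i) (A \<omega>)\<bar>} \<in> sets M"
    unfolding eq using I s by (intro sets.finite_UN) auto
  have "prob {\<omega> \<in> space M. \<exists>i\<in>I. t * sqrt (V i) < \<bar>noise \<mu> \<beta> (P i) (A \<omega>)\<bar>} \<le>
     (\<Sum>i\<in>I. prob {\<omega> \<in> space M. t * sqrt (V i) < \<bar>noise \<mu> \<beta> (P i) (A \<omega>)\<bar>})"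
    unfolding eq using I s by (intro measure_UNION_le) auto
  also have "\<dots> \<le> (\<Sum>i\<in>I. 2 * exp (1 - t))"
    using P V by (intro sum_mono noise_tail) auto
  finally show "prob {\<omega> \<in> space M. \<exists>i\<in>I. t * sqrt (V i) < \<bar>noise \<mu> \<beta> (P i) (A \<omega>)\<bar>} \<le> real (card I) * (2 * exp (1 - t))"
    by simp
qed

text \<open>
  The quantitative form of the central limit theorem for binomial variables. Each normalized summand is at most
  \<open>1 / sqrt W\<close> in absolute value and has variance \<open>1 / card P\<close>, so its characteristic function differs from
  \<open>1 - t\<^sup>2 / (2 * card P)\<close> by at most a third moment term; the errors add up over the \<open>card P\<close> factors.
\<close>

lemma noise_char:
  assumes P: "P \<subseteq> node_pairs n" and q: "\<And>e. e \<in> P \<Longrightarrow> p e = q" and q01: "0 < q" "q < 1"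
  defines "W \<equiv> real (card P) * (q * (1 - q))"
  assumes t: "t\<^sup>2 \<le> 4 * real (card P)" and ne: "P \<noteq> {}"
  shows "cmod (char (distr M borel (\<lambda>\<omega>. noise \<mu> \<beta> P (A \<omega>) / sqrt W)) t
            - (1 + (- (t\<^sup>2) / 2) / real (card P)) ^ card P) \<le> \<bar>t\<bar>^3 / (6 * sqrt W)"
proof -
  let ?N = "real (card P)"
  have fP: "finite P" using finite_subset[OF P] by simp
  have N: "?N > 0" using fP ne by (simp add: card_gt_0_iff)
  have W: "W > 0" using N q01 by (simp add: W_def)
  define h where "h b = (of_bool b - q) / sqrt W" for b :: bool
  define X where "X e \<omega> = h (edge e \<omega>)" for e \<omega>
  define z where "z = 1 + (- (t\<^sup>2) / 2) / ?N"
  have rv: "random_variable borel (X e)" if "e \<in> P" for e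
    unfolding X_def by (rule borel_measurable_integrable, rule expectation_edge(1)[of e h, OF subsetD[OF P that]])
  have "char (distr M borel (\<lambda>\<omega>. noise \<mu> \<beta> P (A \<omega>) / sqrt W)) t = char (distr M borel (\<lambda>\<omega>. \<Sum>e\<in>P. X e \<omega>)) t"
    using q by (simp add: noise_alt X_def h_def sum_divide_distrib)
  also have "\<dots> = (\<Prod>e\<in>P. char (distr M borel (X e)) t)"
    unfolding X_def by (rule char_distr_sum[OF indep_edges_map[OF P]])
  finally have c: "char (distr M borel (\<lambda>\<omega>. noise \<mu> \<beta> P (A \<omega>) / sqrt W)) t = (\<Prod>e\<in>P. char (distr M borel (X e)) t)" .
  have step: "cmod (char (distr M borel (X e)) t - z) \<le> t\<^sup>2 / 6 * (\<bar>t\<bar> / (?N * sqrt W))" if e: "e \<in> P" for e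
  proof -
    have eP: "e \<in> node_pairs n" using e P by auto
    have pe: "p e = q" using q e by simp
    note E = expectation_edge[OF eP]
    have I2: "integrable M (\<lambda>\<omega>. (X e \<omega>)\<^sup>2)" "expectation (\<lambda>\<omega>. (X e \<omega>)\<^sup>2) = 1 / ?N"
    proof -
      show "integrable M (\<lambda>\<omega>. (X e \<omega>)\<^sup>2)" unfolding X_def by (rule E(1))
      have "expectation (\<lambda>\<omega>. (X e \<omega>)\<^sup>2) = (h True)\<^sup>2 * q + (h False)\<^sup>2 * (1 - q)"
        unfolding X_def using E(2)[of "\<lambda>b. (h b)\<^sup>2"] pe by simp
      also have "\<dots> = ((1 - q)\<^sup>2 * q + q\<^sup>2 * (1 - q)) / W"
        using W by (simp add: h_def power_divide add_divide_distrib)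
      also have "(1 - q)\<^sup>2 * q + q\<^sup>2 * (1 - q) = q * (1 - q)" by (simp add: power2_eq_square algebra_simps)
      also have "q * (1 - q) / W = 1 / ?N" using q01 N by (simp add: W_def)
      finally show "expectation (\<lambda>\<omega>. (X e \<omega>)\<^sup>2) = 1 / ?N" .
    qed
    have E1: "expectation (X e) = 0"
      unfolding X_def using E(2)[of h] pe by (simp add: h_def field_simps)
    have "cmod (char (distr M borel (X e)) t - (1 - t\<^sup>2 * (1 / ?N) / 2)) \<le>
        (t\<^sup>2 / 6) * expectation (\<lambda>\<omega>. min (6 * (X e \<omega>)\<^sup>2) (\<bar>t\<bar> * \<bar>X e \<omega>\<bar>^3))"
    proof (rule char_approx3')
      show "integrable M (X e)" unfolding X_def by (rule E(1))
      show "variance (X e) = 1 / ?N" using E1 I2 by simp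
    qed (use rv[OF e] I2 E1 in auto)
    also have "1 - t\<^sup>2 * (1 / ?N) / 2 = z" by (simp add: z_def)
    also have "expectation (\<lambda>\<omega>. min (6 * (X e \<omega>)\<^sup>2) (\<bar>t\<bar> * \<bar>X e \<omega>\<bar>^3)) \<le> expectation (\<lambda>\<omega>. \<bar>t\<bar> / sqrt W * (X e \<omega>)\<^sup>2)"
    proof (rule integral_mono)
      show "integrable M (\<lambda>\<omega>. min (6 * (X e \<omega>)\<^sup>2) (\<bar>t\<bar> * \<bar>X e \<omega>\<bar>^3))"
        unfolding X_def using E(1)[of "\<lambda>b. min (6 * (h b)\<^sup>2) (\<bar>t\<bar> * \<bar>h b\<bar>^3)"] by simp
      show "integrable M (\<lambda>\<omega>. \<bar>t\<bar> / sqrt W * (X e \<omega>)\<^sup>2)" using I2 by simp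
      fix \<omega>
      have "\<bar>h b\<bar> \<le> 1 / sqrt W" for b using q01 W by (cases b) (auto simp: h_def intro!: divide_right_mono)
      then have "\<bar>X e \<omega>\<bar> * \<bar>X e \<omega>\<bar>\<^sup>2 \<le> 1 / sqrt W * \<bar>X e \<omega>\<bar>\<^sup>2" unfolding X_def by (intro mult_right_mono) auto
      then have "\<bar>t\<bar> * \<bar>X e \<omega>\<bar>^3 \<le> \<bar>t\<bar> * (1 / sqrt W * \<bar>X e \<omega>\<bar>\<^sup>2)"
        by (intro mult_left_mono) (auto simp: power3_eq_cube power2_eq_square)
      then show "min (6 * (X e \<omega>)\<^sup>2) (\<bar>t\<bar> * \<bar>X e \<omega>\<bar>^3) \<le> \<bar>t\<bar> / sqrt W * (X e \<omega>)\<^sup>2" by simp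
    qed
    also have "expectation (\<lambda>\<omega>. \<bar>t\<bar> / sqrt W * (X e \<omega>)\<^sup>2) = \<bar>t\<bar> / (?N * sqrt W)"
      using I2 by simp
    finally show ?thesis by (simp add: mult_left_mono)
  qed
  have z1: "cmod (complex_of_real z) \<le> 1"
  proof -
    have "t\<^sup>2 / 2 / ?N \<le> 2" using t N by (simp add: field_simps)
    moreover have "0 \<le> t\<^sup>2 / 2 / ?N" by simp
    ultimately show ?thesis unfolding norm_of_real z_def by (simp add: abs_le_iff)
  qed
  have "cmod ((\<Prod>e\<in>P. char (distr M borel (X e)) t) - (\<Prod>e\<in>P. complex_of_real z)) \<le>
     (\<Sum>e\<in>P. cmod (char (distr M borel (X e)) t - z))"
  proof (rule norm_prod_diff)
    fix e assume "e \<in> P"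
    then interpret d: real_distribution "distr M borel (X e)" by (intro real_distribution_distr rv)
    show "cmod (char (distr M borel (X e)) t) \<le> 1" by (rule d.cmod_char_le_1)
  qed (rule z1)
  also have "\<dots> \<le> (\<Sum>e\<in>P. t\<^sup>2 / 6 * (\<bar>t\<bar> / (?N * sqrt W)))" by (intro sum_mono step)
  also have "\<dots> = \<bar>t\<bar>^3 / (6 * sqrt W)" using N W by (simp add: power3_eq_cube power2_eq_square)
  finally show ?thesis using c by (simp add: z_def)
qed

end

section \<open>Convergence in distribution of random vectors\<close>

lemma tendsto_fun_coordinatewise:
  fixes f :: "'a \<Rightarrow> 'i \<Rightarrow> 'b::topological_space"
  assumes "\<And>i. ((\<lambda>n. f n i) \<longlongrightarrow> l i) F"
  shows "(f \<longlongrightarrow> l) F"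
proof -
  have "limitin (product_topology (\<lambda>_. euclidean) UNIV) f l F"
    unfolding limitin_componentwise using assms by (simp add: limitin_canonical_iff)
  then show ?thesis by (simp add: euclidean_product_topology limitin_canonical_iff)
qed

text \<open>
  Functions on the index set \<open>I\<close> are extended to the whole index type, where sequential compactness, limits and
  Borel measurability are available through type classes.
\<close>

lemma continuous_on_product_extension:
  assumes f: "continuous_map (product_topology (\<lambda>_. euclideanreal) I) euclideanreal f"
  shows "continuous_on UNIV (\<lambda>x. f (restrict x I))"
proof -
  have "continuous_map (product_topology (\<lambda>_. euclideanreal) UNIV) (product_topology (\<lambda>_. euclideanreal) I) (\<lambda>x. restrict x I)"
    unfolding continuous_map_componentwise
    by (auto intro!: continuous_map_product_projection[OF UNIV_I])
  from continuous_map_compose[OF this f] show ?thesis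
    by (simp add: comp_def euclidean_product_topology)
qed

lemma continuous_map_imp_measurable_PiM:
  fixes I :: "'i::countable set" and f :: "('i \<Rightarrow> real) \<Rightarrow> real"
  assumes f: "continuous_map (product_topology (\<lambda>_. euclideanreal) I) euclideanreal f"
  shows "f \<in> borel_measurable (PiM I (\<lambda>_. borel))"
proof -
  define h where "h x = f (restrict x I)" for x
  define e where "e x = (\<lambda>i. if i \<in> I then x i else (0::real))" for x :: "'i \<Rightarrow> real"
  have "h \<in> borel_measurable borel"
    unfolding h_def by (rule borel_measurable_continuous_onI[OF continuous_on_product_extension[OF f]])
  moreover have "e \<in> measurable (PiM I (\<lambda>_. borel)) borel"
  proof (rule measurable_coordinatewise_then_product)
    fix i show "(\<lambda>x. e x i) \<in> borel_measurable (PiM I (\<lambda>_. borel))"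
      unfolding e_def by (cases "i \<in> I") auto
  qed
  ultimately have "(\<lambda>x. h (e x)) \<in> borel_measurable (PiM I (\<lambda>_. borel))" by measurable
  moreover have "h (e x) = f x" if "x \<in> space (PiM I (\<lambda>_. borel))" for x
  proof -
    have "restrict (e x) I = x" using that by (auto simp: space_PiM e_def PiE_def extensional_def fun_eq_iff)
    then show ?thesis by (simp add: h_def)
  qed
  ultimately show ?thesis by (simp cong: measurable_cong)
qed

text \<open>
  Two measures on a finite product agree if they agree on boxes, and coordinatewise preimages of boxes are boxes.
\<close>

lemma (in product_prob_space) distr_PiM_coordinatewise:
  assumes I: "finite I" and Y: "\<And>i. Y i \<in> measurable (M i) (N i)"
  shows "distr (PiM I M) (PiM I N) (\<lambda>x. \<lambda>i\<in>I. Y i (x i)) = PiM I (\<lambda>i. distr (M i) (N i) (Y i))"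
proof -
  interpret D: product_prob_space "\<lambda>i. distr (M i) (N i) (Y i)"
    by (rule product_prob_spaceI) (rule prob_space.prob_space_distr[OF M.prob_space_axioms Y])
  have m: "(\<lambda>x. \<lambda>i\<in>I. Y i (x i)) \<in> measurable (PiM I M) (PiM I N)"
    by (rule measurable_restrict) (rule measurable_compose[OF measurable_component_singleton], assumption, rule Y)
  show ?thesis
  proof (rule D.PiM_eqI[OF I])
    show "sets (distr (PiM I M) (PiM I N) (\<lambda>x. \<lambda>i\<in>I. Y i (x i))) = sets (PiM I (\<lambda>i. distr (M i) (N i) (Y i)))"
      by (simp cong: sets_PiM_cong)
    fix A assume A: "\<And>i. i \<in> I \<Longrightarrow> A i \<in> sets (distr (M i) (N i) (Y i))"
    then have A': "\<And>i. i \<in> I \<Longrightarrow> A i \<in> sets (N i)" by simp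
    have "(\<lambda>x. \<lambda>i\<in>I. Y i (x i)) -` PiE I A \<inter> space (PiM I M) = PiE I (\<lambda>i. Y i -` A i \<inter> space (M i))"
      by (auto simp: space_PiM PiE_iff)
    then have "emeasure (distr (PiM I M) (PiM I N) (\<lambda>x. \<lambda>i\<in>I. Y i (x i))) (PiE I A) =
        emeasure (PiM I M) (PiE I (\<lambda>i. Y i -` A i \<inter> space (M i)))"
      using m A' I by (subst emeasure_distr) (auto intro!: sets_PiM_I_finite)
    also have "\<dots> = (\<Prod>i\<in>I. emeasure (M i) (Y i -` A i \<inter> space (M i)))"
      using I A' Y by (intro emeasure_PiM measurable_sets[OF Y]) auto
    also have "\<dots> = (\<Prod>i\<in>I. emeasure (distr (M i) (N i) (Y i)) (A i))"
      using A' Y by (intro prod.cong refl) (simp add: emeasure_distr)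
    finally show "emeasure (distr (PiM I M) (PiM I N) (\<lambda>x. \<lambda>i\<in>I. Y i (x i))) (PiE I A) =
      (\<Prod>i\<in>I. emeasure (distr (M i) (N i) (Y i)) (A i))" .
  qed
qed

text \<open>
  Skorohod's theorem realizes each coordinate by variables that converge everywhere. On the product of these
  probability spaces the vectors converge coordinatewise, hence \<open>f\<close> of them converges, and dominated convergence
  applies.
\<close>

lemma weak_conv_PiM:
  fixes I :: "'i::countable set" and P :: "nat \<Rightarrow> 'i \<Rightarrow> real measure"
  assumes I: "finite I"
    and P: "\<And>n i. real_distribution (P n i)" and Q: "\<And>i. real_distribution (Q i)"
    and conv: "\<And>i. weak_conv_m (\<lambda>n. P n i) (Q i)"
  shows "weak_conv_vec I (\<lambda>n. PiM I (P n)) (PiM I Q)"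
  unfolding weak_conv_vec_def
proof (intro allI impI)
  fix f :: "('i \<Rightarrow> real) \<Rightarrow> real"
  assume f: "continuous_map (product_topology (\<lambda>_. euclideanreal) I) euclideanreal f"
    and bd: "bounded (f ` (I \<rightarrow>\<^sub>E UNIV))"
  from bd obtain B where B: "\<And>x. x \<in> I \<rightarrow>\<^sub>E UNIV \<Longrightarrow> \<bar>f x\<bar> \<le> B"
    unfolding bounded_iff by auto
  have "\<exists>(\<Omega> :: real measure) Y Y0. prob_space \<Omega> \<and> (\<forall>n. Y n \<in> measurable \<Omega> borel) \<and>
      (\<forall>n. distr \<Omega> borel (Y n) = P n i) \<and> Y0 \<in> measurable \<Omega> borel \<and> distr \<Omega> borel Y0 = Q i \<and>
      (\<forall>x\<in>space \<Omega>. (\<lambda>n. Y n x) \<longlonglongrightarrow> Y0 x)" for i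
    using Skorohod[OF P Q conv, of i] by (simp add: measurable_lborel1)
  then obtain \<Omega> :: "'i \<Rightarrow> real measure" and Y :: "'i \<Rightarrow> nat \<Rightarrow> real \<Rightarrow> real" and Y0 :: "'i \<Rightarrow> real \<Rightarrow> real"
    where \<Omega>: "\<And>i. prob_space (\<Omega> i)" and Ym: "\<And>i n. Y i n \<in> measurable (\<Omega> i) borel"
      and Yd: "\<And>i n. distr (\<Omega> i) borel (Y i n) = P n i"
      and Y0m: "\<And>i. Y0 i \<in> measurable (\<Omega> i) borel" and Y0d: "\<And>i. distr (\<Omega> i) borel (Y0 i) = Q i"
      and lim: "\<And>i x. x \<in> space (\<Omega> i) \<Longrightarrow> (\<lambda>n. Y i n x) \<longlonglongrightarrow> Y0 i x"
    by metis
  interpret product_prob_space \<Omega> by (rule product_prob_spaceI[OF \<Omega>])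
  have fm: "f \<in> borel_measurable (PiM I (\<lambda>_. borel))" by (rule continuous_map_imp_measurable_PiM[OF f])
  have Zm: "(\<lambda>x. \<lambda>i\<in>I. Z i (x i)) \<in> measurable (PiM I \<Omega>) (PiM I (\<lambda>_. borel))"
    if "\<And>i. Z i \<in> measurable (\<Omega> i) borel" for Z :: "'i \<Rightarrow> real \<Rightarrow> real"
    by (rule measurable_restrict) (rule measurable_compose[OF measurable_component_singleton], assumption, rule that)
  have Zi: "(\<integral>y. f y \<partial>PiM I (\<lambda>i. distr (\<Omega> i) borel (Z i))) = (\<integral>x. f (\<lambda>i\<in>I. Z i (x i)) \<partial>PiM I \<Omega>)"
    if Z: "\<And>i. Z i \<in> measurable (\<Omega> i) borel" for Z :: "'i \<Rightarrow> real \<Rightarrow> real"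
    unfolding distr_PiM_coordinatewise[OF I Z, symmetric]
    by (rule integral_distr[OF Zm[OF Z] fm])
  interpret PP: prob_space "PiM I \<Omega>" by (rule prob_space_PiM) (rule \<Omega>)
  have "(\<lambda>n. \<integral>x. f (\<lambda>i\<in>I. Y i n (x i)) \<partial>PiM I \<Omega>) \<longlonglongrightarrow> (\<integral>x. f (\<lambda>i\<in>I. Y0 i (x i)) \<partial>PiM I \<Omega>)"
  proof (rule integral_dominated_convergence[where w = "\<lambda>_. B"])
    show "(\<lambda>x. f (\<lambda>i\<in>I. Y0 i (x i))) \<in> borel_measurable (PiM I \<Omega>)"
      by (rule measurable_compose[OF Zm[OF Y0m] fm])
    show "(\<lambda>x. f (\<lambda>i\<in>I. Y i n (x i))) \<in> borel_measurable (PiM I \<Omega>)" for n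
      by (rule measurable_compose[OF Zm[OF Ym] fm])
    show "AE x in PiM I \<Omega>. (\<lambda>n. f (\<lambda>i\<in>I. Y i n (x i))) \<longlonglongrightarrow> f (\<lambda>i\<in>I. Y0 i (x i))"
    proof (rule AE_I2)
      fix x assume x: "x \<in> space (PiM I \<Omega>)"
      have "(\<lambda>n i. if i \<in> I then Y i n (x i) else 0) \<longlonglongrightarrow> (\<lambda>i. if i \<in> I then Y0 i (x i) else 0)"
      proof (rule tendsto_fun_coordinatewise)
        fix i
        show "(\<lambda>n. if i \<in> I then Y i n (x i) else 0) \<longlonglongrightarrow> (if i \<in> I then Y0 i (x i) else 0)"
          using lim[of "x i" i] x by (cases "i \<in> I") (auto simp: space_PiM)
      qed
      from continuous_on_tendsto_compose[OF continuous_on_product_extension[OF f] this]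
      show "(\<lambda>n. f (\<lambda>i\<in>I. Y i n (x i))) \<longlonglongrightarrow> f (\<lambda>i\<in>I. Y0 i (x i))"
        by (simp add: restrict_def cong: if_cong)
    qed
    show "AE x in PiM I \<Omega>. norm (f (\<lambda>i\<in>I. Y i n (x i))) \<le> B" for n
      using B by (intro AE_I2) auto
  qed simp
  then show "(\<lambda>n. \<integral>y. f y \<partial>PiM I (P n)) \<longlonglongrightarrow> (\<integral>y. f y \<partial>PiM I Q)"
    using Zi[OF Y0m] Zi[OF Ym] by (simp add: Yd Y0d)
qed

text \<open>
  Heine's theorem on a cube: otherwise there are pairs of points \<open>x\<^sub>k\<close>, \<open>y\<^sub>k\<close> that approach each other while
  their values stay \<open>\<epsilon>\<close> apart, and a common limit point contradicts continuity. Only \<open>y\<close> is required to lie in the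
  cube, so that the lemma applies to perturbations that leave it.
\<close>

lemma uniform_on_box:
  fixes I :: "'i::countable set" and f :: "('i \<Rightarrow> real) \<Rightarrow> real"
  assumes f: "continuous_map (product_topology (\<lambda>_. euclideanreal) I) euclideanreal f" and \<epsilon>: "\<epsilon> > 0"
  shows "\<exists>d>0. \<forall>x\<in>I \<rightarrow>\<^sub>E UNIV. \<forall>y\<in>I \<rightarrow>\<^sub>E UNIV. (\<forall>i\<in>I. \<bar>y i\<bar> \<le> L \<and> \<bar>x i - y i\<bar> \<le> d) \<longrightarrow> \<bar>f x - f y\<bar> \<le> \<epsilon>"
proof (rule ccontr)
  assume neg: "\<not> ?thesis"
  have "\<exists>x y. x \<in> I \<rightarrow>\<^sub>E UNIV \<and> y \<in> I \<rightarrow>\<^sub>E UNIV \<and> (\<forall>i\<in>I. \<bar>y i\<bar> \<le> L \<and> \<bar>x i - y i\<bar> \<le> 1 / real (Suc k)) \<and> \<not> \<bar>f x - f y\<bar> \<le> \<epsilon>" for k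
    using neg[unfolded not_ex, rule_format, of "1 / real (Suc k)"] by auto
  then obtain x y where x: "\<And>k. x k \<in> I \<rightarrow>\<^sub>E UNIV" and y: "\<And>k. y k \<in> I \<rightarrow>\<^sub>E UNIV"
    and yL: "\<And>k i. i \<in> I \<Longrightarrow> \<bar>y k i\<bar> \<le> L" and xy: "\<And>k i. i \<in> I \<Longrightarrow> \<bar>x k i - y k i\<bar> \<le> 1 / real (Suc k)"
    and far: "\<And>k. \<epsilon> < \<bar>f (x k) - f (y k)\<bar>"
    by (metis not_le)
  define e where "e z = (\<lambda>i. if i \<in> I then z i else (0::real))" for z :: "'i \<Rightarrow> real"
  have fe: "f (restrict (e z) I) = f z" if "z \<in> I \<rightarrow>\<^sub>E UNIV" for z
  proof -
    have "restrict (e z) I = z" using that by (auto simp: e_def PiE_def extensional_def fun_eq_iff)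
    then show ?thesis by simp
  qed
  have "compactin (product_topology (\<lambda>_. euclideanreal) UNIV) (PiE UNIV (\<lambda>i::'i. if i \<in> I then {-L..L} else {0}))"
    unfolding compactin_PiE by auto
  then have "compact (PiE UNIV (\<lambda>i::'i. if i \<in> I then {-L..L} else {0::real}))"
    by (simp add: euclidean_product_topology)
  then have sc: "seq_compact (PiE UNIV (\<lambda>i::'i. if i \<in> I then {-L..L} else {0::real}))"
    by (rule compact_imp_seq_compact)
  have ey: "e (y k) \<in> PiE UNIV (\<lambda>i::'i. if i \<in> I then {-L..L} else {0::real})" for k
    using yL by (auto simp: e_def abs_le_iff minus_le_iff)
  then obtain l r where r: "strict_mono (r :: nat \<Rightarrow> nat)" "((\<lambda>k. e (y k)) \<circ> r) \<longlonglongrightarrow> l"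
    using sc[unfolded seq_compact_def, rule_format, of "\<lambda>k. e (y k)"] by blast
  have yl: "(\<lambda>k. e (y (r k))) \<longlonglongrightarrow> l" using r(2) by (simp add: comp_def)
  have xl: "(\<lambda>k. e (x (r k))) \<longlonglongrightarrow> l"
  proof (rule tendsto_fun_coordinatewise)
    fix i
    have "continuous_on UNIV (\<lambda>z :: 'i \<Rightarrow> real. z i)" by (rule continuous_on_product_coordinates)
    from continuous_on_tendsto_compose[OF this yl]
    have yi: "(\<lambda>k. e (y (r k)) i) \<longlonglongrightarrow> l i" by simp
    have "(\<lambda>k. 1 / real (Suc (r k))) \<longlonglongrightarrow> 0"
      using LIMSEQ_subseq_LIMSEQ[OF LIMSEQ_inverse_real_of_nat r(1)] by (simp add: comp_def inverse_eq_divide)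
    then have "(\<lambda>k. e (x (r k)) i - e (y (r k)) i) \<longlonglongrightarrow> 0"
      by (rule Lim_null_comparison[rotated]) (use xy in \<open>auto simp: e_def\<close>)
    from tendsto_add[OF this yi] show "(\<lambda>k. e (x (r k)) i) \<longlonglongrightarrow> l i" by simp
  qed
  note c = continuous_on_tendsto_compose[OF continuous_on_product_extension[OF f]]
  have "(\<lambda>k. f (x (r k)) - f (y (r k))) \<longlonglongrightarrow> 0"
    using tendsto_diff[OF c[OF xl] c[OF yl]] by (simp add: fe[OF x] fe[OF y])
  then have "eventually (\<lambda>k. \<bar>f (x (r k)) - f (y (r k))\<bar> < \<epsilon>) sequentially"
    using \<epsilon> by (auto simp: tendsto_iff dist_real_def)
  then obtain k where "\<bar>f (x (r k)) - f (y (r k))\<bar> < \<epsilon>" by (auto simp: eventually_sequentially)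
  with far[of "r k"] show False by simp
qed

lemma continuous_map_coordinate [continuous_intros]:
  "i \<in> I \<Longrightarrow> continuous_map (product_topology (\<lambda>_. euclideanreal) I) euclideanreal (\<lambda>x. x i)"
  by (rule continuous_map_product_projection)

text \<open>
  Tightness of a weakly convergent sequence: a bounded continuous function that vanishes near the origin and is
  \<open>1\<close> far away has small integral under the limit, hence under all late members of the sequence.
\<close>

lemma weak_conv_vec_tight:
  fixes I :: "'i::countable set" and P :: "nat \<Rightarrow> ('i \<Rightarrow> real) measure"
  assumes I: "finite I" and P: "\<And>n. prob_space (P n)" "\<And>n. sets (P n) = sets (PiM I (\<lambda>_. borel))"
    and Q: "prob_space Q" "sets Q = sets (PiM I (\<lambda>_. borel))"
    and conv: "weak_conv_vec I P Q" and \<epsilon>: "\<epsilon> > 0"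
  shows "\<exists>L. eventually (\<lambda>n. measure (P n) {y \<in> space (P n). \<not> (\<forall>i\<in>I. \<bar>y i\<bar> \<le> L)} \<le> \<epsilon>) sequentially"
proof -
  interpret Q: prob_space Q by (rule Q(1))
  \<comment> \<open>Continuous, \<open>0\<close> where the coordinates sum up to at most \<open>K\<close>, and \<open>1\<close> where one of them exceeds \<open>K + 1\<close>.\<close>
  define \<phi> where "\<phi> K y = min 1 (max 0 ((\<Sum>i\<in>I. \<bar>y i\<bar>) - real K))" for K :: nat and y :: "'i \<Rightarrow> real"
  have cont: "continuous_map (product_topology (\<lambda>_. euclideanreal) I) euclideanreal (\<phi> K)" for K
    unfolding \<phi>_def using I
    by (intro continuous_map_real_min continuous_map_real_max continuous_map_diff continuous_map_sum
        continuous_map_real_abs continuous_map_coordinate continuous_map_const[THEN iffD2]) auto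
  have m: "\<phi> K \<in> borel_measurable N" if "sets N = sets (PiM I (\<lambda>_. borel))" for K N
    using continuous_map_imp_measurable_PiM[OF cont] that by (simp cong: measurable_cong_sets)
  have b: "\<bar>\<phi> K y\<bar> \<le> 1" "0 \<le> \<phi> K y" for K y by (auto simp: \<phi>_def)
  have "(\<lambda>K. \<integral>y. \<phi> K y \<partial>Q) \<longlonglongrightarrow> (\<integral>y. 0 \<partial>Q)"
  proof (rule integral_dominated_convergence[where w = "\<lambda>_. 1"])
    show "AE y in Q. (\<lambda>K. \<phi> K y) \<longlonglongrightarrow> 0"
    proof (rule AE_I2)
      fix y
      have "eventually (\<lambda>K. \<phi> K y = 0) sequentially"
        using eventually_ge_at_top[of "nat \<lceil>\<Sum>i\<in>I. \<bar>y i\<bar>\<rceil>"]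
        by eventually_elim (auto simp: \<phi>_def)
      then show "(\<lambda>K. \<phi> K y) \<longlonglongrightarrow> 0" by (rule tendsto_eventually)
    qed
  qed (use m[OF Q(2)] b in auto)
  then have "eventually (\<lambda>K. (\<integral>y. \<phi> K y \<partial>Q) < \<epsilon>) sequentially"
    using \<epsilon> by (intro order_tendstoD(2)) auto
  then obtain K where K: "(\<integral>y. \<phi> K y \<partial>Q) < \<epsilon>" by (auto simp: eventually_sequentially)
  have "bounded (\<phi> K ` (I \<rightarrow>\<^sub>E UNIV))" unfolding bounded_iff using b by auto
  with conv cont have "(\<lambda>n. \<integral>y. \<phi> K y \<partial>P n) \<longlonglongrightarrow> (\<integral>y. \<phi> K y \<partial>Q)"
    unfolding weak_conv_vec_def by blast
  then have "eventually (\<lambda>n. (\<integral>y. \<phi> K y \<partial>P n) < \<epsilon>) sequentially"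
    using K by (rule order_tendstoD(2))
  then have "eventually (\<lambda>n. measure (P n) {y \<in> space (P n). \<not> (\<forall>i\<in>I. \<bar>y i\<bar> \<le> real K + 1)} \<le> \<epsilon>) sequentially"
  proof eventually_elim
    case (elim n)
    interpret P: prob_space "P n" by (rule P(1))
    have int: "integrable (P n) (\<phi> K)"
      by (rule P.integrable_const_bound[of _ 1]) (use b m[OF P(2)] in auto)
    have meas: "{y \<in> space (P n). 1 \<le> \<phi> K y} \<in> sets (P n)"
      using m[OF P(2)] by measurable
    have "measure (P n) {y \<in> space (P n). \<not> (\<forall>i\<in>I. \<bar>y i\<bar> \<le> real K + 1)} \<le> measure (P n) {y \<in> space (P n). 1 \<le> \<phi> K y}"
    proof (rule P.finite_measure_mono[OF _ meas], safe)
      fix y i assume i: "i \<in> I" "\<not> \<bar>y i\<bar> \<le> real K + 1"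
      have "\<bar>y i\<bar> \<le> (\<Sum>i\<in>I. \<bar>y i\<bar>)" using I i by (intro member_le_sum) auto
      then show "1 \<le> \<phi> K y" using i by (auto simp: \<phi>_def)
    qed
    also have "\<dots> \<le> (\<integral>y. \<phi> K y \<partial>P n) / 1"
      using int b by (intro integral_Markov_inequality_measure[of _ _ "{}"]) auto
    finally show ?case using elim by simp
  qed
  then show ?thesis by blast
qed

text \<open>
  A form of Slutsky's theorem. The deviation is allowed to be proportional to \<open>1 + \<bar>Y\<bar>\<close>, which is what a
  linearization with relative error and a rescaling by a factor near \<open>1\<close> produce; tightness of \<open>Y\<close> makes it small.
  The laws \<open>P n\<close> are given for all \<open>n\<close>, and those of \<open>Y n\<close> are compared with them from \<open>n0\<close> on only.
\<close>

lemma weak_conv_vec_perturb: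
  fixes I :: "'i::countable set" and M :: "nat \<Rightarrow> 'w measure" and X Y :: "nat \<Rightarrow> 'w \<Rightarrow> 'i \<Rightarrow> real"
  assumes I: "finite I" and M: "\<And>n. n \<ge> n0 \<Longrightarrow> prob_space (M n)"
    and X: "\<And>n. n \<ge> n0 \<Longrightarrow> X n \<in> measurable (M n) (PiM I (\<lambda>_. borel))"
    and Y: "\<And>n. n \<ge> n0 \<Longrightarrow> Y n \<in> measurable (M n) (PiM I (\<lambda>_. borel))"
    and P: "\<And>n. prob_space (P n)" "\<And>n. sets (P n) = sets (PiM I (\<lambda>_. borel))"
    and YP: "\<And>n. n \<ge> n0 \<Longrightarrow> distr (M n) (PiM I (\<lambda>_. borel)) (Y n) = P n"
    and Q: "prob_space Q" "sets Q = sets (PiM I (\<lambda>_. borel))"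
    and conv: "weak_conv_vec I P Q"
    and B: "\<And>n. n \<ge> n0 \<Longrightarrow> B n \<in> sets (M n)" "(\<lambda>n. measure (M n) (B n)) \<longlonglongrightarrow> 0"
    and \<delta>: "\<delta> \<longlonglongrightarrow> 0"
    and close: "\<And>n \<omega> i. n \<ge> n0 \<Longrightarrow> \<omega> \<in> space (M n) \<Longrightarrow> \<omega> \<notin> B n \<Longrightarrow> i \<in> I \<Longrightarrow>
      \<bar>X n \<omega> i - Y n \<omega> i\<bar> \<le> \<delta> n * (1 + \<bar>Y n \<omega> i\<bar>)"
  shows "weak_conv_vec I (\<lambda>n. distr (M n) (PiM I (\<lambda>_. borel)) (X n)) Q"
  unfolding weak_conv_vec_def
proof (intro allI impI)
  fix f :: "('i \<Rightarrow> real) \<Rightarrow> real"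
  assume f: "continuous_map (product_topology (\<lambda>_. euclideanreal) I) euclideanreal f"
    and bd: "bounded (f ` (I \<rightarrow>\<^sub>E UNIV))"
  from bd obtain C0 where "\<And>x. x \<in> I \<rightarrow>\<^sub>E UNIV \<Longrightarrow> \<bar>f x\<bar> \<le> C0"
    unfolding bounded_iff by auto
  then have C: "\<And>x. x \<in> I \<rightarrow>\<^sub>E UNIV \<Longrightarrow> \<bar>f x\<bar> \<le> max C0 1" by fastforce
  define C where "C = max C0 1"
  have C1: "C \<ge> 1" and C: "\<And>x. x \<in> I \<rightarrow>\<^sub>E UNIV \<Longrightarrow> \<bar>f x\<bar> \<le> C" using C by (auto simp: C_def)
  have fm: "f \<in> borel_measurable (PiM I (\<lambda>_. borel))" by (rule continuous_map_imp_measurable_PiM[OF f])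
  have lim: "(\<lambda>n. \<integral>y. f y \<partial>P n) \<longlonglongrightarrow> (\<integral>y. f y \<partial>Q)"
    using conv f bd unfolding weak_conv_vec_def by blast
  have "(\<lambda>n. (\<integral>y. f y \<partial>distr (M n) (PiM I (\<lambda>_. borel)) (X n)) - (\<integral>y. f y \<partial>P n)) \<longlonglongrightarrow> 0"
  proof (rule tendstoI)
    fix e :: real assume e: "e > 0"
    obtain L where L: "eventually (\<lambda>n. measure (P n) {y \<in> space (P n). \<not> (\<forall>i\<in>I. \<bar>y i\<bar> \<le> L)} \<le> e / (8 * C)) sequentially"
      using weak_conv_vec_tight[OF I P Q conv, of "e / (8 * C)"] e C1 by auto
    define L' where "L' = max L 0"
    obtain d where d: "d > 0" "\<And>x y. x \<in> I \<rightarrow>\<^sub>E UNIV \<Longrightarrow> y \<in> I \<rightarrow>\<^sub>E UNIV \<Longrightarrow>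
         (\<And>i. i \<in> I \<Longrightarrow> \<bar>y i\<bar> \<le> L' \<and> \<bar>x i - y i\<bar> \<le> d) \<Longrightarrow> \<bar>f x - f y\<bar> \<le> e / 4"
      using uniform_on_box[OF f, of "e/4" L'] e by (metis zero_less_divide_iff zero_less_numeral)
    have "(\<lambda>n. \<delta> n * (1 + L')) \<longlonglongrightarrow> 0" using tendsto_mult_right[OF \<delta>, of "1 + L'"] by simp
    then have ev\<delta>: "eventually (\<lambda>n. \<delta> n * (1 + L') < d) sequentially" using d(1) by (rule order_tendstoD(2))
    have evB: "eventually (\<lambda>n. measure (M n) (B n) < e / (8 * C)) sequentially"
      using B(2) by (rule order_tendstoD(2)) (use e C1 in auto)
    show "eventually (\<lambda>n. dist ((\<integral>y. f y \<partial>distr (M n) (PiM I (\<lambda>_. borel)) (X n)) - (\<integral>y. f y \<partial>P n)) 0 < e) sequentially"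
      using L ev\<delta> evB eventually_ge_at_top[of n0]
    proof eventually_elim
      case (elim n)
      interpret M: prob_space "M n" by (rule M[OF elim(4)])
      note Xn = X[OF elim(4)] and Yn = Y[OF elim(4)]
      have XE: "X n \<omega> \<in> I \<rightarrow>\<^sub>E UNIV" "Y n \<omega> \<in> I \<rightarrow>\<^sub>E UNIV" if "\<omega> \<in> space (M n)" for \<omega>
        using measurable_space[OF Xn that] measurable_space[OF Yn that] by (auto simp: space_PiM)
      define T where "T = {\<omega> \<in> space (M n). \<not> (\<forall>i\<in>I. \<bar>Y n \<omega> i\<bar> \<le> L)}"
      have Ts: "{y \<in> space (P n). \<not> (\<forall>i\<in>I. \<bar>y i\<bar> \<le> L)} \<in> sets (PiM I (\<lambda>_. borel))"
        unfolding sets_eq_imp_space_eq[OF P(2)] using I by measurable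
      have Teq: "T = Y n -` {y \<in> space (P n). \<not> (\<forall>i\<in>I. \<bar>y i\<bar> \<le> L)} \<inter> space (M n)"
        using measurable_space[OF Yn] by (auto simp: T_def sets_eq_imp_space_eq[OF P(2)])
      have Tm: "T \<in> sets (M n)" unfolding Teq by (rule measurable_sets[OF Yn Ts])
      have Tp: "measure (M n) T \<le> e / (8 * C)"
        using elim(1) unfolding Teq YP[OF elim(4), symmetric]
        by (subst (asm) measure_distr[OF Yn]) (use Ts YP[OF elim(4)] in auto)
      have fX: "(\<lambda>\<omega>. f (X n \<omega>)) \<in> borel_measurable (M n)" by (rule measurable_compose[OF Xn fm])
      have fY: "(\<lambda>\<omega>. f (Y n \<omega>)) \<in> borel_measurable (M n)" by (rule measurable_compose[OF Yn fm])
      have iX: "integrable (M n) (\<lambda>\<omega>. f (X n \<omega>))"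
        by (rule M.integrable_const_bound[of _ C]) (use fX C XE in auto)
      have iY: "integrable (M n) (\<lambda>\<omega>. f (Y n \<omega>))"
        by (rule M.integrable_const_bound[of _ C]) (use fY C XE in auto)
      note Bn = B(1)[OF elim(4)]
      have iI: "integrable (M n) (\<lambda>\<omega>. e / 4 + 2 * C * indicator (B n \<union> T) \<omega>)"
        using Bn Tm by (intro Bochner_Integration.integrable_add integrable_mult_right) (auto simp: M.emeasure_eq_measure)
      have "(\<integral>y. f y \<partial>distr (M n) (PiM I (\<lambda>_. borel)) (X n)) - (\<integral>y. f y \<partial>P n) =
          (\<integral>\<omega>. f (X n \<omega>) - f (Y n \<omega>) \<partial>M n)"
        unfolding YP[OF elim(4), symmetric] integral_distr[OF Xn fm] integral_distr[OF Yn fm] using iX iY by simp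
      also have "\<bar>\<dots>\<bar> \<le> (\<integral>\<omega>. \<bar>f (X n \<omega>) - f (Y n \<omega>)\<bar> \<partial>M n)" by (rule integral_abs_bound)
      also have "\<dots> \<le> (\<integral>\<omega>. e / 4 + 2 * C * indicator (B n \<union> T) \<omega> \<partial>M n)"
      proof (rule integral_mono)
        show "integrable (M n) (\<lambda>\<omega>. \<bar>f (X n \<omega>) - f (Y n \<omega>)\<bar>)" using iX iY by auto
        fix \<omega> assume w: "\<omega> \<in> space (M n)"
        show "\<bar>f (X n \<omega>) - f (Y n \<omega>)\<bar> \<le> e / 4 + 2 * C * indicator (B n \<union> T) \<omega>"
        proof (cases "\<omega> \<in> B n \<union> T")
          case True
          have "\<bar>f (X n \<omega>)\<bar> \<le> C" "\<bar>f (Y n \<omega>)\<bar> \<le> C" using C XE w by auto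
          then show ?thesis using True e by (simp add: indicator_def)
        next
          case False
          have "\<bar>f (X n \<omega>) - f (Y n \<omega>)\<bar> \<le> e / 4"
          proof (rule d(2)[OF XE[OF w]])
            fix i assume i: "i \<in> I"
            have y: "\<bar>Y n \<omega> i\<bar> \<le> L'" using False w i by (auto simp: T_def L'_def)
            have c: "\<bar>X n \<omega> i - Y n \<omega> i\<bar> \<le> \<delta> n * (1 + \<bar>Y n \<omega> i\<bar>)" using close[OF elim(4) w _ i] False by auto
            then have "0 \<le> \<delta> n * (1 + \<bar>Y n \<omega> i\<bar>)" by linarith
            then have "0 \<le> \<delta> n" unfolding zero_le_mult_iff by linarith
            then have "\<delta> n * (1 + \<bar>Y n \<omega> i\<bar>) \<le> \<delta> n * (1 + L')" using y by (intro mult_left_mono) auto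
            then show "\<bar>Y n \<omega> i\<bar> \<le> L' \<and> \<bar>X n \<omega> i - Y n \<omega> i\<bar> \<le> d" using y c elim(2) by linarith
          qed
          then show ?thesis using False by simp
        qed
      qed (rule iI)
      also have "\<dots> = e / 4 + 2 * C * measure (M n) (B n \<union> T)"
        using Bn Tm iI by (subst Bochner_Integration.integral_add) (auto simp: M.emeasure_eq_measure M.prob_space)
      also have "\<dots> \<le> e / 4 + 2 * C * (e / (8 * C) + e / (8 * C))"
      proof -
        have "measure (M n) (B n \<union> T) \<le> measure (M n) (B n) + measure (M n) T"
          using Bn Tm by (rule measure_Un_le)
        also have "\<dots> \<le> e / (8 * C) + e / (8 * C)" using elim(3) Tp by linarith
        finally show ?thesis using C1 by (intro add_left_mono mult_left_mono) auto
      qed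
      also have "\<dots> = 3 * e / 4" using C1 by (simp add: field_simps)
      also have "\<dots> < e" using e by simp
      finally show ?case by (simp add: dist_real_def)
    qed
  qed
  from tendsto_add[OF this lim] show "(\<lambda>n. \<integral>y. f y \<partial>distr (M n) (PiM I (\<lambda>_. borel)) (X n)) \<longlonglongrightarrow> (\<integral>y. f y \<partial>Q)"
    by simp
qed

lemma weak_conv_m_from_char_bound:
  fixes P :: "nat \<Rightarrow> real measure" and N :: "nat \<Rightarrow> nat" and W :: "nat \<Rightarrow> real"
  assumes P: "\<And>n. real_distribution (P n)"
    and N: "filterlim N at_top sequentially" and W: "filterlim W at_top sequentially"
    and bound: "\<And>t. eventually (\<lambda>n. t\<^sup>2 \<le> 4 * real (N n) \<longrightarrow>
        cmod (char (P n) t - (1 + (- (t\<^sup>2) / 2) / real (N n)) ^ N n) \<le> \<bar>t\<bar>^3 / (6 * sqrt (W n))) sequentially"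
  shows "weak_conv_m P std_normal_distribution"
proof (rule levy_continuity)
  fix t :: real
  have N': "filterlim (\<lambda>n. real (N n)) at_top sequentially"
    using filterlim_compose[OF filterlim_real_sequentially N] .
  have evN: "eventually (\<lambda>n. t\<^sup>2 \<le> 4 * real (N n)) sequentially"
    using N'[unfolded filterlim_at_top, rule_format, of "t\<^sup>2"] by eventually_elim (smt (verit) zero_le_power2)
  have "filterlim (\<lambda>n. sqrt (W n)) at_top sequentially"
    by (rule filterlim_compose[OF sqrt_at_top W])
  then have "(\<lambda>n. \<bar>t\<bar>^3 / 6 * inverse (sqrt (W n))) \<longlonglongrightarrow> \<bar>t\<bar>^3 / 6 * 0"
    by (intro tendsto_intros tendsto_inverse_0_at_top)
  then have b0: "(\<lambda>n. \<bar>t\<bar>^3 / (6 * sqrt (W n))) \<longlonglongrightarrow> 0" by (simp add: field_simps)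
  have "(\<lambda>n. char (P n) t - complex_of_real ((1 + (- (t\<^sup>2) / 2) / real (N n)) ^ N n)) \<longlonglongrightarrow> 0"
    by (rule Lim_null_comparison[OF _ b0]) (use eventually_conj[OF bound[of t] evN] in \<open>auto elim!: eventually_mono\<close>)
  moreover have "(\<lambda>n. complex_of_real ((1 + (- (t\<^sup>2) / 2) / real (N n)) ^ N n)) \<longlonglongrightarrow> complex_of_real (exp (- (t\<^sup>2) / 2))"
    using filterlim_compose[OF tendsto_exp_limit_sequentially N, of "- (t\<^sup>2) / 2"]
    by (intro tendsto_of_real)
  ultimately have "(\<lambda>n. char (P n) t) \<longlonglongrightarrow> complex_of_real (exp (- (t\<^sup>2) / 2))"
    by (rule Lim_transform[rotated])
  then show "(\<lambda>n. char (P n) t) \<longlonglongrightarrow> char std_normal_distribution t"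
    by (simp add: char_std_normal_distribution)
qed (use P in \<open>auto intro!: real_dist_normal_dist\<close>)

section \<open>Scores split by edge class\<close>

lemma fit_alt: "fit \<gamma> \<alpha> n S m b (i, j) = logistic (mu_of \<gamma> n m + beta_of \<alpha> n S b i + beta_of \<alpha> n S b j)"
  by (simp add: fit_def edge_prob_logistic)

lemma num_edges_noise:
  "num_edges n a - (\<Sum>e\<in>node_pairs n. fit \<gamma> \<alpha> n S m b e) = noise (mu_of \<gamma> n m) (beta_of \<alpha> n S b) (node_pairs n) a"
  by (simp add: num_edges_def noise_def fit_def sum_subtractf case_prod_beta)

lemma node_degree_noise:
  assumes "k \<in> {1..n}" "\<And>i j. i \<in> {1..n} \<Longrightarrow> j \<in> {1..n} \<Longrightarrow> a i j = a j i"
  shows "node_degree n a k - (\<Sum>e\<in>star n k UNIV. fit \<gamma> \<alpha> n S m b e) =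
     noise (mu_of \<gamma> n m) (beta_of \<alpha> n S b) (star n k UNIV) a"
proof -
  have "node_degree n a k = (\<Sum>(i, j)\<in>star n k UNIV. of_bool (a i j))"
    using assms by (rule node_degree_eq)
  then show ?thesis unfolding noise_def fit_def by (simp only: sum_subtractf case_prod_unfold)
qed

text \<open>
  The three classes of pairs at a fixed number of nodes. The constants bound the derivative (\<open>a0\<close>, \<open>a1\<close>, from
  below) and the probability (\<open>b1\<close>, \<open>b2\<close>, from above) uniformly over the parameter box: index \<open>0\<close> refers to outer
  pairs, \<open>1\<close> to mixed pairs and \<open>2\<close> to inner pairs.
\<close>

locale edge_regimes =
  fixes \<gamma> \<alpha> :: real and n :: nat and S :: "nat set" and M1 M2 a0 a1 b1 b2 :: real
  assumes S: "S \<subseteq> {1..n}"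
    and a0: "\<And>m. m \<in> {-M1..M1} \<Longrightarrow> a0 \<le> dlogistic (mu_of \<gamma> n m)"
    and a1: "\<And>m b. m \<in> {-M1..M1} \<Longrightarrow> b \<in> {0..M2} \<Longrightarrow> a1 \<le> dlogistic (mu_of \<gamma> n m + (\<alpha> * ln (real n) + b))"
    and b1: "\<And>m b. m \<in> {-M1..M1} \<Longrightarrow> b \<in> {0..M2} \<Longrightarrow> logistic (mu_of \<gamma> n m + (\<alpha> * ln (real n) + b)) \<le> b1"
    and b2: "\<And>m b b'. m \<in> {-M1..M1} \<Longrightarrow> b \<in> {0..M2} \<Longrightarrow> b' \<in> {0..M2} \<Longrightarrow>
      logistic (mu_of \<gamma> n m + (\<alpha> * ln (real n) + b) + (\<alpha> * ln (real n) + b')) \<le> b2"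
begin

abbreviation "s \<equiv> real (card S)"
abbreviation "q \<equiv> real (card ({1..n} - S))"
abbreviation "N \<equiv> real (card (pairs_in n (- S)))"
abbreviation "F \<equiv> fit \<gamma> \<alpha> n S"
abbreviation "Z m b P a \<equiv> noise (mu_of \<gamma> n m) (beta_of \<alpha> n S b) P a"
abbreviation "par \<equiv> param_space S M1 M2"

lemma finite_S [simp]: "finite S"
  using finite_subset[OF S] by simp

lemma parD: "(m, b) \<in> par \<Longrightarrow> m \<in> {-M1..M1}" "(m, b) \<in> par \<Longrightarrow> i \<in> S \<Longrightarrow> b i \<in> {0..M2}"
  by (auto simp: param_space_def)

lemma fit_pos: "0 < F m b e"
  by (cases e) (auto simp: fit_alt logistic_pos)

lemma fit_outer: "e \<in> pairs_in n (- S) \<Longrightarrow> F m b e = logistic (mu_of \<gamma> n m)"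
  by (cases e) (auto simp: fit_alt pairs_in_def beta_of_def)

lemma fit_star: "k \<in> S \<Longrightarrow> e \<in> star n k (- S) \<Longrightarrow> F m b e = logistic (mu_of \<gamma> n m + (\<alpha> * ln (real n) + b k))"
  by (cases e) (auto simp: fit_alt star_def beta_of_def add.assoc)

lemma fit_inner: "(m, b) \<in> par \<Longrightarrow> e \<in> pairs_in n S \<Longrightarrow> F m b e \<le> b2"
  using b2 by (cases e) (auto simp: fit_alt pairs_in_def beta_of_def param_space_def)

lemma star_inner: "k \<in> S \<Longrightarrow> star n k S \<subseteq> pairs_in n S"
  by (auto simp: star_def pairs_in_def)

lemma card_star_outer: "k \<in> S \<Longrightarrow> real (card (star n k (- S))) = q"
proof -
  assume k: "k \<in> S"
  then have "k \<in> {1..n}" "{1..n} \<inter> - S - {k} = {1..n} - S" using S by auto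
  then show ?thesis by (simp only: card_star)
qed

lemma card_star_inner: "k \<in> S \<Longrightarrow> real (card (star n k S)) \<le> s"
proof -
  assume k: "k \<in> S"
  then have "card (star n k S) = card ({1..n} \<inter> S - {k})" using S by (intro card_star) auto
  also have "\<dots> \<le> card S" by (rule card_mono) auto
  finally show ?thesis by simp
qed

lemma card_pairs_inner: "real (card (pairs_in n S)) \<le> s\<^sup>2"
proof -
  have "{1..n} \<inter> S = S" using S by auto
  then show ?thesis using card_pairs_in_le[of n S] by simp
qed

lemma q_le: "q \<le> real n"
proof -
  have "card ({1..n} - S) \<le> card {1..n}" by (rule card_mono) auto
  then show ?thesis by simp
qed

lemma b1_nonneg: "(m, b) \<in> par \<Longrightarrow> k \<in> S \<Longrightarrow> 0 \<le> b1"
  using b1[of m "b k"] parD(1)[of m b] parD(2)[of m b k] logistic_pos by (meson less_le_trans less_imp_le)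

lemma b2_nonneg: "(m, b) \<in> par \<Longrightarrow> k \<in> S \<Longrightarrow> 0 \<le> b2"
  using b2[of m "b k" "b k"] parD(1)[of m b] parD(2)[of m b k] logistic_pos by (meson less_le_trans less_imp_le)

context
  fixes m b m' b'
  assumes par: "(m, b) \<in> par" "(m', b') \<in> par"
begin

lemma diff_inner: "P \<subseteq> pairs_in n S \<Longrightarrow> (\<Sum>e\<in>P. \<bar>F m' b' e - F m b e\<bar>) \<le> real (card P) * b2"
proof -
  assume P: "P \<subseteq> pairs_in n S"
  have "(\<Sum>e\<in>P. \<bar>F m' b' e - F m b e\<bar>) \<le> (\<Sum>e\<in>P. b2)"
  proof (rule sum_mono)
    fix e assume "e \<in> P"
    then have e: "e \<in> pairs_in n S" using P by auto
    show "\<bar>F m' b' e - F m b e\<bar> \<le> b2"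
      using fit_inner[OF par(1) e] fit_inner[OF par(2) e] fit_pos[of m b e] fit_pos[of m' b' e] by linarith
  qed
  then show ?thesis by simp
qed

lemma diff_star_inner: "k \<in> S \<Longrightarrow> (\<Sum>e\<in>star n k S. \<bar>F m' b' e - F m b e\<bar>) \<le> s * b2"
proof -
  assume k: "k \<in> S"
  have "(\<Sum>e\<in>star n k S. \<bar>F m' b' e - F m b e\<bar>) \<le> real (card (star n k S)) * b2"
    by (rule diff_inner[OF star_inner[OF k]])
  also have "\<dots> \<le> s * b2"
    by (rule mult_right_mono[OF card_star_inner[OF k] b2_nonneg[OF par(1) k]])
  finally show ?thesis .
qed

lemma diff_star_outer: "k \<in> S \<Longrightarrow> (\<Sum>e\<in>star n k (- S). F m' b' e - F m b e) =
    q * (logistic (mu_of \<gamma> n m' + (\<alpha> * ln (real n) + b' k)) - logistic (mu_of \<gamma> n m + (\<alpha> * ln (real n) + b k)))"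
  by (simp add: fit_star card_star_outer)

lemma diff_outer: "(\<Sum>e\<in>pairs_in n (- S). F m' b' e - F m b e) = N * (logistic (mu_of \<gamma> n m') - logistic (mu_of \<gamma> n m))"
  by (simp add: fit_outer)

text \<open>
  Every pair that is not outer belongs to the star of some \<open>k \<in> S\<close>, and there the difference of two
  probabilities is at most their common upper bound.
\<close>

lemma diff_pairs_outer:
  "\<bar>(\<Sum>e\<in>node_pairs n. F m' b' e - F m b e) - N * (logistic (mu_of \<gamma> n m') - logistic (mu_of \<gamma> n m))\<bar>
    \<le> s * (real n * b1 + s * b2)"
proof -
  have "\<bar>(\<Sum>e\<in>node_pairs n. F m' b' e - F m b e) - (\<Sum>e\<in>pairs_in n (- S). F m' b' e - F m b e)\<bar>
     \<le> (\<Sum>k\<in>S. \<Sum>e\<in>star n k UNIV. \<bar>F m' b' e - F m b e\<bar>)"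
    by (rule sum_pairs_diff_le[OF S])
  also have "\<dots> \<le> (\<Sum>k\<in>S. real n * b1 + s * b2)"
  proof (rule sum_mono)
    fix k assume k: "k \<in> S"
    have "(\<Sum>e\<in>star n k (- S). \<bar>F m' b' e - F m b e\<bar>) \<le> (\<Sum>e\<in>star n k (- S). b1)"
    proof (rule sum_mono)
      fix e assume e: "e \<in> star n k (- S)"
      have "F m b e \<le> b1" "F m' b' e \<le> b1"
        unfolding fit_star[OF k e] using b1 parD par k by blast+
      then show "\<bar>F m' b' e - F m b e\<bar> \<le> b1" using fit_pos[of m b e] fit_pos[of m' b' e] by linarith
    qed
    also have "\<dots> = q * b1" using card_star_outer[OF k] by simp
    also have "\<dots> \<le> real n * b1" by (rule mult_right_mono[OF q_le b1_nonneg[OF par(1) k]])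
    finally show "(\<Sum>e\<in>star n k UNIV. \<bar>F m' b' e - F m b e\<bar>) \<le> real n * b1 + s * b2"
      unfolding sum_star_split[of _ n k S] using diff_star_inner[OF k] by linarith
  qed
  finally show ?thesis unfolding diff_outer by simp
qed

lemma mu_gap: "a0 * \<bar>m' - m\<bar> \<le> \<bar>logistic (mu_of \<gamma> n m') - logistic (mu_of \<gamma> n m)\<bar>"
proof -
  have "a0 * \<bar>mu_of \<gamma> n m' - mu_of \<gamma> n m\<bar> \<le> \<bar>logistic (mu_of \<gamma> n m') - logistic (mu_of \<gamma> n m)\<bar>"
  proof (rule logistic_diff_ge)
    fix z assume z: "min (mu_of \<gamma> n m) (mu_of \<gamma> n m') \<le> z" "z \<le> max (mu_of \<gamma> n m) (mu_of \<gamma> n m')"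
    have "a0 \<le> dlogistic (mu_of \<gamma> n (z + \<gamma> * ln (real n)))"
      using z parD(1)[OF par(1)] parD(1)[OF par(2)] by (intro a0) (auto simp: mu_of_def min_def max_def split: if_splits)
    then show "a0 \<le> dlogistic z" by (simp add: mu_of_def)
  qed
  then show ?thesis by (simp add: mu_of_def)
qed

lemma beta_gap:
  assumes k: "k \<in> S"
  shows "a1 * \<bar>b' k - b k\<bar> \<le> \<bar>logistic (mu_of \<gamma> n m' + (\<alpha> * ln (real n) + b' k)) - logistic (mu_of \<gamma> n m' + (\<alpha> * ln (real n) + b k))\<bar>"
proof -
  let ?c = "mu_of \<gamma> n m' + \<alpha> * ln (real n)"
  have "a1 * \<bar>(?c + b' k) - (?c + b k)\<bar> \<le> \<bar>logistic (?c + b' k) - logistic (?c + b k)\<bar>"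
  proof (rule logistic_diff_ge)
    fix z assume z: "min (?c + b k) (?c + b' k) \<le> z" "z \<le> max (?c + b k) (?c + b' k)"
    have "z - ?c \<in> {0..M2}"
      using z parD(2)[OF par(1) k] parD(2)[OF par(2) k] by (auto simp: min_def max_def split: if_splits)
    from a1[OF parD(1)[OF par(2)] this] show "a1 \<le> dlogistic z" by simp
  qed
  then show ?thesis by (simp add: add.assoc)
qed

lemma mu_lipschitz:
  assumes k: "k \<in> S"
  shows "\<bar>logistic (mu_of \<gamma> n m' + (\<alpha> * ln (real n) + b k)) - logistic (mu_of \<gamma> n m + (\<alpha> * ln (real n) + b k))\<bar> \<le> b1 * \<bar>m' - m\<bar>"
proof -
  let ?c = "\<alpha> * ln (real n) + b k"
  have "\<bar>logistic (mu_of \<gamma> n m' + ?c) - logistic (mu_of \<gamma> n m + ?c)\<bar> \<le> b1 * \<bar>(mu_of \<gamma> n m' + ?c) - (mu_of \<gamma> n m + ?c)\<bar>"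
  proof (rule logistic_diff_le)
    fix z assume z: "min (mu_of \<gamma> n m + ?c) (mu_of \<gamma> n m' + ?c) \<le> z" "z \<le> max (mu_of \<gamma> n m + ?c) (mu_of \<gamma> n m' + ?c)"
    have "z - ?c + \<gamma> * ln (real n) \<in> {-M1..M1}"
      using z parD(1)[OF par(1)] parD(1)[OF par(2)] by (auto simp: mu_of_def min_def max_def split: if_splits)
    from b1[OF this parD(2)[OF par(1) k]] have "logistic z \<le> b1" by (simp add: mu_of_def)
    then show "dlogistic z \<le> b1" using dlogistic_le_logistic[of z] by linarith
  qed
  then show ?thesis by (simp add: mu_of_def)
qed

end

context
  fixes a and m0 :: real and b0 :: "nat \<Rightarrow> real" and mh :: real and bh :: "nat \<Rightarrow> real"
  assumes mle: "is_mle \<gamma> \<alpha> n S M1 M2 a mh bh" and true: "(m0, b0) \<in> par"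
    and sym: "\<And>i j. i \<in> {1..n} \<Longrightarrow> j \<in> {1..n} \<Longrightarrow> a i j = a j i"
begin

lemma mle_par: "(mh, bh) \<in> par"
  using mle_in_space[OF mle] by (auto simp: param_space_def)

lemma degree_noise:
  "k \<in> S \<Longrightarrow> node_degree n a k - (\<Sum>e\<in>star n k UNIV. F m0 b0 e) = Z m0 b0 (star n k UNIV) a"
  using S sym by (intro node_degree_noise) auto

text \<open>
  If \<open>mh > m0\<close>, every outer pair has a larger fitted than true probability, while the score inequality says that
  the fitted expected number of edges does not exceed the observed one; hence the increase over outer pairs is paid
  for by the noise and by the other pairs. The case \<open>mh < m0\<close> is symmetric.
\<close>

lemma mu_error_bound:
  "N * a0 * \<bar>mh - m0\<bar> \<le> \<bar>Z m0 b0 (node_pairs n) a\<bar> + s * (real n * b1 + s * b2)"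
proof -
  let ?D = "logistic (mu_of \<gamma> n mh) - logistic (mu_of \<gamma> n m0)"
  let ?T = "\<Sum>e\<in>node_pairs n. F mh bh e - F m0 b0 e"
  note gap = mu_gap[OF true mle_par] and near = diff_pairs_outer[OF true mle_par]
  have mh: "mh \<in> {-M1..M1}" "m0 \<in> {-M1..M1}" using parD[OF mle_par] parD[OF true] by auto
  have *: "N * \<bar>?D\<bar> \<le> \<bar>Z m0 b0 (node_pairs n) a\<bar> + s * (real n * b1 + s * b2)"
  proof (cases mh m0 rule: linorder_cases)
    case less
    then have "num_edges n a \<le> (\<Sum>e\<in>node_pairs n. F mh bh e)" using mh by (intro mle_score_mu(2)[OF mle]) auto
    then have "Z m0 b0 (node_pairs n) a \<le> ?T" unfolding num_edges_noise[symmetric] by (simp add: sum_subtractf)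
    moreover have "?D \<le> 0" using less by (simp add: logistic_mono mu_of_def)
    then have "N * \<bar>?D\<bar> = - (N * ?D)" by (simp only: abs_of_nonpos mult_minus_right)
    ultimately show ?thesis using near by linarith
  next
    case greater
    then have "(\<Sum>e\<in>node_pairs n. F mh bh e) \<le> num_edges n a" using mh by (intro mle_score_mu(1)[OF mle]) auto
    then have "?T \<le> Z m0 b0 (node_pairs n) a" unfolding num_edges_noise[symmetric] by (simp add: sum_subtractf)
    moreover have "0 \<le> ?D" using greater by (simp add: logistic_mono mu_of_def)
    then have "N * \<bar>?D\<bar> = N * ?D" by simp
    ultimately show ?thesis using near by linarith
  qed (use near in auto)
  have "N * (a0 * \<bar>mh - m0\<bar>) \<le> N * \<bar>?D\<bar>" using gap by (intro mult_left_mono) auto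
  with * show ?thesis by (simp add: mult.assoc)
qed

text \<open>
  The argument of \<open>mu_error_bound\<close> for the star of \<open>k\<close>: the log-odds of its pairs with outside nodes is
  moved from \<open>\<mu> + \<beta> k\<close> in two steps, first the \<open>\<mu>\<close> part, which costs the error in \<open>\<mu>\<close>, then the \<open>\<beta> k\<close> part.
\<close>

lemma beta_error_bound:
  assumes k: "k \<in> S"
  shows "q * a1 * \<bar>bh k - b0 k\<bar> \<le> \<bar>Z m0 b0 (star n k UNIV) a\<bar> + s * b2 + q * b1 * \<bar>mh - m0\<bar>"
proof -
  let ?x = "\<lambda>m b. mu_of \<gamma> n m + (\<alpha> * ln (real n) + b)"
  let ?D = "logistic (?x mh (bh k)) - logistic (?x mh (b0 k))"
  let ?E = "logistic (?x mh (b0 k)) - logistic (?x m0 (b0 k))"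
  let ?T = "\<Sum>e\<in>star n k UNIV. F mh bh e - F m0 b0 e"
  let ?I = "\<Sum>e\<in>star n k S. F mh bh e - F m0 b0 e"
  note gap = beta_gap[OF true mle_par k] and lip = mu_lipschitz[OF true mle_par k]
  have "\<bar>?I\<bar> \<le> s * b2" using sum_abs diff_star_inner[OF true mle_par k] by (rule order_trans)
  moreover have "?T = q * (logistic (?x mh (bh k)) - logistic (?x m0 (b0 k))) + ?I"
    unfolding sum_star_split[of _ n k S] diff_star_outer[OF true mle_par k] ..
  then have "?T = q * ?D + q * ?E + ?I" by (simp add: algebra_simps)
  moreover have "\<bar>q * ?E\<bar> \<le> q * (b1 * \<bar>mh - m0\<bar>)" unfolding abs_mult using lip by (intro mult_mono) auto
  ultimately have near: "\<bar>?T - q * ?D\<bar> \<le> s * b2 + q * b1 * \<bar>mh - m0\<bar>" by (simp add: mult.assoc)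
  have bh: "bh k \<in> {0..M2}" "b0 k \<in> {0..M2}" using parD(2)[OF mle_par k] parD(2)[OF true k] by auto
  have *: "q * \<bar>?D\<bar> \<le> \<bar>Z m0 b0 (star n k UNIV) a\<bar> + s * b2 + q * b1 * \<bar>mh - m0\<bar>"
  proof (cases "bh k" "b0 k" rule: linorder_cases)
    case less
    then have "node_degree n a k \<le> (\<Sum>e\<in>star n k UNIV. F mh bh e)"
      using bh by (intro mle_score_beta(2)[OF mle k S]) auto
    then have "Z m0 b0 (star n k UNIV) a \<le> ?T"
      unfolding degree_noise[OF k, symmetric] by (simp add: sum_subtractf)
    moreover have "?D \<le> 0" using less by (simp add: logistic_mono)
    then have "q * \<bar>?D\<bar> = - (q * ?D)" by (simp only: abs_of_nonpos mult_minus_right)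
    ultimately show ?thesis using near by linarith
  next
    case greater
    then have "(\<Sum>e\<in>star n k UNIV. F mh bh e) \<le> node_degree n a k"
      using bh by (intro mle_score_beta(1)[OF mle k S]) auto
    then have "?T \<le> Z m0 b0 (star n k UNIV) a"
      unfolding degree_noise[OF k, symmetric] by (simp add: sum_subtractf)
    moreover have "0 \<le> ?D" using greater by (simp add: logistic_mono)
    then have "q * \<bar>?D\<bar> = q * ?D" by simp
    ultimately show ?thesis using near by linarith
  qed (use near in auto)
  have "q * (a1 * \<bar>bh k - b0 k\<bar>) \<le> q * \<bar>?D\<bar>" using gap by (intro mult_left_mono) auto
  with * show ?thesis by (simp add: mult.assoc)
qed

context
  assumes mh_int: "-M1 < mh" "mh < M1" and bh_int: "\<And>k. k \<in> S \<Longrightarrow> 0 < bh k \<and> bh k < M2"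
begin

lemma score_star: "k \<in> S \<Longrightarrow> (\<Sum>e\<in>star n k UNIV. F mh bh e - F m0 b0 e) = Z m0 b0 (star n k UNIV) a"
proof -
  assume k: "k \<in> S"
  have "(\<Sum>e\<in>star n k UNIV. F mh bh e) = node_degree n a k"
    using mle_score_beta[OF mle k S] bh_int[OF k] by fastforce
  then show ?thesis unfolding degree_noise[OF k, symmetric] by (simp add: sum_subtractf)
qed

lemma score_pairs: "(\<Sum>e\<in>node_pairs n. F mh bh e - F m0 b0 e) = Z m0 b0 (node_pairs n) a"
proof -
  have "(\<Sum>e\<in>node_pairs n. F mh bh e) = num_edges n a"
    using mle_score_mu[OF mle] mh_int by fastforce
  then show ?thesis unfolding num_edges_noise[symmetric] by (simp add: sum_subtractf)
qed

text \<open>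
  The combination of score equations in which the mixed pairs cancel.
\<close>

lemma mu_score_equation:
  obtains r where "N * (logistic (mu_of \<gamma> n mh) - logistic (mu_of \<gamma> n m0)) = Z m0 b0 (pairs_in n (- S)) a + r"
    and "\<bar>r\<bar> \<le> \<bar>Z m0 b0 (pairs_in n S) a\<bar> + s\<^sup>2 * b2"
proof -
  define g where "g e = F mh bh e - F m0 b0 e" for e
  define h where "h e = of_bool (a (fst e) (snd e)) - F m0 b0 e" for e
  have Zh: "Z m0 b0 P a = (\<Sum>e\<in>P. h e)" for P by (simp add: noise_def h_def fit_def case_prod_beta)
  have "(\<Sum>e\<in>pairs_in n (- S). g e) - (\<Sum>e\<in>pairs_in n S. g e) = (\<Sum>e\<in>node_pairs n. g e) - (\<Sum>k\<in>S. \<Sum>e\<in>star n k UNIV. g e)"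
    by (rule sum_pairs_minus_stars[OF S, symmetric])
  also have "\<dots> = (\<Sum>e\<in>node_pairs n. h e) - (\<Sum>k\<in>S. \<Sum>e\<in>star n k UNIV. h e)"
    using score_pairs score_star unfolding Zh g_def by simp
  also have "\<dots> = (\<Sum>e\<in>pairs_in n (- S). h e) - (\<Sum>e\<in>pairs_in n S. h e)"
    by (rule sum_pairs_minus_stars[OF S])
  finally have eq: "(\<Sum>e\<in>pairs_in n (- S). g e) = Z m0 b0 (pairs_in n (- S)) a + ((\<Sum>e\<in>pairs_in n S. g e) - Z m0 b0 (pairs_in n S) a)"
    unfolding Zh by linarith
  have "\<bar>\<Sum>e\<in>pairs_in n S. g e\<bar> \<le> (\<Sum>e\<in>pairs_in n S. \<bar>g e\<bar>)" by (rule sum_abs)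
  also have "\<dots> \<le> real (card (pairs_in n S)) * b2" unfolding g_def by (rule diff_inner[OF true mle_par order_refl])
  also have "\<dots> \<le> s\<^sup>2 * b2"
  proof (cases "S = {}")
    case True then show ?thesis by (simp add: pairs_in_def)
  next
    case False
    then obtain k where "k \<in> S" by auto
    then show ?thesis by (intro mult_right_mono card_pairs_inner b2_nonneg[OF true])
  qed
  finally have "\<bar>(\<Sum>e\<in>pairs_in n S. g e) - Z m0 b0 (pairs_in n S) a\<bar> \<le> \<bar>Z m0 b0 (pairs_in n S) a\<bar> + s\<^sup>2 * b2" by linarith
  with eq show ?thesis unfolding g_def diff_outer[OF true mle_par] by (rule that)
qed

lemma beta_score_equation:
  assumes k: "k \<in> S"
  obtains r where "q * (logistic (mu_of \<gamma> n mh + (\<alpha> * ln (real n) + bh k)) - logistic (mu_of \<gamma> n m0 + (\<alpha> * ln (real n) + b0 k)))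
       = Z m0 b0 (star n k (- S)) a + r"
    and "\<bar>r\<bar> \<le> \<bar>Z m0 b0 (star n k S) a\<bar> + s * b2"
proof -
  let ?I = "\<Sum>e\<in>star n k S. F mh bh e - F m0 b0 e"
  have "\<bar>?I\<bar> \<le> s * b2" using sum_abs diff_star_inner[OF true mle_par k] by (rule order_trans)
  moreover have "Z m0 b0 (star n k UNIV) a = Z m0 b0 (star n k (- S)) a + Z m0 b0 (star n k S) a"
    unfolding noise_def by (rule sum_star_split)
  ultimately show ?thesis
    using score_star[OF k] that[of "Z m0 b0 (star n k S) a - ?I"]
    unfolding sum_star_split[of _ n k S] diff_star_outer[OF true mle_par k] by fastforce
qed

end

end

end

section \<open>Rates and linearization at a fixed number of nodes\<close>

lemma mult_le_powr:
  fixes x :: real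
  assumes "a \<le> x powr y" "b \<le> x powr z" "0 \<le> b"
  shows "a * b \<le> x powr (y + z)"
proof -
  have "a * b \<le> x powr y * x powr z" using assms by (intro mult_mono) auto
  then show ?thesis by (simp add: powr_add)
qed

text \<open>
  The bounds of the three classes as powers of \<open>n\<close>. Every factor \<open>n powr o(1)\<close> is rounded up to \<open>n powr \<epsilon>\<close>, and
  \<open>c\<close> measures by which power of \<open>n\<close> the size of \<open>S\<close> stays below \<open>n powr (1 - \<alpha>)\<close>.
\<close>

locale regime_rates = edge_regimes \<gamma> \<alpha> n S M1 M2
    "real n powr (- \<gamma> - \<epsilon>)" "real n powr (- (\<gamma> - \<alpha>) - \<epsilon>)" "real n powr (- (\<gamma> - \<alpha>) + \<epsilon>)"
    "real n powr (min 0 (2 * \<alpha> - \<gamma>) + \<epsilon>)"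
  for \<gamma> \<alpha> n S M1 M2 and \<epsilon> :: real +
  fixes c :: real
  assumes b0: "\<And>m. m \<in> {-M1..M1} \<Longrightarrow> logistic (mu_of \<gamma> n m) \<le> real n powr (- \<gamma> + \<epsilon>)"
    and eps: "0 < \<epsilon>" and c: "0 < c" and n1: "1 \<le> real n" and large: "3 \<le> real n powr \<epsilon>"
    and s_le: "s \<le> real n powr (1 - \<alpha> - c)"
    and q_ge: "real n powr (1 - \<epsilon>) \<le> q" and N_ge: "real n powr (2 - \<epsilon>) \<le> N"
    and \<alpha>0: "0 \<le> \<alpha>" and \<gamma>2: "\<gamma> < 2" and rho: "0 \<le> \<gamma> - \<alpha>" "\<gamma> - \<alpha> < 1"
begin

abbreviation "\<nu> \<equiv> real n"
abbreviation "\<rho> \<equiv> \<gamma> - \<alpha>"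

lemma mono: "y \<le> z \<Longrightarrow> \<nu> powr y \<le> \<nu> powr z"
  using n1 by (rule powr_mono[rotated])

text \<open>
  Numerical constants are traded for one more \<open>\<epsilon>\<close> in the exponent.
\<close>

lemma absorb: "a \<le> K * \<nu> powr y \<Longrightarrow> K \<le> 3 \<Longrightarrow> y + \<epsilon> \<le> z \<Longrightarrow> a \<le> \<nu> powr z"
proof -
  assume a: "a \<le> K * \<nu> powr y" "K \<le> 3" "y + \<epsilon> \<le> z"
  have "K * \<nu> powr y \<le> \<nu> powr \<epsilon> * \<nu> powr y" using a large by (intro mult_right_mono) auto
  also have "\<dots> = \<nu> powr (y + \<epsilon>)" by (simp add: powr_add)
  also have "\<dots> \<le> \<nu> powr z" by (rule mono[OF a(3)])
  finally show ?thesis using a(1) by linarith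
qed

lemma ratio_le:
  assumes "x \<le> K * \<nu> powr y" "\<nu> powr z \<le> w" "0 \<le> K"
  shows "x / w \<le> K * \<nu> powr (y - z)"
proof -
  have z: "0 < \<nu> powr z" using n1 by simp
  have "x / w \<le> (K * \<nu> powr y) / \<nu> powr z" using assms z by (intro frac_le) auto
  then show ?thesis by (simp add: powr_diff)
qed

lemma sqrt_powr: "\<nu> powr \<epsilon> * sqrt (\<nu> powr x) = \<nu> powr (x / 2 + \<epsilon>)"
  by (simp add: powr_half_sqrt[symmetric] powr_powr powr_add)

lemma nu_powr_1: "\<nu> \<le> \<nu> powr 1" using n1 by simp

lemma N_le: "N \<le> \<nu> powr 2"
proof -
  have "N \<le> (real (card ({1..n} \<inter> - S)))\<^sup>2" by (rule card_pairs_in_le)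
  also have "\<dots> \<le> \<nu>\<^sup>2"
  proof (rule power_mono)
    have "card ({1..n} \<inter> - S) \<le> card {1..n}" by (rule card_mono) auto
    then show "real (card ({1..n} \<inter> - S)) \<le> \<nu>" by simp
  qed simp
  also have "\<dots> = \<nu> powr 2" using n1 by (simp add: powr_numeral)
  finally show ?thesis .
qed

text \<open>
  Up to \<open>\<epsilon>\<close>, this bound on the expected number of mixed edges is smaller by the factor \<open>n powr - c\<close> than the order
  \<open>n powr (2 - \<gamma>)\<close> of the expected number of outer ones.
\<close>

lemma cross_le: "s * (\<nu> * \<nu> powr (- \<rho> + \<epsilon>)) \<le> \<nu> powr (2 - \<gamma> - c + \<epsilon>)"
  by (rule order_trans[OF mult_le_powr[OF s_le mult_le_powr[OF nu_powr_1 order_refl]] mono]) auto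

lemma inner_le: "s * \<nu> powr (min 0 (2 * \<alpha> - \<gamma>) + \<epsilon>) \<le> \<nu> powr (1 - \<rho> - c + \<epsilon>)"
  by (rule order_trans[OF mult_le_powr[OF s_le order_refl] mono]) auto

lemma inner2_le: "s * (s * \<nu> powr (min 0 (2 * \<alpha> - \<gamma>) + \<epsilon>)) \<le> \<nu> powr (2 - \<gamma> - c + \<epsilon>)"
  by (rule order_trans[OF mult_le_powr[OF s_le inner_le] mono]) (use c in auto)

lemma nuisance_le:
  "s * (\<nu> * \<nu> powr (- \<rho> + \<epsilon>) + s * \<nu> powr (min 0 (2 * \<alpha> - \<gamma>) + \<epsilon>)) \<le> 2 * \<nu> powr (2 - \<gamma> - c + \<epsilon>)"
  unfolding distrib_left using cross_le inner2_le by linarith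

lemma sum_fit_star:
  assumes par: "(m, b) \<in> par" and k: "k \<in> S"
  shows "(\<Sum>e\<in>star n k UNIV. F m b e) \<le> \<nu> * \<nu> powr (- \<rho> + \<epsilon>) + s * \<nu> powr (min 0 (2 * \<alpha> - \<gamma>) + \<epsilon>)"
proof -
  have "(\<Sum>e\<in>star n k (- S). F m b e) \<le> (\<Sum>e\<in>star n k (- S). \<nu> powr (- \<rho> + \<epsilon>))"
  proof (rule sum_mono)
    fix e assume "e \<in> star n k (- S)"
    from fit_star[OF k this, of m b] show "F m b e \<le> \<nu> powr (- \<rho> + \<epsilon>)"
      using b1[OF parD(1)[OF par] parD(2)[OF par k]] by simp
  qed
  also have "\<dots> = q * \<nu> powr (- \<rho> + \<epsilon>)" using card_star_outer[OF k] by simp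
  also have "\<dots> \<le> \<nu> * \<nu> powr (- \<rho> + \<epsilon>)" using q_le by (rule mult_right_mono) simp
  finally have 1: "(\<Sum>e\<in>star n k (- S). F m b e) \<le> \<nu> * \<nu> powr (- \<rho> + \<epsilon>)" .
  have "(\<Sum>e\<in>star n k S. F m b e) \<le> (\<Sum>e\<in>star n k S. \<nu> powr (min 0 (2 * \<alpha> - \<gamma>) + \<epsilon>))"
    using star_inner[OF k] by (intro sum_mono fit_inner[OF par]) auto
  also have "\<dots> \<le> s * \<nu> powr (min 0 (2 * \<alpha> - \<gamma>) + \<epsilon>)"
    using card_star_inner[OF k] by (simp add: mult_right_mono)
  finally show ?thesis unfolding sum_star_split[of _ n k S] using 1 by linarith
qed

lemma mean_star:
  assumes par: "(m, b) \<in> par" and k: "k \<in> S"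
  shows "(\<Sum>e\<in>star n k UNIV. F m b e) \<le> \<nu> powr (1 - \<rho> + 2 * \<epsilon>)"
proof -
  have "\<nu> * \<nu> powr (- \<rho> + \<epsilon>) \<le> \<nu> powr (1 - \<rho> + \<epsilon>)"
    by (rule order_trans[OF mult_le_powr[OF nu_powr_1 order_refl] mono]) auto
  moreover have "\<nu> powr (1 - \<rho> - c + \<epsilon>) \<le> \<nu> powr (1 - \<rho> + \<epsilon>)" by (rule mono) (use c in auto)
  ultimately have "(\<Sum>e\<in>star n k UNIV. F m b e) \<le> 2 * \<nu> powr (1 - \<rho> + \<epsilon>)"
    using sum_fit_star[OF par k] inner_le by linarith
  then show ?thesis by (rule absorb) auto
qed

lemma mean_outer:
  assumes par: "(m, b) \<in> par"
  shows "(\<Sum>e\<in>pairs_in n (- S). F m b e) \<le> \<nu> powr (2 - \<gamma> + \<epsilon>)"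
proof -
  have "(\<Sum>e\<in>pairs_in n (- S). F m b e) \<le> (\<Sum>e\<in>pairs_in n (- S). \<nu> powr (- \<gamma> + \<epsilon>))"
    using b0[OF parD(1)[OF par]] by (intro sum_mono) (simp add: fit_outer)
  also have "\<dots> = N * \<nu> powr (- \<gamma> + \<epsilon>)" by simp
  also have "\<dots> \<le> \<nu> powr (2 - \<gamma> + \<epsilon>)"
    by (rule order_trans[OF mult_le_powr[OF N_le order_refl] mono]) auto
  finally show ?thesis .
qed

lemma mean_pairs:
  assumes par: "(m, b) \<in> par"
  shows "(\<Sum>e\<in>node_pairs n. F m b e) \<le> \<nu> powr (2 - \<gamma> + 2 * \<epsilon>)"
proof -
  have "\<bar>(\<Sum>e\<in>node_pairs n. F m b e) - (\<Sum>e\<in>pairs_in n (- S). F m b e)\<bar> \<le> (\<Sum>k\<in>S. \<Sum>e\<in>star n k UNIV. \<bar>F m b e\<bar>)"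
    by (rule sum_pairs_diff_le[OF S])
  also have "\<dots> = (\<Sum>k\<in>S. \<Sum>e\<in>star n k UNIV. F m b e)" using fit_pos by (simp add: less_imp_le)
  also have "\<dots> \<le> (\<Sum>k\<in>S. \<nu> * \<nu> powr (- \<rho> + \<epsilon>) + s * \<nu> powr (min 0 (2 * \<alpha> - \<gamma>) + \<epsilon>))"
    by (intro sum_mono sum_fit_star[OF par])
  also have "\<dots> \<le> 2 * \<nu> powr (2 - \<gamma> - c + \<epsilon>)" using nuisance_le by simp
  also have "\<nu> powr (2 - \<gamma> - c + \<epsilon>) \<le> \<nu> powr (2 - \<gamma> + \<epsilon>)" by (rule mono) (use c in auto)
  finally have "(\<Sum>e\<in>node_pairs n. F m b e) \<le> 3 * \<nu> powr (2 - \<gamma> + \<epsilon>)"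
    using mean_outer[OF par] by linarith
  then show ?thesis by (rule absorb) auto
qed

context
  fixes a and m0 :: real and b0 :: "nat \<Rightarrow> real" and mh :: real and bh :: "nat \<Rightarrow> real" and d :: real
  assumes mle: "is_mle \<gamma> \<alpha> n S M1 M2 a mh bh" and true: "(m0, b0) \<in> par"
    and sym: "\<And>i j. i \<in> {1..n} \<Longrightarrow> j \<in> {1..n} \<Longrightarrow> a i j = a j i"
    and noise_pairs: "\<bar>Z m0 b0 (node_pairs n) a\<bar> \<le> \<nu> powr \<epsilon> * sqrt (\<nu> powr (2 - \<gamma> + 2 * \<epsilon>))"
    and noise_star: "\<And>k. k \<in> S \<Longrightarrow> \<bar>Z m0 b0 (star n k UNIV) a\<bar> \<le> \<nu> powr \<epsilon> * sqrt (\<nu> powr (1 - \<rho> + 2 * \<epsilon>))"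
    and d: "d \<le> c" "d \<le> 1 - \<gamma> / 2" "d \<le> (1 - \<rho>) / 2"
begin

lemma mu_rate: "\<bar>mh - m0\<bar> \<le> \<nu> powr (- d + 5 * \<epsilon>)"
proof -
  have e: "\<nu> powr (2 - \<gamma> - 2 * \<epsilon>) \<le> N * \<nu> powr (- \<gamma> - \<epsilon>)"
  proof -
    have "\<nu> powr (2 - \<epsilon>) * \<nu> powr (- \<gamma> - \<epsilon>) \<le> N * \<nu> powr (- \<gamma> - \<epsilon>)"
      using N_ge by (rule mult_right_mono) simp
    then show ?thesis by (simp add: powr_add[symmetric] algebra_simps)
  qed
  have "\<nu> powr (2 - \<gamma> - 2 * \<epsilon>) * \<bar>mh - m0\<bar> \<le> N * \<nu> powr (- \<gamma> - \<epsilon>) * \<bar>mh - m0\<bar>"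
    using e by (rule mult_right_mono) simp
  also have "\<dots> \<le> \<nu> powr ((2 - \<gamma> + 2 * \<epsilon>) / 2 + \<epsilon>) + 2 * \<nu> powr (2 - \<gamma> - c + \<epsilon>)"
    using mu_error_bound[OF mle true sym] noise_pairs nuisance_le unfolding sqrt_powr by linarith
  also have "\<nu> powr ((2 - \<gamma> + 2 * \<epsilon>) / 2 + \<epsilon>) \<le> \<nu> powr (2 - \<gamma> - d + 2 * \<epsilon>)"
    by (rule mono) (use d in \<open>simp add: field_simps\<close>)
  also have "\<nu> powr (2 - \<gamma> - c + \<epsilon>) \<le> \<nu> powr (2 - \<gamma> - d + 2 * \<epsilon>)" by (rule mono) (use d eps in auto)
  finally have "\<nu> powr (2 - \<gamma> - 2 * \<epsilon>) * \<bar>mh - m0\<bar> \<le> 3 * \<nu> powr (2 - \<gamma> - d + 2 * \<epsilon>)" by simp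
  also have "3 * \<nu> powr (2 - \<gamma> - d + 2 * \<epsilon>) = \<nu> powr (2 - \<gamma> - 2 * \<epsilon>) * (3 * \<nu> powr (- d + 4 * \<epsilon>))"
    by (simp add: powr_add[symmetric] algebra_simps)
  finally have "\<bar>mh - m0\<bar> \<le> 3 * \<nu> powr (- d + 4 * \<epsilon>)" using n1 by simp
  then show ?thesis by (rule absorb) auto
qed

lemma beta_rate:
  assumes k: "k \<in> S"
  shows "\<bar>bh k - b0 k\<bar> \<le> \<nu> powr (- d + 9 * \<epsilon>)"
proof -
  have e: "\<nu> powr (1 - \<rho> - 2 * \<epsilon>) \<le> q * \<nu> powr (- \<rho> - \<epsilon>)"
  proof -
    have "\<nu> powr (1 - \<epsilon>) * \<nu> powr (- \<rho> - \<epsilon>) \<le> q * \<nu> powr (- \<rho> - \<epsilon>)"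
      using q_ge by (rule mult_right_mono) simp
    then show ?thesis by (simp add: powr_add[symmetric] algebra_simps)
  qed
  have u: "q * \<nu> powr (- \<rho> + \<epsilon>) * \<bar>mh - m0\<bar> \<le> \<nu> powr (1 - \<rho> - d + 6 * \<epsilon>)"
  proof -
    have "q * \<nu> powr (- \<rho> + \<epsilon>) \<le> \<nu> powr (1 + (- \<rho> + \<epsilon>))"
      using q_le nu_powr_1 by (intro mult_le_powr) auto
    from mult_le_powr[OF this mu_rate] show ?thesis by (simp add: algebra_simps)
  qed
  have "\<nu> powr (1 - \<rho> - 2 * \<epsilon>) * \<bar>bh k - b0 k\<bar> \<le> q * \<nu> powr (- \<rho> - \<epsilon>) * \<bar>bh k - b0 k\<bar>"
    using e by (rule mult_right_mono) simp
  also have "\<dots> \<le> \<nu> powr ((1 - \<rho> + 2 * \<epsilon>) / 2 + \<epsilon>) + \<nu> powr (1 - \<rho> - c + \<epsilon>) + \<nu> powr (1 - \<rho> - d + 6 * \<epsilon>)"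
    using beta_error_bound[OF mle true sym k] noise_star[OF k] inner_le u unfolding sqrt_powr by linarith
  also have "\<nu> powr ((1 - \<rho> + 2 * \<epsilon>) / 2 + \<epsilon>) \<le> \<nu> powr (1 - \<rho> - d + 6 * \<epsilon>)"
    by (rule mono) (use d eps in \<open>simp add: field_simps\<close>)
  also have "\<nu> powr (1 - \<rho> - c + \<epsilon>) \<le> \<nu> powr (1 - \<rho> - d + 6 * \<epsilon>)" by (rule mono) (use d eps in auto)
  finally have "\<nu> powr (1 - \<rho> - 2 * \<epsilon>) * \<bar>bh k - b0 k\<bar> \<le> 3 * \<nu> powr (1 - \<rho> - d + 6 * \<epsilon>)" by simp
  also have "3 * \<nu> powr (1 - \<rho> - d + 6 * \<epsilon>) = \<nu> powr (1 - \<rho> - 2 * \<epsilon>) * (3 * \<nu> powr (- d + 8 * \<epsilon>))"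
    by (simp add: powr_add[symmetric] algebra_simps)
  finally have "\<bar>bh k - b0 k\<bar> \<le> 3 * \<nu> powr (- d + 8 * \<epsilon>)" using n1 by simp
  then show ?thesis by (rule absorb) auto
qed

end

context
  assumes s_le_half: "s \<le> \<nu> powr ((1 - \<alpha>) / 2 - c)"
begin

text \<open>
  Here \<open>min 0 (2 * \<alpha> - \<gamma>)\<close> is bounded by the mean \<open>\<alpha> - \<gamma> / 2\<close> of its two arguments; this is exactly what the
  exponent \<open>(1 - \<alpha>) / 2\<close> for the size of \<open>S\<close> is made for.
\<close>

lemma inner_half_le: "s * \<nu> powr (min 0 (2 * \<alpha> - \<gamma>) + \<epsilon>) \<le> \<nu> powr ((1 - \<rho>) / 2 - c + \<epsilon>)"
  by (rule order_trans[OF mult_le_powr[OF s_le_half order_refl] mono]) (auto simp: min_def field_simps)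

lemma inner2_half_le: "s\<^sup>2 * \<nu> powr (min 0 (2 * \<alpha> - \<gamma>) + \<epsilon>) \<le> \<nu> powr (1 - \<gamma> / 2 - 2 * c + \<epsilon>)"
proof -
  have "s * (s * \<nu> powr (min 0 (2 * \<alpha> - \<gamma>) + \<epsilon>)) \<le> \<nu> powr (1 - \<gamma> / 2 - 2 * c + \<epsilon>)"
    by (rule order_trans[OF mult_le_powr[OF s_le_half inner_half_le] mono]) (auto simp: field_simps)
  then show ?thesis by (simp add: power2_eq_square mult.assoc)
qed

lemma mean_star_inner:
  assumes par: "(m, b) \<in> par" and k: "k \<in> S" and ec: "\<epsilon> \<le> c"
  shows "(\<Sum>e\<in>star n k S. F m b e) \<le> \<nu> powr ((1 - \<rho>) / 2)"
proof -
  have "(\<Sum>e\<in>star n k S. F m b e) \<le> (\<Sum>e\<in>star n k S. \<nu> powr (min 0 (2 * \<alpha> - \<gamma>) + \<epsilon>))"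
    using star_inner[OF k] by (intro sum_mono fit_inner[OF par]) auto
  also have "\<dots> \<le> s * \<nu> powr (min 0 (2 * \<alpha> - \<gamma>) + \<epsilon>)"
    using card_star_inner[OF k] by (simp add: mult_right_mono)
  also have "\<dots> \<le> \<nu> powr ((1 - \<rho>) / 2 - c + \<epsilon>)" by (rule inner_half_le)
  also have "\<dots> \<le> \<nu> powr ((1 - \<rho>) / 2)" by (rule mono) (use ec in linarith)
  finally show ?thesis .
qed

lemma mean_pairs_inner:
  assumes par: "(m, b) \<in> par" and ec: "\<epsilon> \<le> c"
  shows "(\<Sum>e\<in>pairs_in n S. F m b e) \<le> \<nu> powr (1 - \<gamma> / 2)"
proof -
  have "(\<Sum>e\<in>pairs_in n S. F m b e) \<le> (\<Sum>e\<in>pairs_in n S. \<nu> powr (min 0 (2 * \<alpha> - \<gamma>) + \<epsilon>))"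
    by (intro sum_mono fit_inner[OF par]) auto
  also have "\<dots> \<le> s\<^sup>2 * \<nu> powr (min 0 (2 * \<alpha> - \<gamma>) + \<epsilon>)"
    using card_pairs_inner by (simp add: mult_right_mono)
  also have "\<dots> \<le> \<nu> powr (1 - \<gamma> / 2 - 2 * c + \<epsilon>)" by (rule inner2_half_le)
  also have "\<dots> \<le> \<nu> powr (1 - \<gamma> / 2)" by (rule mono) (use ec c in auto)
  finally show ?thesis .
qed

context
  fixes a and m0 :: real and b0 :: "nat \<Rightarrow> real" and mh :: real and bh :: "nat \<Rightarrow> real" and d h :: real
  assumes mle: "is_mle \<gamma> \<alpha> n S M1 M2 a mh bh" and true: "(m0, b0) \<in> par"
    and sym: "\<And>i j. i \<in> {1..n} \<Longrightarrow> j \<in> {1..n} \<Longrightarrow> a i j = a j i"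
    and mh_int: "-M1 < mh" "mh < M1" and bh_int: "\<And>k. k \<in> S \<Longrightarrow> 0 < bh k \<and> bh k < M2"
    and mu_small: "\<bar>mh - m0\<bar> \<le> h" and beta_small: "\<And>k. k \<in> S \<Longrightarrow> \<bar>bh k - b0 k\<bar> \<le> h" and h: "h \<le> 1 / 8"
    and noise_outer: "\<bar>Z m0 b0 (pairs_in n (- S)) a\<bar> \<le> \<nu> powr \<epsilon> * sqrt (\<nu> powr (2 - \<gamma> + 2 * \<epsilon>))"
    and noise_inner: "\<bar>Z m0 b0 (pairs_in n S) a\<bar> \<le> \<nu> powr \<epsilon> * sqrt (\<nu> powr (1 - \<gamma> / 2))"
    and d: "d \<le> c" "d \<le> (1 - \<gamma> / 2) / 2" "d \<le> (1 - \<rho>) / 4" "2 * \<epsilon> \<le> d"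
begin

abbreviation "W0 \<equiv> N * dlogistic (mu_of \<gamma> n m0)"
abbreviation "Wk k \<equiv> q * dlogistic (mu_of \<gamma> n m0 + (\<alpha> * ln \<nu> + b0 k))"

lemma root_W0: "\<nu> powr (1 - \<gamma> / 2 - \<epsilon>) \<le> sqrt W0"
proof -
  have "\<nu> powr (2 - \<epsilon>) * \<nu> powr (- \<gamma> - \<epsilon>) \<le> W0"
    using N_ge a0[OF parD(1)[OF true]] by (intro mult_mono) auto
  then have "sqrt (\<nu> powr (2 - \<gamma> - 2 * \<epsilon>)) \<le> sqrt W0"
    by (simp add: powr_add[symmetric] algebra_simps)
  then show ?thesis by (simp add: powr_half_sqrt[symmetric] powr_powr field_simps)
qed

lemma root_Wk: "k \<in> S \<Longrightarrow> \<nu> powr ((1 - \<rho>) / 2 - \<epsilon>) \<le> sqrt (Wk k)"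
proof -
  assume k: "k \<in> S"
  have "\<nu> powr (1 - \<epsilon>) * \<nu> powr (- \<rho> - \<epsilon>) \<le> Wk k"
    using q_ge a1[OF parD(1)[OF true] parD(2)[OF true k]] by (intro mult_mono) auto
  then have "sqrt (\<nu> powr (1 - \<rho> - 2 * \<epsilon>)) \<le> sqrt (Wk k)"
    by (simp add: powr_add[symmetric] algebra_simps)
  then show ?thesis by (simp add: powr_half_sqrt[symmetric] powr_powr field_simps)
qed

lemma root_Wk_le: "k \<in> S \<Longrightarrow> sqrt (Wk k) \<le> \<nu> powr ((1 - \<rho>) / 2 + \<epsilon>)"
proof -
  assume k: "k \<in> S"
  have "Wk k \<le> \<nu> powr (1 + (- \<rho> + \<epsilon>))"
  proof (rule mult_le_powr)
    show "dlogistic (mu_of \<gamma> n m0 + (\<alpha> * ln \<nu> + b0 k)) \<le> \<nu> powr (- \<rho> + \<epsilon>)"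
      using b1[OF parD(1)[OF true] parD(2)[OF true k]] dlogistic_le_logistic order_trans by blast
  qed (use q_le nu_powr_1 dlogistic_pos less_imp_le in auto)
  then have "sqrt (Wk k) \<le> sqrt (\<nu> powr (1 + (- \<rho> + \<epsilon>)))" by simp
  also have "\<dots> = \<nu> powr ((1 + (- \<rho> + \<epsilon>)) / 2)" by (simp add: powr_half_sqrt[symmetric] powr_powr)
  also have "\<dots> \<le> \<nu> powr ((1 - \<rho>) / 2 + \<epsilon>)" by (rule mono) (use eps in \<open>simp add: field_simps\<close>)
  finally show ?thesis .
qed

lemma mu_linearization:
  defines "Y \<equiv> Z m0 b0 (pairs_in n (- S)) a / sqrt W0"
  shows "\<bar>(mh - m0) * sqrt W0 - Y\<bar> \<le> 4 * h * \<bar>Y\<bar> + 4 * \<nu> powr (- d + 2 * \<epsilon>)"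
proof -
  obtain r where eq: "N * (logistic (mu_of \<gamma> n mh) - logistic (mu_of \<gamma> n m0)) = Z m0 b0 (pairs_in n (- S)) a + r"
    and r: "\<bar>r\<bar> \<le> \<bar>Z m0 b0 (pairs_in n S) a\<bar> + s\<^sup>2 * \<nu> powr (min 0 (2 * \<alpha> - \<gamma>) + \<epsilon>)"
    using mu_score_equation[OF mle true sym mh_int bh_int] by blast
  have N0: "0 < N" using N_ge n1 by (smt (verit) powr_gt_zero)
  have "mu_of \<gamma> n mh = mu_of \<gamma> n m0 + (mh - m0)" by (simp add: mu_of_def)
  with eq have eq': "N * (logistic (mu_of \<gamma> n m0 + (mh - m0)) - logistic (mu_of \<gamma> n m0)) = Z m0 b0 (pairs_in n (- S)) a + r" by simp
  have "\<bar>r\<bar> \<le> \<nu> powr ((1 - \<gamma> / 2) / 2 + \<epsilon>) + \<nu> powr (1 - \<gamma> / 2 - 2 * c + \<epsilon>)"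
    using r noise_inner inner2_half_le unfolding sqrt_powr by linarith
  also have "\<nu> powr ((1 - \<gamma> / 2) / 2 + \<epsilon>) \<le> \<nu> powr (1 - \<gamma> / 2 - d + \<epsilon>)" by (rule mono) (use d in \<open>simp add: field_simps\<close>)
  also have "\<nu> powr (1 - \<gamma> / 2 - 2 * c + \<epsilon>) \<le> \<nu> powr (1 - \<gamma> / 2 - d + \<epsilon>)" by (rule mono) (use d c in auto)
  finally have "\<bar>r\<bar> \<le> 2 * \<nu> powr (1 - \<gamma> / 2 - d + \<epsilon>)" by simp
  from ratio_le[OF this root_W0] have "\<bar>r\<bar> / sqrt W0 \<le> 2 * \<nu> powr (- d + 2 * \<epsilon>)" by (simp add: algebra_simps)
  moreover have "\<bar>(mh - m0) * sqrt W0 - Y\<bar> \<le> 4 * \<bar>mh - m0\<bar> * \<bar>Y\<bar> + 2 * \<bar>r\<bar> / sqrt W0"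
    unfolding Y_def by (rule logistic_score_inversion[OF N0 _ eq']) (use mu_small h in auto)
  moreover have "4 * \<bar>mh - m0\<bar> * \<bar>Y\<bar> \<le> 4 * h * \<bar>Y\<bar>" using mu_small by (intro mult_right_mono) auto
  ultimately show ?thesis by linarith
qed

text \<open>
  The rate \<open>n powr (- 1 + \<gamma> / 2)\<close> of the error in \<open>\<mu>\<close>, up to \<open>\<epsilon>\<close>. It shows that replacing \<open>\<mu> + \<beta> k\<close> by \<open>\<beta> k\<close> in
  \<open>beta_linearization\<close> costs, up to \<open>\<epsilon>\<close> again, only \<open>n powr (- (1 - \<alpha>) / 2)\<close>
  standard deviations.
\<close>

lemma mu_sharp_rate: "\<bar>mh - m0\<bar> \<le> 6 * \<nu> powr (- 1 + \<gamma> / 2 + 4 * \<epsilon>)"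
proof -
  let ?Y = "Z m0 b0 (pairs_in n (- S)) a / sqrt W0"
  have "\<bar>Z m0 b0 (pairs_in n (- S)) a\<bar> \<le> 1 * \<nu> powr ((2 - \<gamma> + 2 * \<epsilon>) / 2 + \<epsilon>)"
    using noise_outer unfolding sqrt_powr by simp
  from ratio_le[OF this root_W0] have "\<bar>?Y\<bar> \<le> \<nu> powr ((2 - \<gamma> + 2 * \<epsilon>) / 2 + \<epsilon> - (1 - \<gamma> / 2 - \<epsilon>))"
    using dlogistic_pos by (simp add: abs_mult less_imp_le)
  then have Y: "\<bar>?Y\<bar> \<le> \<nu> powr (3 * \<epsilon>)" by (simp add: field_simps)
  have h0: "4 * h * \<bar>?Y\<bar> \<le> 1 * \<bar>?Y\<bar>" using h by (intro mult_right_mono) auto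
  have "\<nu> powr (- d + 2 * \<epsilon>) \<le> \<nu> powr (3 * \<epsilon>)" by (rule mono) (use d eps in auto)
  then have "\<bar>(mh - m0) * sqrt W0\<bar> \<le> 6 * \<nu> powr (3 * \<epsilon>)"
    using mu_linearization Y h0 by linarith
  from ratio_le[OF this root_W0] have "\<bar>(mh - m0) * sqrt W0\<bar> / sqrt W0 \<le> 6 * \<nu> powr (- 1 + \<gamma> / 2 + 4 * \<epsilon>)"
    by (simp add: algebra_simps)
  moreover have "0 < sqrt W0" using root_W0 n1 by (smt (verit) powr_gt_zero)
  then have "\<bar>(mh - m0) * sqrt W0\<bar> / sqrt W0 = \<bar>mh - m0\<bar>"
    by (metis abs_mult abs_of_pos less_irrefl nonzero_mult_div_cancel_right)
  ultimately show ?thesis by simp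
qed

text \<open>
  The score equation of the star of \<open>k\<close> determines the error of \<open>\<mu> + \<beta> k\<close>; the error of \<open>\<mu>\<close> is then subtracted.
\<close>

lemma beta_linearization:
  assumes k: "k \<in> S" and noise_k: "\<bar>Z m0 b0 (star n k S) a\<bar> \<le> \<nu> powr \<epsilon> * sqrt (\<nu> powr ((1 - \<rho>) / 2))"
  defines "Y \<equiv> Z m0 b0 (star n k (- S)) a / sqrt (Wk k)"
  shows "\<bar>(bh k - b0 k) * sqrt (Wk k) - Y\<bar> \<le> 8 * h * \<bar>Y\<bar> + 4 * \<nu> powr (- d + 2 * \<epsilon>) + 6 * \<nu> powr (- (1 - \<alpha>) / 2 + 5 * \<epsilon>)"
proof -
  let ?x = "mu_of \<gamma> n m0 + (\<alpha> * ln \<nu> + b0 k)"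
  let ?w = "(mh - m0) + (bh k - b0 k)"
  obtain r where eq: "q * (logistic (mu_of \<gamma> n mh + (\<alpha> * ln \<nu> + bh k)) - logistic ?x) = Z m0 b0 (star n k (- S)) a + r"
    and r: "\<bar>r\<bar> \<le> \<bar>Z m0 b0 (star n k S) a\<bar> + s * \<nu> powr (min 0 (2 * \<alpha> - \<gamma>) + \<epsilon>)"
    using beta_score_equation[OF mle true sym mh_int bh_int k] by blast
  have q0: "0 < q" using q_ge n1 by (smt (verit) powr_gt_zero)
  have "mu_of \<gamma> n mh + (\<alpha> * ln \<nu> + bh k) = ?x + ?w" by (simp add: mu_of_def)
  with eq have eq': "q * (logistic (?x + ?w) - logistic ?x) = Z m0 b0 (star n k (- S)) a + r" by simp
  have "\<bar>r\<bar> \<le> \<nu> powr ((1 - \<rho>) / 2 / 2 + \<epsilon>) + \<nu> powr ((1 - \<rho>) / 2 - c + \<epsilon>)"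
    using r noise_k inner_half_le unfolding sqrt_powr by linarith
  also have "\<nu> powr ((1 - \<rho>) / 2 / 2 + \<epsilon>) \<le> \<nu> powr ((1 - \<rho>) / 2 - d + \<epsilon>)"
    by (rule mono) (use d in \<open>simp add: field_simps\<close>)
  also have "\<nu> powr ((1 - \<rho>) / 2 - c + \<epsilon>) \<le> \<nu> powr ((1 - \<rho>) / 2 - d + \<epsilon>)" by (rule mono) (use d in auto)
  finally have "\<bar>r\<bar> \<le> 2 * \<nu> powr ((1 - \<rho>) / 2 - d + \<epsilon>)" by simp
  from ratio_le[OF this root_Wk[OF k]] have R: "\<bar>r\<bar> / sqrt (Wk k) \<le> 2 * \<nu> powr (- d + 2 * \<epsilon>)" by (simp add: algebra_simps)
  have w: "\<bar>?w\<bar> \<le> 2 * h" using mu_small beta_small[OF k] by linarith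
  have L: "\<bar>?w * sqrt (Wk k) - Y\<bar> \<le> 4 * \<bar>?w\<bar> * \<bar>Y\<bar> + 2 * \<bar>r\<bar> / sqrt (Wk k)"
    unfolding Y_def by (rule logistic_score_inversion[OF q0 _ eq']) (use w h in auto)
  have w8: "4 * \<bar>?w\<bar> * \<bar>Y\<bar> \<le> 8 * h * \<bar>Y\<bar>" using w by (intro mult_right_mono) auto
  have "\<bar>(mh - m0) * sqrt (Wk k)\<bar> \<le> 6 * \<nu> powr (- (1 - \<alpha>) / 2 + 5 * \<epsilon>)"
  proof -
    have "\<bar>(mh - m0) * sqrt (Wk k)\<bar> \<le> (6 * \<nu> powr (- 1 + \<gamma> / 2 + 4 * \<epsilon>)) * \<nu> powr ((1 - \<rho>) / 2 + \<epsilon>)"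
      unfolding abs_mult using mu_sharp_rate root_Wk_le[OF k] dlogistic_pos
      by (intro mult_mono) (auto simp: abs_mult less_imp_le)
    also have "\<dots> = 6 * \<nu> powr ((- 1 + \<gamma> / 2 + 4 * \<epsilon>) + ((1 - \<rho>) / 2 + \<epsilon>))"
      unfolding powr_add by simp
    also have "(- 1 + \<gamma> / 2 + 4 * \<epsilon>) + ((1 - \<rho>) / 2 + \<epsilon>) = - (1 - \<alpha>) / 2 + 5 * \<epsilon>"
      by (simp add: field_simps)
    finally show ?thesis .
  qed
  moreover have "?w * sqrt (Wk k) = (mh - m0) * sqrt (Wk k) + (bh k - b0 k) * sqrt (Wk k)"
    by (rule distrib_right)
  moreover have "2 * \<bar>r\<bar> / sqrt (Wk k) = 2 * (\<bar>r\<bar> / sqrt (Wk k))" by simp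
  ultimately show ?thesis using L R w8 by linarith
qed

end

end

end

section \<open>Independence of disjoint edge counts\<close>

text \<open>
  Edge counts over disjoint sets of pairs are functions of disjoint blocks of an independent family.
\<close>

lemma (in sparse_beta_model) noise_joint_distr:
  assumes I: "I \<noteq> {}" and P: "\<And>i. i \<in> I \<Longrightarrow> P i \<subseteq> node_pairs n" and disj: "disjoint_family_on P I"
  shows "distr M (PiM I (\<lambda>_. borel)) (\<lambda>\<omega>. \<lambda>i\<in>I. noise \<mu> \<beta> (P i) (A \<omega>) / c i)
       = PiM I (\<lambda>i. distr M borel (\<lambda>\<omega>. noise \<mu> \<beta> (P i) (A \<omega>) / c i))"
proof -
  define g where "g i x = (\<Sum>e\<in>P i. x e) / c i" for i and x :: "nat \<times> nat \<Rightarrow> real"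
  have ind: "indep_vars (\<lambda>_. borel) (\<lambda>e \<omega>. of_bool (edge e \<omega>) - p e) (node_pairs n)"
    by (rule indep_edges_map[of _ "\<lambda>e b. of_bool b - p e"]) simp
  have "indep_vars (\<lambda>i. PiM (P i) (\<lambda>_. borel)) (\<lambda>i \<omega>. \<lambda>e\<in>P i. of_bool (edge e \<omega>) - p e) I"
    by (rule indep_vars_restrict[OF ind P disj])
  then have "indep_vars (\<lambda>_. borel) (\<lambda>i \<omega>. g i (\<lambda>e\<in>P i. of_bool (edge e \<omega>) - p e)) I"
  proof (rule indep_vars_compose2)
    fix i assume "i \<in> I"
    show "g i \<in> borel_measurable (PiM (P i) (\<lambda>_. borel))"
      unfolding g_def by (intro borel_measurable_divide borel_measurable_sum measurable_component_singleton) auto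
  qed
  moreover have "g i (\<lambda>e\<in>P i. of_bool (edge e \<omega>) - p e) = noise \<mu> \<beta> (P i) (A \<omega>) / c i" for i \<omega>
    by (simp add: g_def noise_alt)
  ultimately have indep: "indep_vars (\<lambda>_. borel) (\<lambda>i \<omega>. noise \<mu> \<beta> (P i) (A \<omega>) / c i) I" by simp
  have "random_variable borel (\<lambda>\<omega>. noise \<mu> \<beta> (P i) (A \<omega>) / c i)" if "i \<in> I" for i
    by (rule borel_measurable_divide[OF noise_measurable[OF P[OF that]] borel_measurable_const])
  from indep_vars_iff_distr_eq_PiM'[OF I this] indep show ?thesis by simp
qed

text \<open>
  Lets the model be stated with the reparameterized \<open>\<beta>\<close>, which agrees with the original one on the nodes.
\<close>

lemma sparse_beta_model_cong:
  assumes "sparse_beta_model M n \<mu> \<beta> A" "\<And>i. i \<in> {1..n} \<Longrightarrow> \<beta> i = \<beta>' i"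
  shows "sparse_beta_model M n \<mu> \<beta>' A"
proof -
  interpret sparse_beta_model M n \<mu> \<beta> A by fact
  show ?thesis
  proof
    show "Min (\<beta>' ` {1..n}) = 0" using beta_min assms(2) by (metis image_cong)
    show "distr M (count_space UNIV) (\<lambda>\<omega>. A \<omega> i j) = measure_pmf (bernoulli_pmf (edge_prob \<mu> \<beta>' i j))"
      if "(i, j) \<in> node_pairs n" for i j
      using edges_bernoulli[OF that] assms(2)[of i] assms(2)[of j] that by (simp add: edge_prob_def node_pairs_def)
  qed (use beta_nonneg assms(2) no_loops symmetric edges_indep in auto)
qed

section \<open>Limits of variances and growth conditions\<close>

text \<open>
  The limit of \<open>n powr - r / dlogistic (- r * ln n + t)\<close> for fixed \<open>t\<close>. It unifies the three cases of \<open>Sigma_diag\<close>: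
  the entries are this function at \<open>r = \<gamma> - \<alpha>\<close> for the coordinates of \<open>\<beta>\<close> and twice this function at \<open>r = \<gamma>\<close>
  for \<open>\<mu>\<close>.
\<close>

definition limit_variance :: "real \<Rightarrow> real \<Rightarrow> real" where
  "limit_variance r t = (if 0 < r then exp (- t) else 2 + exp (- t) + exp t)"

lemma limit_variance_pos: "0 < limit_variance r t"
  by (simp add: limit_variance_def add_pos_pos)

text \<open>
  With \<open>g = n powr - r * exp t\<close>, which tends to \<open>0\<close> for \<open>r > 0\<close>, the quotient is \<open>(1 + g)\<^sup>2\<close>; for \<open>r = 0\<close> it is
  constantly \<open>1\<close>. The parameter \<open>t\<close> may be unbounded as long as it is \<open>o(ln n)\<close>.
\<close>

lemma dlogistic_limit:
  fixes t :: "nat \<Rightarrow> real"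
  assumes r: "0 \<le> r" and t: "\<And>e. 0 < e \<Longrightarrow> eventually (\<lambda>n. \<bar>t n\<bar> \<le> e * ln (real n)) sequentially"
  shows "(\<lambda>n. real n powr (- r) / (dlogistic (- r * ln (real n) + t n) * limit_variance r (t n))) \<longlonglongrightarrow> 1"
proof (cases "r = 0")
  case True
  have "eventually (\<lambda>n. real n powr (- r) / (dlogistic (- r * ln (real n) + t n) * limit_variance r (t n)) = 1) sequentially"
    using eventually_ge_at_top[of 1]
  proof eventually_elim
    case (elim n)
    have "limit_variance r (t n) = inverse (dlogistic (t n))"
      using True by (simp add: limit_variance_def inverse_dlogistic)
    then show ?case using True elim dlogistic_pos[of "t n"] by simp
  qed
  then show ?thesis by (rule tendsto_eventually)
next
  case False
  then have r0: "0 < r" using r by simp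
  have half: "0 < r / 2" using r0 by simp
  define g where "g n = real n powr (- r) * exp (t n)" for n
  have g0: "g \<longlonglongrightarrow> 0"
  proof (rule Lim_null_comparison)
    show "eventually (\<lambda>n. norm (g n) \<le> real n powr (- r / 2)) sequentially"
      using t[OF half] eventually_ge_at_top[of 1]
    proof eventually_elim
      case (elim n)
      have "t n \<le> r / 2 * ln (real n)" using elim r0 by (auto simp: abs_le_iff)
      then have "exp (t n) \<le> real n powr (r / 2)" using elim by (simp add: powr_def)
      then have "g n \<le> real n powr (- r) * real n powr (r / 2)"
        unfolding g_def by (rule mult_left_mono) simp
      also have "\<dots> = real n powr (- r / 2)" by (simp add: powr_add[symmetric])
      finally show ?case by (simp add: g_def)
    qed
    show "(\<lambda>n. real n powr (- r / 2)) \<longlonglongrightarrow> 0" using r0 by real_asymp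
  qed
  have "eventually (\<lambda>n. real n powr (- r) / (dlogistic (- r * ln (real n) + t n) * limit_variance r (t n)) = 1 + 2 * g n + g n * g n) sequentially"
    using eventually_ge_at_top[of 1]
  proof eventually_elim
    case (elim n)
    have x: "exp (- r * ln (real n) + t n) = g n"
      unfolding exp_add g_def using elim by (simp add: powr_def)
    have gp: "0 < g n" using elim by (simp add: g_def)
    have "exp (- (- r * ln (real n) + t n)) = inverse (g n)" unfolding exp_minus x ..
    then have "inverse (dlogistic (- r * ln (real n) + t n)) = 2 + g n + inverse (g n)"
      unfolding inverse_dlogistic x by simp
    moreover have "real n powr (- r) / limit_variance r (t n) = g n"
      using r0 by (simp add: limit_variance_def g_def exp_minus field_simps)
    ultimately have "real n powr (- r) / (dlogistic (- r * ln (real n) + t n) * limit_variance r (t n)) = g n * (2 + g n + inverse (g n))"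
      by (metis divide_divide_eq_left divide_inverse mult.commute)
    moreover have "g n * (2 + g n + inverse (g n)) = 1 + 2 * g n + g n * g n"
      using gp by (simp add: distrib_left)
    ultimately show ?case by (simp only:)
  qed
  moreover have "(\<lambda>n. 1 + 2 * g n + g n * g n) \<longlonglongrightarrow> 1 + 2 * 0 + 0 * 0" by (intro tendsto_intros g0)
  ultimately show ?thesis by (simp add: tendsto_cong)
qed

lemma Sigma_diag_None:
  assumes "0 \<le> \<alpha>" "\<alpha> \<le> \<gamma>"
  shows "Sigma_diag \<gamma> \<alpha> m b None = 2 * limit_variance \<gamma> m"
  using assms by (auto simp: Sigma_diag_def limit_variance_def)

lemma Sigma_diag_Some:
  assumes "0 \<le> \<alpha>" "\<alpha> \<le> \<gamma>"
  shows "Sigma_diag \<gamma> \<alpha> m b (Some i) = limit_variance (\<gamma> - \<alpha>) (m + b i)"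
  using assms by (auto simp: Sigma_diag_def limit_variance_def diff_diff_eq)

text \<open>
  Half of the power gained in \<open>bar_o\<close> is spent on the constant hidden in the \<open>O\<close>.
\<close>

lemma bar_o_powrD:
  assumes "bar_o a (\<lambda>n. real n powr x)"
  shows "\<exists>c>0. eventually (\<lambda>n. a n \<le> real n powr (x - c)) sequentially"
proof -
  obtain c where c: "c > 0" "a \<in> O(\<lambda>n. real n powr (- c) * real n powr x)"
    using assms by (auto simp: bar_o_def)
  then obtain K where K: "K > 0" "eventually (\<lambda>n. norm (a n) \<le> K * norm (real n powr (- c) * real n powr x)) sequentially"
    by (elim landau_o.bigE)
  have "eventually (\<lambda>n. K \<le> real n powr (c / 2)) sequentially" using c(1) by real_asymp
  with K(2) have "eventually (\<lambda>n. a n \<le> real n powr (x - c / 2)) sequentially"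
  proof eventually_elim
    case (elim n)
    have "a n \<le> K * real n powr (x - c)" using elim(1) by (simp add: powr_add[symmetric] algebra_simps)
    also have "\<dots> \<le> real n powr (c / 2) * real n powr (x - c)" using elim(2) by (rule mult_right_mono) simp
    also have "\<dots> = real n powr (x - c / 2)" by (simp add: powr_add[symmetric] algebra_simps)
    finally show ?case .
  qed
  then show ?thesis using c(1) by (intro exI[of _ "c / 2"]) auto
qed

section \<open>Consistency along a sequence of models\<close>

text \<open>
  A sequence of models with true parameters and estimators in reparameterized coordinates; the sparsity of \<open>S\<close> is
  left to the individual results.
\<close>

locale sbm_sequence =
  fixes M :: "nat \<Rightarrow> 'w measure" and A :: "nat \<Rightarrow> 'w \<Rightarrow> nat \<Rightarrow> nat \<Rightarrow> bool" and S :: "nat \<Rightarrow> nat set"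
    and \<gamma> \<alpha> :: real and M1 M2 :: "nat \<Rightarrow> real" and m0 :: "nat \<Rightarrow> real" and b0 :: "nat \<Rightarrow> nat \<Rightarrow> real"
    and mh :: "nat \<Rightarrow> 'w \<Rightarrow> real" and bh :: "nat \<Rightarrow> 'w \<Rightarrow> nat \<Rightarrow> real"
  assumes model: "\<And>n. n \<ge> 1 \<Longrightarrow> sparse_beta_model (M n) n (mu_of \<gamma> n (m0 n)) (beta_of \<alpha> n (S n) (b0 n)) (A n)"
    and S: "\<And>n. n \<ge> 1 \<Longrightarrow> S n \<subseteq> {1..n}"
    and gamma: "\<gamma> < 2" and alpha: "0 \<le> \<alpha>" "\<alpha> < 1" and rho: "0 \<le> \<gamma> - \<alpha>" "\<gamma> - \<alpha> < 1"
    and bounds_pos: "\<And>n. n \<ge> 1 \<Longrightarrow> M1 n > 0" "\<And>n. n \<ge> 1 \<Longrightarrow> M2 n > 0"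
    and bounds_small: "(\<lambda>n. max (M1 n) (M2 n)) \<in> o(\<lambda>n. ln (real n))"
    and true: "\<And>n. n \<ge> 1 \<Longrightarrow> (m0 n, b0 n) \<in> param_space (S n) (M1 n) (M2 n)"
    and mle: "\<And>n \<omega>. n \<ge> 1 \<Longrightarrow> \<omega> \<in> space (M n) \<Longrightarrow> is_mle \<gamma> \<alpha> n (S n) (M1 n) (M2 n) (A n \<omega>) (mh n \<omega>) (bh n \<omega>)"
begin

abbreviation "\<rho> \<equiv> \<gamma> - \<alpha>"
abbreviation "Zn n P \<omega> \<equiv> noise (mu_of \<gamma> n (m0 n)) (beta_of \<alpha> n (S n) (b0 n)) P (A n \<omega>)"

text \<open>
  The form in which \<open>max M1 M2 = o(ln n)\<close> is used: any multiple of it, constants included, is below \<open>\<epsilon> * ln n\<close>.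
\<close>

lemma bounds_log:
  assumes "0 < e"
  shows "eventually (\<lambda>n. K * (1 + max (M1 n) (M2 n)) \<le> e * ln (real n)) sequentially"
proof -
  define K' where "K' = max K 1"
  have K': "K' > 0" by (simp add: K'_def)
  have "eventually (\<lambda>n. norm (max (M1 n) (M2 n)) \<le> e / (2 * K') * norm (ln (real n))) sequentially"
    using assms K' by (intro landau_o.smallD[OF bounds_small]) auto
  moreover have "eventually (\<lambda>n. 2 * K' / e \<le> ln (real n)) sequentially" by real_asymp
  ultimately show ?thesis using eventually_ge_at_top[of 1]
  proof eventually_elim
    case (elim n)
    have mx: "0 \<le> max (M1 n) (M2 n)" using bounds_pos[OF elim(3)] by simp
    have "K' * max (M1 n) (M2 n) \<le> K' * (e / (2 * K') * ln (real n))"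
      using elim mx K' by (intro mult_left_mono) auto
    also have "\<dots> = e / 2 * ln (real n)" using K' by simp
    moreover have "K' \<le> e / 2 * ln (real n)" using elim(2) assms by (simp add: field_simps)
    ultimately have "K' * (1 + max (M1 n) (M2 n)) \<le> e * ln (real n)" by (simp add: algebra_simps)
    moreover have "K * (1 + max (M1 n) (M2 n)) \<le> K' * (1 + max (M1 n) (M2 n))"
      using mx by (intro mult_right_mono) (auto simp: K'_def)
    ultimately show ?case by linarith
  qed
qed

lemma card_outside:
  assumes "n \<ge> 1"
  shows "real (card ({1..n} - S n)) = real n - real (card (S n))"
  using S[OF assms] finite_subset[OF S[OF assms]] card_mono[OF _ S[OF assms]]
  by (subst card_Diff_subset) (auto simp: of_nat_diff)

text \<open>
  Anywhere in the parameter box, the log-odds of a pair differ from the multiple of \<open>ln n\<close> that belongs to its class by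
  at most \<open>3 * max M1 M2\<close>, and
  the latter is \<open>o(ln n)\<close>.
\<close>

lemma regime_eventually:
  assumes eps: "0 < \<epsilon>" and c: "0 < c" and s: "eventually (\<lambda>n. real (card (S n)) \<le> real n powr (1 - \<alpha> - c)) sequentially"
  shows "eventually (\<lambda>n. regime_rates \<gamma> \<alpha> n (S n) (M1 n) (M2 n) \<epsilon> c) sequentially"
proof -
  have "eventually (\<lambda>n. real n powr (- c) \<le> 1 / 2) sequentially" using c by real_asymp
  \<comment> \<open>The multiple 16 makes \<open>n powr \<epsilon> \<ge> 17\<close>, which pays for the factor 16 lost in \<open>N \<ge> n\<^sup>2 / 16\<close>.\<close>
  with bounds_log[OF eps, of 16] s show ?thesis using eventually_ge_at_top[of 4]
  proof eventually_elim
    case (elim n)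
    have n1: "n \<ge> 1" and n4: "real n \<ge> 4" using elim(4) by auto
    define L where "L = ln (real n)"
    define mx where "mx = max (M1 n) (M2 n)"
    have L: "0 \<le> L" using n4 by (simp add: L_def)
    have mx: "0 \<le> mx" "M1 n \<le> mx" "M2 n \<le> mx" using bounds_pos[OF n1] by (auto simp: mx_def)
    have eL: "16 + 16 * mx \<le> \<epsilon> * L" using elim(1) by (simp add: L_def mx_def algebra_simps)
    have pw: "real n powr y = exp (y * L)" for y using n4 by (simp add: powr_def L_def)
    have e17: "17 \<le> real n powr \<epsilon>"
      using exp_ge_add_one_self[of "\<epsilon> * L"] eL mx(1) unfolding pw by linarith
    have low: "real n powr (- k - \<epsilon>) \<le> dlogistic x" if "\<bar>x\<bar> \<le> k * L + 2 * mx" for k x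
    proof -
      have "4 * real n powr (- k - \<epsilon>) \<le> exp 4 * exp ((- k - \<epsilon>) * L)"
        unfolding pw using exp_ge_add_one_self[of 4] by (intro mult_right_mono) auto
      also have "\<dots> = exp (4 + (- k - \<epsilon>) * L)" by (simp add: exp_add)
      also have "\<dots> \<le> exp (- \<bar>x\<bar>)" using that eL mx(1) by (simp add: algebra_simps)
      also have "\<dots> \<le> 4 * dlogistic x" using dlogistic_ge[of x] by simp
      finally show ?thesis by simp
    qed
    have up: "logistic x \<le> real n powr (k + \<epsilon>)" if "x \<le> k * L + 3 * mx" for k x
    proof -
      have "logistic x \<le> exp x" by (rule logistic_le_exp)
      also have "\<dots> \<le> exp ((k + \<epsilon>) * L)" using that eL mx(1) by (simp add: algebra_simps)
      finally show ?thesis by (simp add: pw)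
    qed
    have s1: "real (card (S n)) \<le> real n / 2"
    proof -
      have "real n powr (1 - \<alpha> - c) \<le> real n powr (1 + - c)"
        using n4 alpha by (intro powr_mono) auto
      also have "\<dots> = real n * real n powr (- c)" using n4 by (subst powr_add) simp
      also have "\<dots> \<le> real n * (1 / 2)" using elim(3) by (intro mult_left_mono) auto
      finally show ?thesis using elim(2) by simp
    qed
    have q2: "real n / 2 \<le> real (card ({1..n} - S n))" using s1 card_outside[OF n1] by linarith
    have gL: "0 \<le> \<gamma> * L" "0 \<le> \<rho> * L" using L rho alpha by (auto simp: mult_nonneg_nonneg)
    show ?case
    proof unfold_locales
      show "S n \<subseteq> {1..n}" by (rule S[OF n1])
      fix m b b' assume m: "m \<in> {- M1 n..M1 n}"
      have m: "- M1 n \<le> m" "m \<le> M1 n" using m by auto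
      have x: "mu_of \<gamma> n m = - (\<gamma> * L) + m" by (simp add: mu_of_def L_def)
      show "real n powr (- \<gamma> - \<epsilon>) \<le> dlogistic (mu_of \<gamma> n m)"
        unfolding x by (rule low) (use m mx gL in linarith)
      show "logistic (mu_of \<gamma> n m) \<le> real n powr (- \<gamma> + \<epsilon>)"
        unfolding x by (rule up) (use m mx in linarith)
      assume "b \<in> {0..M2 n}"
      then have b: "0 \<le> b" "b \<le> M2 n" by auto
      have y: "mu_of \<gamma> n m + (\<alpha> * ln (real n) + b) = - (\<rho> * L) + (m + b)"
        by (simp add: mu_of_def L_def algebra_simps)
      show "real n powr (- \<rho> - \<epsilon>) \<le> dlogistic (mu_of \<gamma> n m + (\<alpha> * ln (real n) + b))"
        unfolding y by (rule low) (use m b mx gL in linarith)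
      show "logistic (mu_of \<gamma> n m + (\<alpha> * ln (real n) + b)) \<le> real n powr (- \<rho> + \<epsilon>)"
        unfolding y by (rule up) (use m b mx in linarith)
      assume "b' \<in> {0..M2 n}"
      then have b': "0 \<le> b'" "b' \<le> M2 n" by auto
      let ?z = "mu_of \<gamma> n m + (\<alpha> * ln (real n) + b) + (\<alpha> * ln (real n) + b')"
      have "logistic ?z \<le> real n powr ((2 * \<alpha> - \<gamma>) + \<epsilon>)"
        using m b b' mx by (intro up) (auto simp: mu_of_def L_def algebra_simps)
      moreover have "logistic ?z \<le> real n powr (0 + \<epsilon>)" using logistic_less_1[of ?z] e17 by simp
      ultimately show "logistic ?z \<le> real n powr (min 0 (2 * \<alpha> - \<gamma>) + \<epsilon>)" by (simp add: min_def)
    next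
      show "real n powr (1 - \<epsilon>) \<le> real (card ({1..n} - S n))"
      proof -
        have "real n powr (1 - \<epsilon>) * 17 \<le> real n powr (1 - \<epsilon>) * real n powr \<epsilon>" using e17 by (intro mult_left_mono) auto
        also have "\<dots> = real n" using n4 by (simp add: powr_add[symmetric])
        finally show ?thesis using q2 by linarith
      qed
      show "real n powr (2 - \<epsilon>) \<le> real (card (pairs_in n (- S n)))"
      proof -
        let ?q = "real (card ({1..n} - S n))"
        have i: "{1..n} \<inter> - S n = {1..n} - S n" by auto
        have "real n / 2 * (real n / 4) \<le> ?q * (?q - 1)" using q2 n4 by (intro mult_mono) auto
        then have "real n * real n \<le> 16 * real (card (pairs_in n (- S n)))"
          using card_pairs_in[of n "- S n"] unfolding i by linarith
        moreover have "real n powr (2 - \<epsilon>) * 17 \<le> real n powr (2 - \<epsilon>) * real n powr \<epsilon>" using e17 by (intro mult_left_mono) auto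
        moreover have "real n powr (2 - \<epsilon>) * real n powr \<epsilon> = real n * real n"
          using n4 by (simp add: powr_add[symmetric] powr_numeral power2_eq_square)
        ultimately show ?thesis using powr_ge_zero[of "real n" "2 - \<epsilon>"] by linarith
      qed
    qed (use n4 e17 eps c elim(2) alpha gamma rho in auto)
  qed
qed

text \<open>
  The deviations of up to \<open>n + 2\<close> edge counts from their means exceed their scales \<open>sqrt V\<close> by at most the factor
  \<open>n powr \<epsilon>\<close>, simultaneously, outside events of probability at most \<open>(n + 2) * 2 * exp (1 - n powr \<epsilon>)\<close>.
\<close>

lemma noise_event:
  fixes I :: "nat \<Rightarrow> 'i set"
  assumes eps: "0 < \<epsilon>"
    and ev: "eventually (\<lambda>n. finite (I n) \<and> card (I n) \<le> n + 2 \<and> (\<forall>i\<in>I n. P n i \<subseteq> node_pairs n \<and> 1 \<le> V n i \<and>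
       (\<Sum>e\<in>P n i. fit \<gamma> \<alpha> n (S n) (m0 n) (b0 n) e) \<le> V n i)) sequentially"
  shows "\<exists>B. (\<forall>n\<ge>1. B n \<in> sets (M n)) \<and> (\<lambda>n. measure (M n) (B n)) \<longlonglongrightarrow> 0 \<and>
     eventually (\<lambda>n. \<forall>\<omega>\<in>space (M n) - B n. \<forall>i\<in>I n. \<bar>Zn n (P n i) \<omega>\<bar> \<le> real n powr \<epsilon> * sqrt (V n i)) sequentially"
proof -
  define good where "good n \<longleftrightarrow> finite (I n) \<and> card (I n) \<le> n + 2 \<and> (\<forall>i\<in>I n. P n i \<subseteq> node_pairs n \<and> 1 \<le> V n i \<and>
       (\<Sum>e\<in>P n i. fit \<gamma> \<alpha> n (S n) (m0 n) (b0 n) e) \<le> V n i)" for n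
  \<comment> \<open>For the finitely many other \<open>n\<close> the event is irrelevant, but it must be measurable.\<close>
  define B where "B n = (if good n then {\<omega> \<in> space (M n). \<exists>i\<in>I n. real n powr \<epsilon> * sqrt (V n i) < \<bar>Zn n (P n i) \<omega>\<bar>} else {})" for n
  have g: "eventually good sequentially" using ev unfolding good_def by simp
  have B: "B n \<in> sets (M n) \<and> measure (M n) (B n) \<le> real (n + 2) * (2 * exp (1 - real n powr \<epsilon>))" if n: "n \<ge> 1" for n
  proof (cases "good n")
    case True
    interpret sparse_beta_model "M n" n "mu_of \<gamma> n (m0 n)" "beta_of \<alpha> n (S n) (b0 n)" "A n" by (rule model[OF n])
    have f: "finite (I n)" "real (card (I n)) \<le> real (n + 2)" "\<And>i. i \<in> I n \<Longrightarrow> P n i \<subseteq> node_pairs n" "\<And>i. i \<in> I n \<Longrightarrow> 1 \<le> V n i"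
      "\<And>i. i \<in> I n \<Longrightarrow> (\<Sum>e\<in>P n i. edge_prob (mu_of \<gamma> n (m0 n)) (beta_of \<alpha> n (S n) (b0 n)) (fst e) (snd e)) \<le> V n i"
      using True by (auto simp: good_def fit_def case_prod_beta simp flip: of_nat_add)
    note T = noise_tail_union[where P = "P n" and V = "V n" and t = "real n powr \<epsilon>", OF f(1) f(3) f(4) f(5)]
    have "real (card (I n)) * (2 * exp (1 - real n powr \<epsilon>)) \<le> real (n + 2) * (2 * exp (1 - real n powr \<epsilon>))"
      using f(2) by (rule mult_right_mono) simp
    from order_trans[OF T(2) this] T(1) show ?thesis using True by (simp add: B_def)
  qed (simp add: B_def)
  have "(\<lambda>n. measure (M n) (B n)) \<longlonglongrightarrow> 0"
  proof (rule Lim_null_comparison)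
    show "eventually (\<lambda>n. norm (measure (M n) (B n)) \<le> real (n + 2) * (2 * exp (1 - real n powr \<epsilon>))) sequentially"
      using eventually_ge_at_top[of 1] by eventually_elim (use B in auto)
    show "(\<lambda>n. real (n + 2) * (2 * exp (1 - real n powr \<epsilon>))) \<longlonglongrightarrow> 0"
      using eps by real_asymp
  qed
  moreover have "eventually (\<lambda>n. \<forall>\<omega>\<in>space (M n) - B n. \<forall>i\<in>I n. \<bar>Zn n (P n i) \<omega>\<bar> \<le> real n powr \<epsilon> * sqrt (V n i)) sequentially"
    using g by eventually_elim (auto simp: B_def not_less)
  ultimately show ?thesis using B by blast
qed

text \<open>
  One exceptional event serves all coordinates, because the noise of all stars is controlled simultaneously. The
  exponent gained is half the smallest of the three margins \<open>c\<close> (sparsity), \<open>1 - \<gamma> / 2\<close> (noise of all edges) and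
  \<open>(1 - \<rho>) / 2\<close> (noise of a star).
\<close>

lemma consistency:
  assumes c: "0 < c" and s: "eventually (\<lambda>n. real (card (S n)) \<le> real n powr (1 - \<alpha> - c)) sequentially"
  shows "\<exists>c'>0. \<exists>B. (\<forall>n\<ge>1. B n \<in> sets (M n)) \<and> (\<lambda>n. measure (M n) (B n)) \<longlonglongrightarrow> 0 \<and>
     eventually (\<lambda>n. \<forall>\<omega>\<in>space (M n) - B n. \<bar>mh n \<omega> - m0 n\<bar> \<le> real n powr (- c') \<and>
        (\<forall>k\<in>S n. \<bar>bh n \<omega> k - b0 n k\<bar> \<le> real n powr (- c'))) sequentially"
proof -
  define d where "d = min c (min (1 - \<gamma> / 2) ((1 - \<rho>) / 2))"
  \<comment> \<open>The worst exponent below is \<open>- d + 9 * \<epsilon>\<close>, and \<open>9 / 20 < 1 / 2\<close>.\<close>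
  define \<epsilon> where "\<epsilon> = d / 20"
  have d: "0 < d" "d \<le> c" "d \<le> 1 - \<gamma> / 2" "d \<le> (1 - \<rho>) / 2"
  proof -
    show "0 < d" using c gamma rho by (simp add: d_def)
    show "d \<le> c" unfolding d_def by (rule min.cobounded1)
    show "d \<le> 1 - \<gamma> / 2" unfolding d_def by (rule min.coboundedI2, rule min.cobounded1)
    show "d \<le> (1 - \<rho>) / 2" unfolding d_def by (rule min.coboundedI2, rule min.cobounded2)
  qed
  have eps: "0 < \<epsilon>" using d by (simp add: \<epsilon>_def)
  note reg = regime_eventually[OF eps c s]
  define P where "P n i = (case i of None \<Rightarrow> node_pairs n | Some k \<Rightarrow> star n k UNIV)" for n and i :: "nat option"
  define V where "V n i = (case i of None \<Rightarrow> real n powr (2 - \<gamma> + 2 * \<epsilon>) | Some k \<Rightarrow> real n powr (1 - \<rho> + 2 * \<epsilon>))" for n and i :: "nat option"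
  have "eventually (\<lambda>n. finite (coords (S n)) \<and> card (coords (S n)) \<le> n + 2 \<and> (\<forall>i\<in>coords (S n). P n i \<subseteq> node_pairs n \<and> 1 \<le> V n i \<and>
       (\<Sum>e\<in>P n i. fit \<gamma> \<alpha> n (S n) (m0 n) (b0 n) e) \<le> V n i)) sequentially"
    using reg eventually_ge_at_top[of 1]
  proof eventually_elim
    case (elim n)
    interpret R: regime_rates \<gamma> \<alpha> n "S n" "M1 n" "M2 n" \<epsilon> c by (rule elim(1))
    have "card (coords (S n)) \<le> Suc (card (Some ` S n))" unfolding coords_def by (rule card_insert_le_m1) auto
    also have "card (Some ` S n) \<le> card (S n)" by (rule card_image_le) simp
    also have "card (S n) \<le> n" using card_mono[OF _ S[OF elim(2)]] by simp
    finally have "card (coords (S n)) \<le> n + 2" by simp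
    moreover have "finite (coords (S n))" by (simp add: coords_def)
    moreover have "1 \<le> V n i" for i
      using gamma rho eps elim(2) by (cases i) (auto simp: V_def intro!: ge_one_powr_ge_zero)
    moreover have "P n i \<subseteq> node_pairs n" for i using star_subset by (cases i) (auto simp: P_def)
    moreover have "(\<Sum>e\<in>P n i. fit \<gamma> \<alpha> n (S n) (m0 n) (b0 n) e) \<le> V n i" if "i \<in> coords (S n)" for i
      using that R.mean_pairs[OF true[OF elim(2)]] R.mean_star[OF true[OF elim(2)]] by (auto simp: P_def V_def coords_def)
    ultimately show ?case by auto
  qed
  from noise_event[OF eps this] obtain B where B: "\<forall>n\<ge>1. B n \<in> sets (M n)" "(\<lambda>n. measure (M n) (B n)) \<longlonglongrightarrow> 0"
    and ev: "eventually (\<lambda>n. \<forall>\<omega>\<in>space (M n) - B n. \<forall>i\<in>coords (S n). \<bar>Zn n (P n i) \<omega>\<bar> \<le> real n powr \<epsilon> * sqrt (V n i)) sequentially"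
    by blast
  have "eventually (\<lambda>n. \<forall>\<omega>\<in>space (M n) - B n. \<bar>mh n \<omega> - m0 n\<bar> \<le> real n powr (- (d / 2)) \<and>
        (\<forall>k\<in>S n. \<bar>bh n \<omega> k - b0 n k\<bar> \<le> real n powr (- (d / 2)))) sequentially"
    using ev reg eventually_ge_at_top[of 1]
  proof eventually_elim
    case (elim n)
    interpret R: regime_rates \<gamma> \<alpha> n "S n" "M1 n" "M2 n" \<epsilon> c by (rule elim(2))
    interpret sparse_beta_model "M n" n "mu_of \<gamma> n (m0 n)" "beta_of \<alpha> n (S n) (b0 n)" "A n" by (rule model[OF elim(3)])
    show ?case
    proof (intro ballI conjI)
      fix \<omega> assume w: "\<omega> \<in> space (M n) - B n"
      have np: "\<bar>Zn n (node_pairs n) \<omega>\<bar> \<le> real n powr \<epsilon> * sqrt (real n powr (2 - \<gamma> + 2 * \<epsilon>))"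
        using elim(1)[rule_format, OF w, of None] by (simp add: P_def V_def coords_def)
      have ns: "\<bar>Zn n (star n k UNIV) \<omega>\<bar> \<le> real n powr \<epsilon> * sqrt (real n powr (1 - \<rho> + 2 * \<epsilon>))" if "k \<in> S n" for k
        using elim(1)[rule_format, OF w, of "Some k"] that by (simp add: P_def V_def coords_def)
      have w': "\<omega> \<in> space (M n)" using w by simp
      have sym: "\<And>i j. i \<in> {1..n} \<Longrightarrow> j \<in> {1..n} \<Longrightarrow> A n \<omega> i j = A n \<omega> j i" by (rule symmetric[OF w'])
      note rates = R.mu_rate[OF mle[OF elim(3) w'] true[OF elim(3)] sym np ns d(2-4)]
        R.beta_rate[OF mle[OF elim(3) w'] true[OF elim(3)] sym np ns d(2-4)]
      have "\<bar>mh n \<omega> - m0 n\<bar> \<le> real n powr (- d + 5 * \<epsilon>)" by (rule rates(1))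
      also have "\<dots> \<le> real n powr (- (d / 2))" by (rule R.mono) (use d in \<open>simp add: \<epsilon>_def\<close>)
      finally show "\<bar>mh n \<omega> - m0 n\<bar> \<le> real n powr (- (d / 2))" .
      fix k assume k: "k \<in> S n"
      have "\<bar>bh n \<omega> k - b0 n k\<bar> \<le> real n powr (- d + 9 * \<epsilon>)" by (rule rates(2)) (use k in auto)
      also have "\<dots> \<le> real n powr (- (d / 2))" by (rule R.mono) (use d in \<open>simp add: \<epsilon>_def\<close>)
      finally show "\<bar>bh n \<omega> k - b0 n k\<bar> \<le> real n powr (- (d / 2))" .
    qed
  qed
  then show ?thesis using B d(1) by (intro exI[of _ "d / 2"] conjI exI[of _ B]) auto
qed

end

lemma bar_o_P_if_small_off_null_events:
  assumes c: "0 < c" and M: "\<And>n. n \<ge> 1 \<Longrightarrow> prob_space (M n)" and B: "\<And>n. n \<ge> 1 \<Longrightarrow> B n \<in> sets (M n)"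
    and B0: "(\<lambda>n. measure (M n) (B n)) \<longlonglongrightarrow> 0"
    and small: "eventually (\<lambda>n. \<forall>\<omega>\<in>space (M n) - B n. \<bar>X n \<omega>\<bar> \<le> real n powr (- c)) sequentially"
  shows "bar_o_P M X (\<lambda>_. 1)"
  unfolding bar_o_P_def big_O_P_def
proof (intro exI[of _ c] conjI c, intro allI impI)
  fix e :: real assume "0 < e"
  then have "eventually (\<lambda>n. measure (M n) (B n) < e) sequentially" using B0 by (intro order_tendstoD(2)) auto
  with small have "eventually (\<lambda>n. measure (M n) {\<omega> \<in> space (M n). \<bar>X n \<omega>\<bar> > 1 * (real n powr (- c) * 1)} \<le> e) sequentially"
    using eventually_ge_at_top[of 1]
  proof eventually_elim
    case (elim n)
    interpret prob_space "M n" by (rule M[OF elim(3)])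
    have "measure (M n) {\<omega> \<in> space (M n). \<bar>X n \<omega>\<bar> > 1 * (real n powr (- c) * 1)} \<le> measure (M n) (B n)"
      using elim(1) by (intro finite_measure_mono B elim(3)) force
    then show ?case using elim(2) by linarith
  qed
  then show "\<exists>K>0. eventually (\<lambda>n. measure (M n) {\<omega> \<in> space (M n). \<bar>X n \<omega>\<bar> > K * (real n powr (- c) * 1)} \<le> e) sequentially"
    by (intro exI[of _ 1]) auto
qed

lemma max_abs_le:
  assumes "finite T" "0 \<le> h" "\<And>i. i \<in> T \<Longrightarrow> \<bar>v i\<bar> \<le> h"
  shows "\<bar>max_abs T v\<bar> \<le> h"
proof -
  have "max_abs T v \<le> h" using assms by (auto simp: max_abs_def)
  moreover have "0 \<le> max_abs T v" using assms by (auto simp: max_abs_def intro: Max_ge)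
  ultimately show ?thesis by simp
qed

section \<open>Asymptotic normality\<close>

lemma scale_root:
  fixes D W x :: real
  assumes "0 < D" "0 \<le> W"
  shows "D powr (- 1 / 2) * x powr y / sqrt W = sqrt (x powr (2 * y) / (D * W))"
proof -
  have "D powr (- 1 / 2) = inverse (sqrt D)"
    using assms(1) by (simp add: powr_minus powr_half_sqrt flip: minus_divide_left)
  moreover have "x powr y = sqrt (x powr (2 * y))" by (simp add: powr_half_sqrt[symmetric] powr_powr)
  ultimately show ?thesis by (simp add: real_sqrt_divide real_sqrt_mult field_simps)
qed

context sbm_sequence
begin

text \<open>
  The pairs that carry the leading term of a coordinate, indexed as in \<open>coords\<close>.
\<close>

definition lead_pairs :: "nat \<Rightarrow> nat option \<Rightarrow> (nat \<times> nat) set" where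
  "lead_pairs n k = (case k of None \<Rightarrow> pairs_in n (- S n) | Some i \<Rightarrow> star n i (- S n))"

definition lead_logit :: "nat \<Rightarrow> nat option \<Rightarrow> real" where
  "lead_logit n k = (case k of None \<Rightarrow> mu_of \<gamma> n (m0 n) | Some i \<Rightarrow> mu_of \<gamma> n (m0 n) + (\<alpha> * ln (real n) + b0 n i))"

definition lead_var :: "nat \<Rightarrow> nat option \<Rightarrow> real" where
  "lead_var n k = real (card (lead_pairs n k)) * dlogistic (lead_logit n k)"

definition lead :: "nat \<Rightarrow> 'w \<Rightarrow> nat option \<Rightarrow> real" where
  "lead n \<omega> k = Zn n (lead_pairs n k) \<omega> / sqrt (lead_var n k)"

definition mle_error :: "nat \<Rightarrow> 'w \<Rightarrow> nat option \<Rightarrow> real" where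
  "mle_error n \<omega> k = (case k of None \<Rightarrow> mh n \<omega> - m0 n | Some i \<Rightarrow> bh n \<omega> i - b0 n i)"

lemma lead_pairs_subset: "lead_pairs n k \<subseteq> node_pairs n"
  using star_subset pairs_in_subset by (cases k) (auto simp: lead_pairs_def)

lemma card_lead_pairs_Some:
  assumes "n \<ge> 1" "i \<in> S n"
  shows "card (lead_pairs n (Some i)) = card ({1..n} - S n)"
proof -
  have "i \<in> {1..n}" "{1..n} \<inter> - S n - {i} = {1..n} - S n" using assms(2) S[OF assms(1)] by auto
  then show ?thesis unfolding lead_pairs_def option.case by (simp only: card_star)
qed

lemma sparsity_weaken:
  assumes "eventually (\<lambda>n. real (card (S n)) \<le> real n powr ((1 - \<alpha>) / 2 - c)) sequentially"
  shows "eventually (\<lambda>n. real (card (S n)) \<le> real n powr (1 - \<alpha> - c)) sequentially"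
  using assms eventually_ge_at_top[of 1]
proof eventually_elim
  case (elim n)
  have "real n powr ((1 - \<alpha>) / 2 - c) \<le> real n powr (1 - \<alpha> - c)"
    using elim alpha by (intro powr_mono) auto
  with elim show ?case by linarith
qed

text \<open>
  Consistency first puts the estimator into the interior of the box and makes the Taylor remainders small; the score
  equations then apply on the event that the relevant edge counts are close to their means.
\<close>

lemma linearization:
  assumes c: "0 < c" and s: "eventually (\<lambda>n. real (card (S n)) \<le> real n powr ((1 - \<alpha>) / 2 - c)) sequentially"
    and eta: "0 < \<eta>" "\<And>n. n \<ge> 1 \<Longrightarrow> \<bar>m0 n\<bar> \<le> M1 n - \<eta>"
      "\<And>n i. n \<ge> 1 \<Longrightarrow> i \<in> S n \<Longrightarrow> \<eta> \<le> b0 n i \<and> b0 n i \<le> M2 n - \<eta>"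
  shows "\<exists>\<delta> B. \<delta> \<longlonglongrightarrow> 0 \<and> (\<forall>n\<ge>1. B n \<in> sets (M n)) \<and> (\<lambda>n. measure (M n) (B n)) \<longlonglongrightarrow> 0 \<and>
     eventually (\<lambda>n. \<forall>\<omega>\<in>space (M n) - B n. \<forall>k\<in>coords (S n).
        \<bar>mle_error n \<omega> k * sqrt (lead_var n k) - lead n \<omega> k\<bar> \<le> \<delta> n * (1 + \<bar>lead n \<omega> k\<bar>)) sequentially"
proof -
  note s1 = sparsity_weaken[OF s]
  obtain c' B1 where c': "0 < c'" and B1: "\<forall>n\<ge>1. B1 n \<in> sets (M n)" "(\<lambda>n. measure (M n) (B1 n)) \<longlonglongrightarrow> 0"
    and ev1: "eventually (\<lambda>n. \<forall>\<omega>\<in>space (M n) - B1 n. \<bar>mh n \<omega> - m0 n\<bar> \<le> real n powr (- c') \<and>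
        (\<forall>k\<in>S n. \<bar>bh n \<omega> k - b0 n k\<bar> \<le> real n powr (- c'))) sequentially"
    using consistency[OF c s1] by blast
  define d where "d = min c (min ((1 - \<gamma> / 2) / 2) ((1 - \<rho>) / 4))"
  \<comment> \<open>The remainders have exponents \<open>- d + 2 * \<epsilon>\<close> and \<open>- (1 - \<alpha>) / 2 + 5 * \<epsilon>\<close>, which must be negative.\<close>
  define \<epsilon> where "\<epsilon> = min (d / 4) ((1 - \<alpha>) / 20)"
  have d: "0 < d" "d \<le> c" "d \<le> (1 - \<gamma> / 2) / 2" "d \<le> (1 - \<rho>) / 4"
  proof -
    show "0 < d" using c gamma rho by (simp add: d_def)
    show "d \<le> c" unfolding d_def by (rule min.cobounded1)
    show "d \<le> (1 - \<gamma> / 2) / 2" unfolding d_def by (rule min.coboundedI2, rule min.cobounded1)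
    show "d \<le> (1 - \<rho>) / 4" unfolding d_def by (rule min.coboundedI2, rule min.cobounded2)
  qed
  have eps: "0 < \<epsilon>" "\<epsilon> \<le> d / 4" "\<epsilon> \<le> (1 - \<alpha>) / 20"
  proof -
    show "0 < \<epsilon>" using d alpha by (simp add: \<epsilon>_def)
    show "\<epsilon> \<le> d / 4" unfolding \<epsilon>_def by (rule min.cobounded1)
    show "\<epsilon> \<le> (1 - \<alpha>) / 20" unfolding \<epsilon>_def by (rule min.cobounded2)
  qed
  have eps2: "2 * \<epsilon> \<le> d" "\<epsilon> \<le> c" using eps d by linarith+
  note reg = regime_eventually[OF eps(1) c s1]
  \<comment> \<open>Index \<open>0\<close> is the family of outer pairs, index \<open>1\<close> that of inner pairs.\<close>
  define P where "P n i = (if i = 0 then pairs_in n (- S n) else pairs_in n (S n))" for n and i :: nat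
  define V where "V n i = (if i = 0 then real n powr (2 - \<gamma> + 2 * \<epsilon>) else real n powr (1 - \<gamma> / 2))" for n and i :: nat
  have "eventually (\<lambda>n. finite {0, 1::nat} \<and> card {0, 1::nat} \<le> n + 2 \<and> (\<forall>i\<in>{0, 1}. P n i \<subseteq> node_pairs n \<and> 1 \<le> V n i \<and>
       (\<Sum>e\<in>P n i. fit \<gamma> \<alpha> n (S n) (m0 n) (b0 n) e) \<le> V n i)) sequentially"
    using reg s eventually_ge_at_top[of 1]
  proof eventually_elim
    case (elim n)
    interpret R: regime_rates \<gamma> \<alpha> n "S n" "M1 n" "M2 n" \<epsilon> c by (rule elim(1))
    have "real n powr (2 - \<gamma> + \<epsilon>) \<le> real n powr (2 - \<gamma> + 2 * \<epsilon>)" by (rule R.mono) (use eps in auto)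
    then have "(\<Sum>e\<in>pairs_in n (- S n). fit \<gamma> \<alpha> n (S n) (m0 n) (b0 n) e) \<le> real n powr (2 - \<gamma> + 2 * \<epsilon>)"
      using R.mean_outer[OF true[OF elim(3)]] by linarith
    moreover have "(\<Sum>e\<in>pairs_in n (S n). fit \<gamma> \<alpha> n (S n) (m0 n) (b0 n) e) \<le> real n powr (1 - \<gamma> / 2)"
      by (rule R.mean_pairs_inner[OF elim(2) true[OF elim(3)] eps2(2)])
    moreover have "1 \<le> real n powr (2 - \<gamma> + 2 * \<epsilon>)" "1 \<le> real n powr (1 - \<gamma> / 2)"
      using gamma eps elim(3) by (auto intro!: ge_one_powr_ge_zero)
    ultimately show ?case using pairs_in_subset by (auto simp: P_def V_def)
  qed
  from noise_event[OF eps(1) this] obtain B2 where B2: "\<forall>n\<ge>1. B2 n \<in> sets (M n)" "(\<lambda>n. measure (M n) (B2 n)) \<longlonglongrightarrow> 0"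
    and ev2: "eventually (\<lambda>n. \<forall>\<omega>\<in>space (M n) - B2 n. \<forall>i\<in>{0, 1}. \<bar>Zn n (P n i) \<omega>\<bar> \<le> real n powr \<epsilon> * sqrt (V n i)) sequentially"
    by blast
  have "eventually (\<lambda>n. finite (S n) \<and> card (S n) \<le> n + 2 \<and> (\<forall>k\<in>S n. star n k (S n) \<subseteq> node_pairs n \<and>
       1 \<le> real n powr ((1 - \<rho>) / 2) \<and>
       (\<Sum>e\<in>star n k (S n). fit \<gamma> \<alpha> n (S n) (m0 n) (b0 n) e) \<le> real n powr ((1 - \<rho>) / 2))) sequentially"
    using reg s eventually_ge_at_top[of 1]
  proof eventually_elim
    case (elim n)
    interpret R: regime_rates \<gamma> \<alpha> n "S n" "M1 n" "M2 n" \<epsilon> c by (rule elim(1))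
    have "card (S n) \<le> n" using card_mono[OF _ S[OF elim(3)]] by simp
    moreover have "1 \<le> real n powr ((1 - \<rho>) / 2)"
      using rho elim(3) by (intro ge_one_powr_ge_zero) auto
    ultimately show ?case
      using R.mean_star_inner[OF elim(2) true[OF elim(3)] _ eps2(2)] star_subset by auto
  qed
  from noise_event[OF eps(1) this] obtain B3 where B3: "\<forall>n\<ge>1. B3 n \<in> sets (M n)" "(\<lambda>n. measure (M n) (B3 n)) \<longlonglongrightarrow> 0"
    and ev3: "eventually (\<lambda>n. \<forall>\<omega>\<in>space (M n) - B3 n. \<forall>k\<in>S n. \<bar>Zn n (star n k (S n)) \<omega>\<bar> \<le> real n powr \<epsilon> * sqrt (real n powr ((1 - \<rho>) / 2))) sequentially"
    by blast
  define h where "h n = real n powr (- c')" for n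
  define \<delta> where "\<delta> n = 8 * h n + 4 * real n powr (- d + 2 * \<epsilon>) + 6 * real n powr (- (1 - \<alpha>) / 2 + 5 * \<epsilon>)" for n
  define B where "B n = B1 n \<union> B2 n \<union> B3 n" for n
  have h0: "h \<longlonglongrightarrow> 0" unfolding h_def using c' by real_asymp
  have p0: "(\<lambda>n. real n powr x) \<longlonglongrightarrow> 0" if "x < 0" for x using that by real_asymp
  have "\<delta> \<longlonglongrightarrow> 8 * 0 + 4 * 0 + 6 * 0"
    unfolding \<delta>_def
  proof (intro tendsto_intros h0 p0)
    show "- d + 2 * \<epsilon> < 0" using eps d by linarith
    show "- (1 - \<alpha>) / 2 + 5 * \<epsilon> < 0" using eps(3) alpha(2) by (simp add: field_simps)
  qed
  then have \<delta>0: "\<delta> \<longlonglongrightarrow> 0" by simp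
  have Bm: "\<forall>n\<ge>1. B n \<in> sets (M n)" using B1(1) B2(1) B3(1) by (auto simp: B_def)
  have B0: "(\<lambda>n. measure (M n) (B n)) \<longlonglongrightarrow> 0"
  proof (rule Lim_null_comparison)
    show "eventually (\<lambda>n. norm (measure (M n) (B n)) \<le> measure (M n) (B1 n) + measure (M n) (B2 n) + measure (M n) (B3 n)) sequentially"
      using eventually_ge_at_top[of 1]
    proof eventually_elim
      case (elim n)
      have m: "B1 n \<in> sets (M n)" "B2 n \<in> sets (M n)" "B3 n \<in> sets (M n)" using B1(1) B2(1) B3(1) elim by auto
      have "measure (M n) (B n) \<le> measure (M n) (B1 n \<union> B2 n) + measure (M n) (B3 n)"
        unfolding B_def using m by (intro measure_Un_le) auto
      also have "measure (M n) (B1 n \<union> B2 n) \<le> measure (M n) (B1 n) + measure (M n) (B2 n)"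
        using m by (intro measure_Un_le) auto
      finally show ?case by simp
    qed
    have "(\<lambda>n. measure (M n) (B1 n) + measure (M n) (B2 n) + measure (M n) (B3 n)) \<longlonglongrightarrow> 0 + 0 + 0"
      by (intro tendsto_add B1 B2 B3)
    then show "(\<lambda>n. measure (M n) (B1 n) + measure (M n) (B2 n) + measure (M n) (B3 n)) \<longlonglongrightarrow> 0" by simp
  qed
  have evh: "eventually (\<lambda>n. h n < min \<eta> (1 / 8)) sequentially"
    using h0 by (rule order_tendstoD(2)) (use eta in auto)
  have "eventually (\<lambda>n. \<forall>\<omega>\<in>space (M n) - B n. \<forall>k\<in>coords (S n).
        \<bar>mle_error n \<omega> k * sqrt (lead_var n k) - lead n \<omega> k\<bar> \<le> \<delta> n * (1 + \<bar>lead n \<omega> k\<bar>)) sequentially"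
    using reg s ev1 ev2 ev3 evh eventually_ge_at_top[of 1]
  proof eventually_elim
    case (elim n)
    interpret R: regime_rates \<gamma> \<alpha> n "S n" "M1 n" "M2 n" \<epsilon> c by (rule elim(1))
    interpret sparse_beta_model "M n" n "mu_of \<gamma> n (m0 n)" "beta_of \<alpha> n (S n) (b0 n)" "A n" by (rule model[OF elim(7)])
    show ?case
    proof (intro ballI)
      fix \<omega> k assume w: "\<omega> \<in> space (M n) - B n" and k: "k \<in> coords (S n)"
      then have w1: "\<omega> \<in> space (M n) - B1 n" and w2: "\<omega> \<in> space (M n) - B2 n" and w3: "\<omega> \<in> space (M n) - B3 n"
        and w0: "\<omega> \<in> space (M n)"
        by (auto simp: B_def)
      have sym: "\<And>i j. i \<in> {1..n} \<Longrightarrow> j \<in> {1..n} \<Longrightarrow> A n \<omega> i j = A n \<omega> j i" by (rule symmetric[OF w0])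
      have mu: "\<bar>mh n \<omega> - m0 n\<bar> \<le> h n" and be: "\<And>k. k \<in> S n \<Longrightarrow> \<bar>bh n \<omega> k - b0 n k\<bar> \<le> h n"
        using elim(3)[rule_format, OF w1] by (auto simp: h_def)
      have h: "h n < \<eta>" "h n \<le> 1 / 8" "0 \<le> h n" using elim(6) by (auto simp: h_def)
      have mi: "- M1 n < mh n \<omega>" "mh n \<omega> < M1 n" using mu h eta(2)[OF elim(7)] by linarith+
      have bi: "0 < bh n \<omega> k \<and> bh n \<omega> k < M2 n" if "k \<in> S n" for k
        using be[OF that] h eta(3)[OF elim(7) that] by linarith
      have no: "\<bar>Zn n (pairs_in n (- S n)) \<omega>\<bar> \<le> real n powr \<epsilon> * sqrt (real n powr (2 - \<gamma> + 2 * \<epsilon>))"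
        using elim(4)[rule_format, OF w2, of 0] by (simp add: P_def V_def)
      have ni: "\<bar>Zn n (pairs_in n (S n)) \<omega>\<bar> \<le> real n powr \<epsilon> * sqrt (real n powr (1 - \<gamma> / 2))"
        using elim(4)[rule_format, OF w2, of 1] by (simp add: P_def V_def)
      note lin = R.mu_linearization[OF elim(2) mle[OF elim(7) w0] true[OF elim(7)] sym mi bi mu be h(2) no ni d(2-4) eps2(1)]
        R.beta_linearization[OF elim(2) mle[OF elim(7) w0] true[OF elim(7)] sym mi bi mu be h(2) no ni d(2-4) eps2(1)]
      have fin: "8 * h n * y + 4 * real n powr (- d + 2 * \<epsilon>) + 6 * real n powr (- (1 - \<alpha>) / 2 + 5 * \<epsilon>) \<le> \<delta> n * (1 + y)"
        if "0 \<le> y" for y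
      proof -
        have "0 \<le> y * (4 * real n powr (- d + 2 * \<epsilon>) + 6 * real n powr (- (1 - \<alpha>) / 2 + 5 * \<epsilon>)) + 8 * h n"
          using that h by (intro add_nonneg_nonneg mult_nonneg_nonneg) auto
        then show ?thesis unfolding \<delta>_def by (simp add: algebra_simps)
      qed
      show "\<bar>mle_error n \<omega> k * sqrt (lead_var n k) - lead n \<omega> k\<bar> \<le> \<delta> n * (1 + \<bar>lead n \<omega> k\<bar>)"
      proof (cases k)
        case None
        have "\<bar>mle_error n \<omega> k * sqrt (lead_var n k) - lead n \<omega> k\<bar> \<le> 4 * h n * \<bar>lead n \<omega> k\<bar> + 4 * real n powr (- d + 2 * \<epsilon>)"
          unfolding None mle_error_def lead_var_def lead_def lead_pairs_def lead_logit_def option.case by (rule lin(1))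
        moreover have "0 \<le> 4 * h n * \<bar>lead n \<omega> k\<bar>" "0 \<le> 6 * real n powr (- (1 - \<alpha>) / 2 + 5 * \<epsilon>)" using h by simp_all
        ultimately show ?thesis using fin[of "\<bar>lead n \<omega> k\<bar>"] by linarith
      next
        case (Some i)
        then have i: "i \<in> S n" using k by (auto simp: coords_def)
        have nk: "\<bar>Zn n (star n i (S n)) \<omega>\<bar> \<le> real n powr \<epsilon> * sqrt (real n powr ((1 - \<rho>) / 2))"
          using elim(5)[rule_format, OF w3 i] .
        have "lead_var n k = real (card ({1..n} - S n)) * dlogistic (mu_of \<gamma> n (m0 n) + (\<alpha> * ln (real n) + b0 n i))"
          unfolding Some lead_var_def card_lead_pairs_Some[OF elim(7) i] by (simp add: lead_logit_def)
        moreover have "\<bar>(bh n \<omega> i - b0 n i) * sqrt (real (card ({1..n} - S n)) * dlogistic (mu_of \<gamma> n (m0 n) + (\<alpha> * ln (real n) + b0 n i)))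
              - Zn n (star n i (- S n)) \<omega> / sqrt (real (card ({1..n} - S n)) * dlogistic (mu_of \<gamma> n (m0 n) + (\<alpha> * ln (real n) + b0 n i)))\<bar>
            \<le> 8 * h n * \<bar>Zn n (star n i (- S n)) \<omega> / sqrt (real (card ({1..n} - S n)) * dlogistic (mu_of \<gamma> n (m0 n) + (\<alpha> * ln (real n) + b0 n i)))\<bar>
              + 4 * real n powr (- d + 2 * \<epsilon>) + 6 * real n powr (- (1 - \<alpha>) / 2 + 5 * \<epsilon>)"
          by (rule lin(2)) (use i nk in auto)
        moreover have "mle_error n \<omega> k = bh n \<omega> i - b0 n i" "lead n \<omega> k = Zn n (star n i (- S n)) \<omega> / sqrt (lead_var n k)"
          by (simp_all add: Some mle_error_def lead_def lead_pairs_def)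
        ultimately have "\<bar>mle_error n \<omega> k * sqrt (lead_var n k) - lead n \<omega> k\<bar> \<le> 8 * h n * \<bar>lead n \<omega> k\<bar> +
            4 * real n powr (- d + 2 * \<epsilon>) + 6 * real n powr (- (1 - \<alpha>) / 2 + 5 * \<epsilon>)"
          by (simp only:)
        then show ?thesis using fin[of "\<bar>lead n \<omega> k\<bar>"] by simp
      qed
    qed
  qed
  then show ?thesis using \<delta>0 Bm B0 by blast
qed

lemma true_log:
  assumes e: "0 < e"
  shows "eventually (\<lambda>n. \<bar>m0 n\<bar> \<le> e * ln (real n) \<and> (\<forall>i\<in>S n. \<bar>m0 n + b0 n i\<bar> \<le> e * ln (real n))) sequentially"
  using bounds_log[OF e, of 2] eventually_ge_at_top[of 1]
proof eventually_elim
  case (elim n)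
  have "\<bar>m0 n\<bar> \<le> M1 n" "\<And>i. i \<in> S n \<Longrightarrow> 0 \<le> b0 n i \<and> b0 n i \<le> M2 n"
    using true[OF elim(2)] by (auto simp: param_space_def)
  then have "\<bar>m0 n\<bar> \<le> 2 * (1 + max (M1 n) (M2 n))" "\<And>i. i \<in> S n \<Longrightarrow> \<bar>m0 n + b0 n i\<bar> \<le> 2 * (1 + max (M1 n) (M2 n))"
    by (smt (verit) max.cobounded1 max.cobounded2)+
  then show ?case using elim(1) by force
qed

text \<open>
  The factor between the standardization by \<open>Sigma_diag\<close> and the one by the exact variance \<open>lead_var\<close>.
\<close>

definition error_scale :: "nat \<Rightarrow> nat option \<Rightarrow> real" where
  "error_scale n k = Sigma_diag \<gamma> \<alpha> (m0 n) (b0 n) k powr (- 1 / 2) *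
     (case k of None \<Rightarrow> real n powr (1 - \<gamma> / 2) | Some i \<Rightarrow> real n powr (1 / 2 - \<rho> / 2)) / sqrt (lead_var n k)"

context
  fixes c :: real
  assumes c: "0 < c" and s: "eventually (\<lambda>n. real (card (S n)) \<le> real n powr (1 - \<alpha> - c)) sequentially"
begin

lemma outer_fraction: "(\<lambda>n. real (card ({1..n} - S n)) / real n) \<longlonglongrightarrow> 1"
proof -
  have "(\<lambda>n. real (card (S n)) / real n) \<longlonglongrightarrow> 0"
  proof (rule Lim_null_comparison)
    show "eventually (\<lambda>n. norm (real (card (S n)) / real n) \<le> real n powr (- c)) sequentially"
      using s eventually_ge_at_top[of 1]
    proof eventually_elim
      case (elim n)
      have "real n powr (1 - \<alpha> - c) \<le> real n powr (1 + - c)" using elim alpha by (intro powr_mono) auto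
      also have "\<dots> = real n * real n powr (- c)" using elim by (subst powr_add) simp
      finally show ?case using elim by (simp add: field_simps)
    qed
    show "(\<lambda>n. real n powr (- c)) \<longlonglongrightarrow> 0" using c by real_asymp
  qed
  from tendsto_diff[OF tendsto_const[of 1] this] have "(\<lambda>n. 1 - real (card (S n)) / real n) \<longlonglongrightarrow> 1" by simp
  moreover have "eventually (\<lambda>n. 1 - real (card (S n)) / real n = real (card ({1..n} - S n)) / real n) sequentially"
    using eventually_ge_at_top[of 1]
  proof eventually_elim
    case (elim n)
    then show ?case using card_outside[OF elim] by (simp add: field_simps)
  qed
  ultimately show ?thesis by (rule Lim_transform_eventually)
qed

text \<open>
  Since \<open>S\<close> contains a vanishing fraction of the nodes, almost all pairs are outer.
\<close>

lemma outer_pairs_fraction: "(\<lambda>n. 2 * real (card (pairs_in n (- S n))) / (real n)\<^sup>2) \<longlonglongrightarrow> 1"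
proof -
  have "(\<lambda>n. 1 / real n) \<longlonglongrightarrow> 0" by real_asymp
  then have "(\<lambda>n. real (card ({1..n} - S n)) / real n * (real (card ({1..n} - S n)) / real n - 1 / real n)) \<longlonglongrightarrow> 1 * (1 - 0)"
    by (intro tendsto_intros outer_fraction)
  moreover have "eventually (\<lambda>n. real (card ({1..n} - S n)) / real n * (real (card ({1..n} - S n)) / real n - 1 / real n)
     = 2 * real (card (pairs_in n (- S n))) / (real n)\<^sup>2) sequentially"
    using eventually_ge_at_top[of 1]
  proof eventually_elim
    case (elim n)
    have i: "{1..n} \<inter> - S n = {1..n} - S n" by auto
    show ?case unfolding card_pairs_in[of n "- S n"] i using elim by (simp add: power2_eq_square field_simps)
  qed
  ultimately show ?thesis by (simp add: Lim_transform_eventually)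
qed

text \<open>
  The square of the factor is \<open>dlogistic_limit\<close>'s quotient divided by the fraction of outer pairs.
\<close>

lemma error_scale_None: "(\<lambda>n. error_scale n None) \<longlonglongrightarrow> 1"
proof -
  define g where "g n = real n powr (- \<gamma>) / (dlogistic (- \<gamma> * ln (real n) + m0 n) * limit_variance \<gamma> (m0 n))" for n
  have "g \<longlonglongrightarrow> 1"
    unfolding g_def
  proof (rule dlogistic_limit)
    fix e :: real assume "0 < e"
    from true_log[OF this] show "eventually (\<lambda>n. \<bar>m0 n\<bar> \<le> e * ln (real n)) sequentially" by eventually_elim auto
  qed (use alpha rho in auto)
  then have "(\<lambda>n. sqrt (g n / (2 * real (card (pairs_in n (- S n))) / (real n)\<^sup>2))) \<longlonglongrightarrow> sqrt (1 / 1)"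
    by (intro tendsto_intros outer_pairs_fraction) auto
  moreover have "eventually (\<lambda>n. sqrt (g n / (2 * real (card (pairs_in n (- S n))) / (real n)\<^sup>2)) = error_scale n None) sequentially"
    using eventually_ge_at_top[of 1]
  proof eventually_elim
    case (elim n)
    have D: "Sigma_diag \<gamma> \<alpha> (m0 n) (b0 n) None = 2 * limit_variance \<gamma> (m0 n)"
      using alpha rho by (intro Sigma_diag_None) auto
    have "error_scale n None = sqrt (real n powr (2 * (1 - \<gamma> / 2)) / (2 * limit_variance \<gamma> (m0 n) * lead_var n None))"
      unfolding error_scale_def D option.case
      by (rule scale_root) (auto simp: limit_variance_pos lead_var_def dlogistic_pos less_imp_le)
    also have "2 * (1 - \<gamma> / 2) = 2 + - \<gamma>" by simp
    also have "real n powr (2 + - \<gamma>) = (real n)\<^sup>2 * real n powr (- \<gamma>)"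
      using elim by (subst powr_add) (simp add: powr_numeral)
    also have "lead_var n None = real (card (pairs_in n (- S n))) * dlogistic (- \<gamma> * ln (real n) + m0 n)"
      by (simp add: lead_var_def lead_pairs_def lead_logit_def mu_of_def)
    finally show ?case by (simp add: g_def field_simps)
  qed
  ultimately show ?thesis by (simp add: Lim_transform_eventually)
qed

lemma error_scale_Some:
  assumes i: "eventually (\<lambda>n. i \<in> S n) sequentially"
  shows "(\<lambda>n. error_scale n (Some i)) \<longlonglongrightarrow> 1"
proof -
  define g where "g n = real n powr (- \<rho>) / (dlogistic (- \<rho> * ln (real n) + (m0 n + b0 n i)) * limit_variance \<rho> (m0 n + b0 n i))" for n
  have "g \<longlonglongrightarrow> 1"
    unfolding g_def
  proof (rule dlogistic_limit)
    fix e :: real assume "0 < e"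
    from true_log[OF this] i show "eventually (\<lambda>n. \<bar>m0 n + b0 n i\<bar> \<le> e * ln (real n)) sequentially" by eventually_elim auto
  qed (use rho in auto)
  then have "(\<lambda>n. sqrt (g n / (real (card ({1..n} - S n)) / real n))) \<longlonglongrightarrow> sqrt (1 / 1)"
    by (intro tendsto_intros outer_fraction) auto
  moreover have "eventually (\<lambda>n. sqrt (g n / (real (card ({1..n} - S n)) / real n)) = error_scale n (Some i)) sequentially"
    using eventually_ge_at_top[of 1] i
  proof eventually_elim
    case (elim n)
    have D: "Sigma_diag \<gamma> \<alpha> (m0 n) (b0 n) (Some i) = limit_variance \<rho> (m0 n + b0 n i)"
      using alpha rho by (intro Sigma_diag_Some) auto
    have "error_scale n (Some i) = sqrt (real n powr (2 * (1 / 2 - \<rho> / 2)) / (limit_variance \<rho> (m0 n + b0 n i) * lead_var n (Some i)))"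
      unfolding error_scale_def D option.case
      by (rule scale_root) (auto simp: limit_variance_pos lead_var_def dlogistic_pos less_imp_le)
    also have "2 * (1 / 2 - \<rho> / 2) = 1 + - \<rho>" by (simp add: field_simps)
    also have "real n powr (1 + - \<rho>) = real n * real n powr (- \<rho>)"
      using elim by (subst powr_add) simp
    also have "lead_var n (Some i) = real (card ({1..n} - S n)) * dlogistic (- \<rho> * ln (real n) + (m0 n + b0 n i))"
      unfolding lead_var_def card_lead_pairs_Some[OF elim] by (simp add: lead_logit_def mu_of_def algebra_simps)
    finally show ?case by (simp add: g_def field_simps)
  qed
  ultimately show ?thesis by (simp add: Lim_transform_eventually)
qed

lemma lead_growth:
  assumes k: "k = None \<or> (\<exists>i. k = Some i \<and> eventually (\<lambda>n. i \<in> S n) sequentially)"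
  shows "filterlim (\<lambda>n. card (lead_pairs n k)) at_top sequentially"
    and "filterlim (\<lambda>n. lead_var n k) at_top sequentially"
proof -
  \<comment> \<open>Both \<open>2 - \<gamma> - 2 * \<epsilon>\<close> and \<open>1 - \<rho> - 2 * \<epsilon>\<close>, the lower bounds for the exponents of the variances, are at least \<open>2 * \<epsilon>\<close>.\<close>
  define \<epsilon> where "\<epsilon> = min ((2 - \<gamma>) / 4) ((1 - \<rho>) / 4)"
  have eps: "0 < \<epsilon>" "\<epsilon> \<le> (2 - \<gamma>) / 4" "\<epsilon> \<le> (1 - \<rho>) / 4"
  proof -
    show "0 < \<epsilon>" using gamma rho by (simp add: \<epsilon>_def)
    show "\<epsilon> \<le> (2 - \<gamma>) / 4" unfolding \<epsilon>_def by (rule min.cobounded1)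
    show "\<epsilon> \<le> (1 - \<rho>) / 4" unfolding \<epsilon>_def by (rule min.cobounded2)
  qed
  have e1: "\<epsilon> \<le> 1 / 4" using eps(3) rho(1) by (simp add: field_simps)
  have ev: "eventually (\<lambda>n. k = None \<or> (\<exists>i\<in>S n. k = Some i)) sequentially"
    using k by (auto elim: eventually_mono)
  have "eventually (\<lambda>n. real n powr (1 - \<epsilon>) \<le> real (card (lead_pairs n k)) \<and> real n powr (2 * \<epsilon>) \<le> lead_var n k) sequentially"
    using ev regime_eventually[OF eps(1) c s] eventually_ge_at_top[of 1]
  proof eventually_elim
    case (elim n)
    interpret R: regime_rates \<gamma> \<alpha> n "S n" "M1 n" "M2 n" \<epsilon> c by (rule elim(2))
    note tr = true[OF elim(3)]
    consider "k = None" | i where "i \<in> S n" "k = Some i" using elim(1) by auto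
    then show ?case
    proof cases
      case 1
      have "real n powr (1 - \<epsilon>) \<le> real n powr (2 - \<epsilon>)" by (rule R.mono) simp
      then have a: "real n powr (1 - \<epsilon>) \<le> real (card (lead_pairs n k))"
        using R.N_ge 1 by (simp add: lead_pairs_def)
      have "real n powr (2 * \<epsilon>) \<le> real n powr (2 - \<epsilon> + (- \<gamma> - \<epsilon>))" by (rule R.mono) (use eps in \<open>simp add: field_simps\<close>)
      also have "\<dots> = real n powr (2 - \<epsilon>) * real n powr (- \<gamma> - \<epsilon>)" by (rule powr_add)
      also have "\<dots> \<le> lead_var n k"
        unfolding 1 lead_var_def lead_pairs_def lead_logit_def option.case
        using R.N_ge R.a0[OF R.parD(1)[OF tr]] by (intro mult_mono) auto
      finally show ?thesis using a by simp
    next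
      case 2
      have a: "real n powr (1 - \<epsilon>) \<le> real (card (lead_pairs n k))"
        unfolding 2(2) card_lead_pairs_Some[OF elim(3) 2(1)] by (rule R.q_ge)
      have "real n powr (2 * \<epsilon>) \<le> real n powr (1 - \<epsilon> + (- \<rho> - \<epsilon>))" by (rule R.mono) (use eps in \<open>simp add: field_simps\<close>)
      also have "\<dots> = real n powr (1 - \<epsilon>) * real n powr (- \<rho> - \<epsilon>)" by (rule powr_add)
      also have "\<dots> \<le> lead_var n k"
        unfolding lead_var_def
        using a R.a1[OF R.parD(1)[OF tr] R.parD(2)[OF tr 2(1)]] 2(2) by (intro mult_mono) (auto simp: lead_logit_def)
      finally show ?thesis using a by simp
    qed
  qed
  then have ev1: "eventually (\<lambda>n. real n powr (1 - \<epsilon>) \<le> real (card (lead_pairs n k))) sequentially"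
    and ev2: "eventually (\<lambda>n. real n powr (2 * \<epsilon>) \<le> lead_var n k) sequentially"
    by (auto elim: eventually_mono)
  have p: "filterlim (\<lambda>n. real n powr x) at_top sequentially" if "0 < x" for x
    using that by real_asymp
  have "filterlim (\<lambda>n. real (card (lead_pairs n k))) at_top sequentially"
    by (rule filterlim_at_top_mono[OF p ev1]) (use e1 in simp)
  then show "filterlim (\<lambda>n. card (lead_pairs n k)) at_top sequentially"
    by (simp add: filterlim_sequentially_iff_filterlim_real)
  show "filterlim (\<lambda>n. lead_var n k) at_top sequentially"
    by (rule filterlim_at_top_mono[OF p ev2]) (use eps in simp)
qed

end

lemma lead_joint_distr:
  assumes n: "n \<ge> 1" and F: "F \<subseteq> S n"
  shows "distr (M n) (PiM (coords F) (\<lambda>_. borel)) (\<lambda>\<omega>. restrict (lead n \<omega>) (coords F))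
       = PiM (coords F) (\<lambda>k. distr (M n) borel (\<lambda>\<omega>. lead n \<omega> k))"
proof -
  interpret sparse_beta_model "M n" n "mu_of \<gamma> n (m0 n)" "beta_of \<alpha> n (S n) (b0 n)" "A n" by (rule model[OF n])
  have "disjoint_family_on (lead_pairs n) (coords F)"
  proof (unfold disjoint_family_on_def, intro ballI impI)
    fix k l assume kl: "k \<in> coords F" "l \<in> coords F" "k \<noteq> l"
    have "i \<in> S n" if "Some i \<in> coords F" for i using that F by (auto simp: coords_def)
    with kl show "lead_pairs n k \<inter> lead_pairs n l = {}"
      by (auto simp: lead_pairs_def pairs_in_def star_def split: option.splits)
  qed
  moreover have "coords F \<noteq> {}" by (simp add: coords_def)
  ultimately show ?thesis unfolding lead_def restrict_def[symmetric]
    using noise_joint_distr[of "coords F" "lead_pairs n" "\<lambda>k. sqrt (lead_var n k)"] lead_pairs_subset by (simp add: restrict_def)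
qed

lemma lead_measurable:
  assumes n: "n \<ge> 1"
  shows "(\<lambda>\<omega>. lead n \<omega> k) \<in> borel_measurable (M n)"
proof -
  interpret sparse_beta_model "M n" n "mu_of \<gamma> n (m0 n)" "beta_of \<alpha> n (S n) (b0 n)" "A n" by (rule model[OF n])
  show ?thesis unfolding lead_def by (intro borel_measurable_divide noise_measurable borel_measurable_const lead_pairs_subset)
qed

text \<open>
  All pairs in \<open>lead_pairs n k\<close> have the same log-odds, so the leading term is a standardized binomial variable.
\<close>

lemma lead_char:
  assumes n: "n \<ge> 1" and k: "k \<in> coords (S n)" and t: "t\<^sup>2 \<le> 4 * real (card (lead_pairs n k))" and ne: "0 < card (lead_pairs n k)"
  shows "cmod (char (distr (M n) borel (\<lambda>\<omega>. lead n \<omega> k)) t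
            - (1 + (- (t\<^sup>2) / 2) / real (card (lead_pairs n k))) ^ card (lead_pairs n k)) \<le> \<bar>t\<bar>^3 / (6 * sqrt (lead_var n k))"
proof -
  interpret sparse_beta_model "M n" n "mu_of \<gamma> n (m0 n)" "beta_of \<alpha> n (S n) (b0 n)" "A n" by (rule model[OF n])
  have W: "lead_var n k = real (card (lead_pairs n k)) * (logistic (lead_logit n k) * (1 - logistic (lead_logit n k)))"
    by (simp add: lead_var_def dlogistic_eq)
  show ?thesis
    unfolding lead_def W
  proof (rule noise_char[OF lead_pairs_subset _ logistic_pos logistic_less_1 t])
    fix e assume e: "e \<in> lead_pairs n k"
    show "edge_prob (mu_of \<gamma> n (m0 n)) (beta_of \<alpha> n (S n) (b0 n)) (fst e) (snd e) = logistic (lead_logit n k)"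
      using e k by (auto simp: edge_prob_logistic lead_pairs_def lead_logit_def pairs_in_def star_def beta_of_def coords_def
          add.assoc split: option.splits)
  qed (use ne in auto)
qed

text \<open>
  The leading terms converge jointly by independence and the one-dimensional limit theorem; passing to the
  standardized errors changes them by the remainder of \<open>linearization\<close> and by the factor \<open>error_scale\<close>, which tends
  to \<open>1\<close>. Both changes are of the form that \<open>weak_conv_vec_perturb\<close> allows.
\<close>

lemma asymptotic_normality:
  assumes c: "0 < c" and s: "eventually (\<lambda>n. real (card (S n)) \<le> real n powr ((1 - \<alpha>) / 2 - c)) sequentially"
    and eta: "0 < \<eta>" "\<And>n. n \<ge> 1 \<Longrightarrow> \<bar>m0 n\<bar> \<le> M1 n - \<eta>"
      "\<And>n i. n \<ge> 1 \<Longrightarrow> i \<in> S n \<Longrightarrow> \<eta> \<le> b0 n i \<and> b0 n i \<le> M2 n - \<eta>"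
    and F: "eventually (\<lambda>n. F \<subseteq> S n) sequentially"
    and mm: "\<And>n. n \<ge> 1 \<Longrightarrow> mh n \<in> borel_measurable (M n)"
    and bm: "\<And>n i. n \<ge> 1 \<Longrightarrow> i \<in> S n \<Longrightarrow> (\<lambda>\<omega>. bh n \<omega> i) \<in> borel_measurable (M n)"
  shows "weak_conv_vec (coords F)
          (\<lambda>n. distr (M n) (PiM (coords F) (\<lambda>_. borel))
                 (\<lambda>\<omega>. standardized_error \<gamma> \<alpha> n F (m0 n) (b0 n) (mh n \<omega>) (bh n \<omega>)))
          (std_normal_vec (coords F))"
proof -
  obtain \<delta> B where \<delta>: "\<delta> \<longlonglongrightarrow> 0" and B: "\<forall>n\<ge>1. B n \<in> sets (M n)" "(\<lambda>n. measure (M n) (B n)) \<longlonglongrightarrow> 0"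
    and lin: "eventually (\<lambda>n. \<forall>\<omega>\<in>space (M n) - B n. \<forall>k\<in>coords (S n).
        \<bar>mle_error n \<omega> k * sqrt (lead_var n k) - lead n \<omega> k\<bar> \<le> \<delta> n * (1 + \<bar>lead n \<omega> k\<bar>)) sequentially"
    using linearization[OF c s eta] by blast
  note s1 = sparsity_weaken[OF s]
  have kF: "k = None \<or> (\<exists>i. k = Some i \<and> eventually (\<lambda>n. i \<in> S n) sequentially)" if "k \<in> coords F" for k
  proof (cases k)
    case (Some i)
    then have "i \<in> F" using that by (auto simp: coords_def)
    with F have "eventually (\<lambda>n. i \<in> S n) sequentially" by (auto elim: eventually_mono)
    with Some show ?thesis by simp
  qed simp
  have finF: "finite F"
  proof -
    obtain n where "F \<subseteq> S n" "n \<ge> 1"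
      using eventually_conj[OF F eventually_ge_at_top[of 1]] by (auto simp: eventually_sequentially)
    then show ?thesis using S[of n] finite_subset by (meson finite_atLeastAtMost)
  qed
  then have fin: "finite (coords F)" by (simp add: coords_def)
  have pos: "eventually (\<lambda>n. \<forall>k\<in>coords F. 0 < lead_var n k \<and> 0 < card (lead_pairs n k)) sequentially"
  proof (subst eventually_ball_finite_distrib[OF fin], intro ballI)
    fix k assume "k \<in> coords F"
    note g = lead_growth[OF c s1 kF[OF this]]
    have "eventually (\<lambda>n. 1 \<le> lead_var n k) sequentially" using g(2) by (simp add: filterlim_at_top)
    moreover have "eventually (\<lambda>n. 1 \<le> card (lead_pairs n k)) sequentially" using g(1) by (simp add: filterlim_at_top)
    ultimately show "eventually (\<lambda>n. 0 < lead_var n k \<and> 0 < card (lead_pairs n k)) sequentially"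
      by eventually_elim auto
  qed
  obtain n0 where n0: "n0 \<ge> 1" and ge: "\<And>n. n \<ge> n0 \<Longrightarrow> F \<subseteq> S n"
      "\<And>n \<omega> k. n \<ge> n0 \<Longrightarrow> \<omega> \<in> space (M n) \<Longrightarrow> \<omega> \<notin> B n \<Longrightarrow> k \<in> coords (S n) \<Longrightarrow>
         \<bar>mle_error n \<omega> k * sqrt (lead_var n k) - lead n \<omega> k\<bar> \<le> \<delta> n * (1 + \<bar>lead n \<omega> k\<bar>)"
      "\<And>n k. n \<ge> n0 \<Longrightarrow> k \<in> coords F \<Longrightarrow> 0 < lead_var n k \<and> 0 < card (lead_pairs n k)"
    using eventually_conj[OF eventually_conj[OF F lin] eventually_conj[OF pos eventually_ge_at_top[of 1]]]
    unfolding eventually_sequentially by (metis Diff_iff order_refl)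
  have subF: "coords F \<subseteq> coords (S n)" if "n \<ge> n0" for n using ge(1)[OF that] by (auto simp: coords_def)
  have prob: "prob_space (M n)" if "n \<ge> n0" for n
  proof -
    have "n \<ge> 1" using that n0 by simp
    then interpret sparse_beta_model "M n" n "mu_of \<gamma> n (m0 n)" "beta_of \<alpha> n (S n) (b0 n)" "A n" by (rule model)
    show ?thesis by (rule prob_space_axioms)
  qed
  let ?G = "std_normal_distribution"
  \<comment> \<open>Laws for small \<open>n\<close> and for coordinates outside \<open>F\<close> are filled up with the limit law.\<close>
  define Q where "Q n k = (if n \<ge> n0 \<and> k \<in> coords F then distr (M n) borel (\<lambda>\<omega>. lead n \<omega> k) else ?G)" for n k
  have rdG: "real_distribution ?G" by (rule real_dist_normal_dist)
  have rdQ: "real_distribution (Q n k)" for n k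
  proof (cases "n \<ge> n0 \<and> k \<in> coords F")
    case True
    interpret prob_space "M n" by (rule prob) (use True in simp)
    have "real_distribution (distr (M n) borel (\<lambda>\<omega>. lead n \<omega> k))"
      by (rule real_distribution_distr) (rule lead_measurable, use True n0 in simp)
    then show ?thesis using True by (simp add: Q_def)
  next
    case False
    then have "Q n k = ?G" unfolding Q_def by (rule if_not_P)
    then show ?thesis using rdG by simp
  qed
  \<comment> \<open>Each coordinate of the leading term satisfies the central limit theorem for binomial variables.\<close>
  have convQ: "weak_conv_m (\<lambda>n. Q n k) ?G" for k
  proof (cases "k \<in> coords F")
    case True
    show ?thesis
    proof (rule weak_conv_m_from_char_bound[OF rdQ lead_growth[OF c s1 kF[OF True]]])
      fix t :: real
      show "eventually (\<lambda>n. t\<^sup>2 \<le> 4 * real (card (lead_pairs n k)) \<longrightarrow>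
        cmod (char (Q n k) t - (1 + (- (t\<^sup>2) / 2) / real (card (lead_pairs n k))) ^ card (lead_pairs n k)) \<le> \<bar>t\<bar>^3 / (6 * sqrt (lead_var n k))) sequentially"
        using eventually_ge_at_top[of n0]
      proof eventually_elim
        case (elim n)
        have "n \<ge> 1" "k \<in> coords (S n)" "0 < card (lead_pairs n k)"
          using elim n0 subF True ge(3) by auto
        from lead_char[OF this(1,2) _ this(3), of t] show ?case using elim True by (simp add: Q_def)
      qed
    qed
  next
    case False
    then show ?thesis by (simp add: Q_def weak_conv_m_def weak_conv_def)
  qed
  have eq: "standardized_error \<gamma> \<alpha> n F (m0 n) (b0 n) (mh n \<omega>) (bh n \<omega>) k
       = error_scale n k * (mle_error n \<omega> k * sqrt (lead_var n k))" if "n \<ge> n0" "k \<in> coords F" for n \<omega> k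
    using ge(3)[OF that] that
    by (auto simp: standardized_error_def scaled_error_def error_scale_def mle_error_def split: option.splits)
  define \<delta>' where "\<delta>' n = (\<Sum>k\<in>coords F. \<bar>error_scale n k\<bar> * \<bar>\<delta> n\<bar> + \<bar>error_scale n k - 1\<bar>)" for n
  have "\<delta>' \<longlonglongrightarrow> (\<Sum>k\<in>coords F. \<bar>1\<bar> * \<bar>0\<bar> + \<bar>1 - 1\<bar>)"
    unfolding \<delta>'_def
  proof (intro tendsto_intros \<delta>)
    fix k assume "k \<in> coords F"
    from kF[OF this] show "(\<lambda>n. error_scale n k) \<longlonglongrightarrow> 1"
      using error_scale_None[OF c s1] error_scale_Some[OF c s1] by auto
    then show "(\<lambda>n. error_scale n k) \<longlonglongrightarrow> 1" .
  qed
  then have \<delta>'0: "\<delta>' \<longlonglongrightarrow> 0" by simp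
  show ?thesis
    unfolding std_normal_vec_def
  proof (rule weak_conv_vec_perturb[where ?n0.0 = n0 and Y = "\<lambda>n \<omega>. restrict (lead n \<omega>) (coords F)" and B = B and \<delta> = \<delta>'
        and P = "\<lambda>n. PiM (coords F) (Q n)"])
    show "finite (coords F)" by (rule fin)
    show "prob_space (M n)" if "n \<ge> n0" for n by (rule prob[OF that])
    show "(\<lambda>\<omega>. standardized_error \<gamma> \<alpha> n F (m0 n) (b0 n) (mh n \<omega>) (bh n \<omega>)) \<in> measurable (M n) (PiM (coords F) (\<lambda>_. borel))"
      if n: "n \<ge> n0" for n
      unfolding standardized_error_def
    proof (rule measurable_restrict)
      fix k assume k: "k \<in> coords F"
      have n1: "n \<ge> 1" using n n0 by simp
      have "(\<lambda>\<omega>. scaled_error \<gamma> \<alpha> n (m0 n) (b0 n) (mh n \<omega>) (bh n \<omega>) k) \<in> borel_measurable (M n)"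
      proof (cases k)
        case None
        then show ?thesis using mm[OF n1] by (simp add: scaled_error_def)
      next
        case (Some i)
        then have "i \<in> S n" using k ge(1)[OF n] by (auto simp: coords_def)
        from bm[OF n1 this] show ?thesis using Some by (simp add: scaled_error_def)
      qed
      then show "(\<lambda>\<omega>. Sigma_diag \<gamma> \<alpha> (m0 n) (b0 n) k powr (- 1 / 2) * scaled_error \<gamma> \<alpha> n (m0 n) (b0 n) (mh n \<omega>) (bh n \<omega>) k) \<in> borel_measurable (M n)"
        by simp
    qed
    show "(\<lambda>\<omega>. restrict (lead n \<omega>) (coords F)) \<in> measurable (M n) (PiM (coords F) (\<lambda>_. borel))" if n: "n \<ge> n0" for n
      by (rule measurable_restrict) (rule lead_measurable, use n n0 in simp)
    show "prob_space (PiM (coords F) (Q n))" for n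
      by (rule prob_space_PiM) (rule real_distribution.axioms(1)[OF rdQ])
    show "sets (PiM (coords F) (Q n)) = sets (PiM (coords F) (\<lambda>_. borel))" for n
      by (rule sets_PiM_cong) (simp_all add: real_distribution.events_eq_borel[OF rdQ])
    show "distr (M n) (PiM (coords F) (\<lambda>_. borel)) (\<lambda>\<omega>. restrict (lead n \<omega>) (coords F)) = PiM (coords F) (Q n)" if n: "n \<ge> n0" for n
    proof -
      have "n \<ge> 1" using n n0 by simp
      from lead_joint_distr[OF this ge(1)[OF n]] show ?thesis
        using n by (simp add: Q_def cong: PiM_cong)
    qed
    show "prob_space (PiM (coords F) (\<lambda>_. ?G))"
      by (rule prob_space_PiM) (rule real_distribution.axioms(1)[OF rdG])
    show "sets (PiM (coords F) (\<lambda>_. ?G)) = sets (PiM (coords F) (\<lambda>_. borel))"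
      by (rule sets_PiM_cong) (simp_all add: real_distribution.events_eq_borel[OF rdG])
    show "weak_conv_vec (coords F) (\<lambda>n. PiM (coords F) (Q n)) (PiM (coords F) (\<lambda>_. ?G))"
      by (rule weak_conv_PiM[OF fin rdQ rdG convQ])
    show "B n \<in> sets (M n)" if "n \<ge> n0" for n using B(1) that n0 by simp
    fix n \<omega> k assume n: "n \<ge> n0" and w: "\<omega> \<in> space (M n)" "\<omega> \<notin> B n" and k: "k \<in> coords F"
    let ?y = "lead n \<omega> k" and ?x = "mle_error n \<omega> k * sqrt (lead_var n k)" and ?\<kappa> = "error_scale n k"
    have "\<bar>?x - ?y\<bar> \<le> \<delta> n * (1 + \<bar>?y\<bar>)" using ge(2)[OF n w] subF[OF n] k by auto
    also have "\<dots> \<le> \<bar>\<delta> n\<bar> * (1 + \<bar>?y\<bar>)" by (intro mult_right_mono) auto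
    finally have xy: "\<bar>?x - ?y\<bar> \<le> \<bar>\<delta> n\<bar> * (1 + \<bar>?y\<bar>)" .
    have "?\<kappa> * ?x - ?y = ?\<kappa> * (?x - ?y) + (?\<kappa> - 1) * ?y" by (simp add: algebra_simps)
    then have "\<bar>?\<kappa> * ?x - ?y\<bar> \<le> \<bar>?\<kappa>\<bar> * \<bar>?x - ?y\<bar> + \<bar>?\<kappa> - 1\<bar> * \<bar>?y\<bar>"
      by (metis abs_mult abs_triangle_ineq)
    also have "\<dots> \<le> \<bar>?\<kappa>\<bar> * (\<bar>\<delta> n\<bar> * (1 + \<bar>?y\<bar>)) + \<bar>?\<kappa> - 1\<bar> * (1 + \<bar>?y\<bar>)"
      using xy by (intro add_mono mult_left_mono) auto
    also have "\<dots> = (\<bar>?\<kappa>\<bar> * \<bar>\<delta> n\<bar> + \<bar>?\<kappa> - 1\<bar>) * (1 + \<bar>?y\<bar>)" by (simp add: algebra_simps)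
    also have "\<dots> \<le> \<delta>' n * (1 + \<bar>?y\<bar>)"
      unfolding \<delta>'_def using k fin
      by (intro mult_right_mono member_le_sum[of k "coords F" "\<lambda>k. \<bar>error_scale n k\<bar> * \<bar>\<delta> n\<bar> + \<bar>error_scale n k - 1\<bar>"]) auto
    finally show "\<bar>standardized_error \<gamma> \<alpha> n F (m0 n) (b0 n) (mh n \<omega>) (bh n \<omega>) k - restrict (lead n \<omega>) (coords F) k\<bar>
        \<le> \<delta>' n * (1 + \<bar>restrict (lead n \<omega>) (coords F) k\<bar>)"
      unfolding eq[OF n k] using k by simp
  qed (use B(2) \<delta>'0 in auto)
qed

end

theorem theorem1:
  fixes M :: "nat \<Rightarrow> 'w measure"
    and A :: "nat \<Rightarrow> 'w \<Rightarrow> nat \<Rightarrow> nat \<Rightarrow> bool"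
    and \<mu>0 :: "nat \<Rightarrow> real" and \<beta>0 :: "nat \<Rightarrow> nat \<Rightarrow> real"
    and S :: "nat \<Rightarrow> nat set"
    and \<gamma> \<alpha> :: real
    and M1 M2 :: "nat \<Rightarrow> real"
    and \<mu>0d :: "nat \<Rightarrow> real" and \<beta>0d :: "nat \<Rightarrow> nat \<Rightarrow> real"
    and \<mu>hat :: "nat \<Rightarrow> 'w \<Rightarrow> real" and \<beta>hat :: "nat \<Rightarrow> 'w \<Rightarrow> nat \<Rightarrow> real"
  assumes model: "\<And>n. n \<ge> 1 \<Longrightarrow> sparse_beta_model (M n) n (\<mu>0 n) (\<beta>0 n) (A n)"
    and supp: "\<And>n. n \<ge> 1 \<Longrightarrow> S n = beta_support n (\<beta>0 n)"
    and gamma: "0 \<le> \<gamma>" "\<gamma> < 2"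
    and alpha: "0 \<le> \<alpha>" "\<alpha> < 1"
    and gamma_alpha: "0 \<le> \<gamma> - \<alpha>" "\<gamma> - \<alpha> < 1"
    and bounds_pos: "\<And>n. n \<ge> 1 \<Longrightarrow> M1 n > 0" "\<And>n. n \<ge> 1 \<Longrightarrow> M2 n > 0"
    and bounds_small: "(\<lambda>n. max (M1 n) (M2 n)) \<in> o(\<lambda>n. ln (real n))"
    and true_mu: "\<And>n. n \<ge> 1 \<Longrightarrow> \<mu>0 n = mu_of \<gamma> n (\<mu>0d n)"
    and true_beta: "\<And>n i. n \<ge> 1 \<Longrightarrow> i \<in> {1..n} \<Longrightarrow> \<beta>0 n i = beta_of \<alpha> n (S n) (\<beta>0d n) i"
    and true_in_space: "\<And>n. n \<ge> 1 \<Longrightarrow> (\<mu>0d n, \<beta>0d n) \<in> param_space (S n) (M1 n) (M2 n)"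
    and muhat_meas: "\<And>n. n \<ge> 1 \<Longrightarrow> \<mu>hat n \<in> borel_measurable (M n)"
    and betahat_meas: "\<And>n i. n \<ge> 1 \<Longrightarrow> i \<in> S n \<Longrightarrow> (\<lambda>\<omega>. \<beta>hat n \<omega> i) \<in> borel_measurable (M n)"
    and mle: "\<And>n \<omega>. n \<ge> 1 \<Longrightarrow> \<omega> \<in> space (M n) \<Longrightarrow>
      is_mle \<gamma> \<alpha> n (S n) (M1 n) (M2 n) (A n \<omega>) (\<mu>hat n \<omega>) (\<beta>hat n \<omega>)"
  shows
    "(bar_o (\<lambda>n. real (card (S n))) (\<lambda>n. real n powr (1 - \<alpha>)) \<longrightarrow>
        bar_o_P M (\<lambda>n \<omega>. \<mu>hat n \<omega> - \<mu>0d n) (\<lambda>_. 1) \<and>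
        bar_o_P M (\<lambda>n \<omega>. max_abs (S n) (\<lambda>i. \<beta>hat n \<omega> i - \<beta>0d n i)) (\<lambda>_. 1))
     \<and>
     (\<forall>\<eta> F.
        0 < \<eta> \<longrightarrow>
        (\<forall>n\<ge>1. \<eta> < min (M1 n) (M2 n)) \<longrightarrow>
        (\<forall>n\<ge>1. \<bar>\<mu>0d n\<bar> \<le> M1 n - \<eta>) \<longrightarrow>
        (\<forall>n\<ge>1. \<forall>i\<in>S n. \<eta> \<le> \<beta>0d n i \<and> \<beta>0d n i \<le> M2 n - \<eta>) \<longrightarrow>
        bar_o (\<lambda>n. real (card (S n))) (\<lambda>n. real n powr ((1 - \<alpha>) / 2)) \<longrightarrow>
        (\<forall>\<^sub>F n in sequentially. F \<subseteq> S n) \<longrightarrow>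
        weak_conv_vec (coords F)
          (\<lambda>n. distr (M n) (PiM (coords F) (\<lambda>_. borel))
                 (\<lambda>\<omega>. standardized_error \<gamma> \<alpha> n F (\<mu>0d n) (\<beta>0d n) (\<mu>hat n \<omega>) (\<beta>hat n \<omega>)))
          (std_normal_vec (coords F)))"
proof (intro conjI impI allI)
  have Sn: "S n \<subseteq> {1..n}" if "n \<ge> 1" for n
    using supp[OF that] by (auto simp: beta_support_def)
  interpret sbm_sequence M A S \<gamma> \<alpha> M1 M2 \<mu>0d \<beta>0d \<mu>hat \<beta>hat
  proof (rule sbm_sequence.intro)
    fix n :: nat assume n: "n \<ge> 1"
    show "sparse_beta_model (M n) n (mu_of \<gamma> n (\<mu>0d n)) (beta_of \<alpha> n (S n) (\<beta>0d n)) (A n)"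
      using sparse_beta_model_cong[OF model[OF n] true_beta[OF n]] true_mu[OF n] by simp
  qed (use Sn gamma alpha gamma_alpha bounds_pos bounds_small true_in_space mle in auto)
  have prob: "prob_space (M n)" if "n \<ge> 1" for n
    by (rule sparse_beta_model.axioms(1)[OF model[OF that]])
  {
    assume "bar_o (\<lambda>n. real (card (S n))) (\<lambda>n. real n powr (1 - \<alpha>))"
    then obtain c where "0 < c" "eventually (\<lambda>n. real (card (S n)) \<le> real n powr (1 - \<alpha> - c)) sequentially"
      using bar_o_powrD by blast
    from consistency[OF this] obtain c' B where c': "0 < c'" and B: "\<forall>n\<ge>1. B n \<in> sets (M n)" "(\<lambda>n. measure (M n) (B n)) \<longlonglongrightarrow> 0"
      and ev: "eventually (\<lambda>n. \<forall>\<omega>\<in>space (M n) - B n. \<bar>\<mu>hat n \<omega> - \<mu>0d n\<bar> \<le> real n powr (- c') \<and>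
        (\<forall>k\<in>S n. \<bar>\<beta>hat n \<omega> k - \<beta>0d n k\<bar> \<le> real n powr (- c'))) sequentially"
      by blast
    show "bar_o_P M (\<lambda>n \<omega>. \<mu>hat n \<omega> - \<mu>0d n) (\<lambda>_. 1)"
      by (rule bar_o_P_if_small_off_null_events[OF c' prob _ B(2)]) (use B(1) ev in \<open>auto elim: eventually_mono\<close>)
    show "bar_o_P M (\<lambda>n \<omega>. max_abs (S n) (\<lambda>i. \<beta>hat n \<omega> i - \<beta>0d n i)) (\<lambda>_. 1)"
    proof (rule bar_o_P_if_small_off_null_events[OF c' prob _ B(2)])
      show "eventually (\<lambda>n. \<forall>\<omega>\<in>space (M n) - B n. \<bar>max_abs (S n) (\<lambda>i. \<beta>hat n \<omega> i - \<beta>0d n i)\<bar> \<le> real n powr (- c')) sequentially"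
        using ev eventually_ge_at_top[of 1]
      proof eventually_elim
        case (elim n)
        have "finite (S n)" using finite_subset[OF Sn[OF elim(2)]] by simp
        then show ?case using elim(1) by (intro ballI max_abs_le) auto
      qed
    qed (use B(1) in auto)
  }
  fix \<eta> F
  assume eta: "0 < \<eta>" "\<forall>n\<ge>1. \<bar>\<mu>0d n\<bar> \<le> M1 n - \<eta>" "\<forall>n\<ge>1. \<forall>i\<in>S n. \<eta> \<le> \<beta>0d n i \<and> \<beta>0d n i \<le> M2 n - \<eta>"
    and o: "bar_o (\<lambda>n. real (card (S n))) (\<lambda>n. real n powr ((1 - \<alpha>) / 2))"
    and F: "\<forall>\<^sub>F n in sequentially. F \<subseteq> S n"
  from bar_o_powrD[OF o] obtain c where c: "0 < c" "eventually (\<lambda>n. real (card (S n)) \<le> real n powr ((1 - \<alpha>) / 2 - c)) sequentially"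
    by blast
  show "weak_conv_vec (coords F)
          (\<lambda>n. distr (M n) (PiM (coords F) (\<lambda>_. borel))
                 (\<lambda>\<omega>. standardized_error \<gamma> \<alpha> n F (\<mu>0d n) (\<beta>0d n) (\<mu>hat n \<omega>) (\<beta>hat n \<omega>)))
          (std_normal_vec (coords F))"
    by (rule asymptotic_normality[OF c eta(1) _ _ F muhat_meas betahat_meas]) (use eta in auto)
qed

end
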